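(* Let $U=[a_1,b_1]\cup\dots\cup[a_k,b_k]\subseteq\mathbb{R}$ with $a_1\le b_1<a_2\le b_2<\dots<a_k\le b_k$, with natural choice of generators $N=\{x-a_1,\ (x-a_2)(x-b_1),\ \dots,\ (x-a_k)(x-b_{k-1}),\ b_k-x\}$, and let $q(x)\in\mathbb{R}[x]$ satisfy $q(x)\ge0$ on $U$. Let $S=N\cup\{y-q(x)\}\subseteq\mathbb{R}[x,y]$, so that $K_S=\{(x,y)\in\mathbb{R}^2: x\in U,\ y\ge q(x)\}$, and let $T$ be the preordering in $\mathbb{R}[x,y]$ generated by $S$. Then $T$ is saturated: every $f\in\mathbb{R}[x,y]$ with $f\ge0$ on $K_S$ lies in $T$.
   Context: For a finite set $S=\{s_1,\dots,s_m\}\subseteq\mathbb{R}[x,y]$, the preordering generated by $S$ is the set of all $\sum_{e\in\{0,1\}^m}\sigma_e s_1^{e_1}\cdots s_m^{e_m}$ with each $\sigma_e$ a sum of squares of polynomials in $\mathbb{R}[x,y]$; $K_S=\{p\in\mathbb{R}^2: s_i(p)\ge0\ \forall i\}$. The preordering is saturated if it contains every polynomial non-negative on $K_S$. *)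

theory Defs
  imports "HOL-Computational_Algebra.Polynomial"
begin

text \<open>The bivariate polynomial ring R[x,y] is represented as (R[x])[y], i.e. the type
  real poly poly: a polynomial in y whose coefficients are polynomials in x.\<close>

definition eval2 :: "real poly poly \<Rightarrow> real \<Rightarrow> real \<Rightarrow> real" where
  "eval2 f x y = poly (map_poly (\<lambda>c. poly c x) f) y"

definition varX :: "real poly poly" where "varX = [:[:0, 1:]:]"
definition varY :: "real poly poly" where "varY = [:0, 1:]"

definition liftx :: "real poly \<Rightarrow> real poly poly" where "liftx p = [:p:]"

definition is_sos :: "real poly poly \<Rightarrow> bool" where
  "is_sos p \<longleftrightarrow> (\<exists>L. p = sum_list (map (\<lambda>q. q ^ 2) L))"

definition preordering :: "real poly poly list \<Rightarrow> real poly poly set" where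
  "preordering s = {f. \<exists>\<sigma>. (\<forall>I. is_sos (\<sigma> I)) \<and>
      f = (\<Sum>I\<in>Pow {..<length s}. \<sigma> I * (\<Prod>i\<in>I. s ! i))}"

definition basic_set :: "real poly poly list \<Rightarrow> (real \<times> real) set" where
  "basic_set s = {(x, y). \<forall>i<length s. eval2 (s ! i) x y \<ge> 0}"

definition saturated :: "real poly poly list \<Rightarrow> bool" where
  "saturated s \<longleftrightarrow>
     (\<forall>f. (\<forall>(x, y)\<in>basic_set s. eval2 f x y \<ge> 0) \<longrightarrow> f \<in> preordering s)"

text \<open>Natural generators of U = [a_0,b_0] \<union> ... \<union> [a_{k-1},b_{k-1}] (0-indexed):
  x - a_0, (x - a_{i+1})(x - b_i) for i < k-1, and b_{k-1} - x.\<close>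
definition natural_gens :: "nat \<Rightarrow> (nat \<Rightarrow> real) \<Rightarrow> (nat \<Rightarrow> real) \<Rightarrow> real poly poly list" where
  "natural_gens k a b =
     [liftx [:- a 0, 1:]] @
     map (\<lambda>i. liftx ([:- a (Suc i), 1:] * [:- b i, 1:])) [0..<k - 1] @
     [liftx [:b (k - 1), -1:]]"

end

theory Submission
  imports Defs "HOL-Analysis.Analysis" "HOL-Computational_Algebra.Computational_Algebra"
    "HOL-Computational_Algebra.Field_as_Ring"
begin

text \<open>Substituting y = q(x) + z^2 turns f into a polynomial in x and z that is non-negative on
  the strip U \<times> R; splitting a representation of it as a sum of c(x) p(x,z)^2 into even
  and odd parts in z gives back a representation of f, with y - q as the additional generator.

  On the strip write f = g^2 h with h free of squares of positive degree in y. A combination of h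
  and its y-derivative is a non-zero polynomial in x alone, hence h \<ge> \<kappa> c(x) (1 + y^2)^d where c has only
  finitely many zeros, all in U. Away from these zeros h is strictly positive, including at infinity, and
  Bernstein approximation in x gives a representation. Near a zero, Newton-Puiseux shows
  that h factors over C[[x]] as g times its conjugate: a rotation orbit of
  Puiseux roots that is stable under conjugation would contain a real root. So h is a
  sum of two squares over R[[x]]. Truncating these power series and gluing with weights that are squares
  of polynomials leaves a remainder c R with R strictly positive.\<close>

subsection \<open>Ring homomorphisms and substitution in power series\<close>

text \<open>The strip is not compact in y, so positivity could be lost at infinity. Therefore bounds
  are measured against \<open>(1 + y^2)^d\<close> and \<open>ycone\<close> limits the y-degree of
  every square: a lower bound of this shape also controls the leading coefficient, that is, the
  fibre at infinity. Multipliers depend on x alone, so they pass unchanged through the even-odd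
  splitting in z. The term \<open>\<kappa> c (1 + y^2)^d\<close> is subtracted before the local
  representations are formed, and these only have to match modulo \<open>(x - \<beta>)^(2N)\<close>,
  twice the order N of c at \<open>\<beta>\<close>: what remains can then be divided by c without
  losing strictness at the zeros of c. Boundary points shape the local step. At an endpoint the
  bound holds on one side only; inserting a square for the local parameter makes it two-sided, and
  the parameter returns as a multiplier. It need not be nonnegative on U, but it is congruent, to
  any order, to a member of the preordering. At an isolated point this is true of both signs of the
  parameter, so there only the fibre itself has to be nonnegative.\<close>

locale rhom =
  fixes h :: "'a::comm_ring_1 \<Rightarrow> 'b::comm_ring_1"
  assumes hom_add: "h (x + y) = h x + h y"
    and hom_mult: "h (x * y) = h x * h y"
    and hom_one: "h 1 = 1"
begin

lemma hom_zero [simp]: "h 0 = 0"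
  using hom_add[of 0 0] by simp

lemma hom_uminus: "h (- x) = - h x"
  using hom_add[of x "- x"] by (simp add: eq_neg_iff_add_eq_0 add.commute)

lemma hom_diff: "h (x - y) = h x - h y"
  using hom_add[of x "- y"] by (simp add: hom_uminus)

lemma hom_sum: "h (sum f A) = (\<Sum>x\<in>A. h (f x))"
  by (induction A rule: infinite_finite_induct) (auto simp: hom_add)

lemma hom_prod: "h (prod f A) = (\<Prod>x\<in>A. h (f x))"
  by (induction A rule: infinite_finite_induct) (auto simp: hom_mult hom_one)

lemma hom_power: "h (x ^ n) = h x ^ n"
  by (induction n) (auto simp: hom_mult hom_one)

lemma poly_map_hom: "poly (map_poly h p) (h x) = h (poly p x)"
  by (induction p) (auto simp: map_poly_pCons hom_add hom_mult)

lemma rhom_map_poly: "rhom (map_poly h)"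
proof
  show add: "map_poly h (p + q) = map_poly h p + map_poly h q" for p q
    by (intro poly_eqI) (simp add: coeff_map_poly hom_add)
  show "map_poly h (p * q) = map_poly h p * map_poly h q" for p q
    by (intro poly_eqI) (simp add: coeff_map_poly coeff_mult hom_sum hom_mult)
  show "map_poly h 1 = 1" by (simp add: hom_one)
qed

lemma rhom_poly_map: "rhom (\<lambda>p. poly (map_poly h p) z)"
proof -
  interpret m: rhom "map_poly h" by (rule rhom_map_poly)
  show ?thesis
    by standard (simp_all add: m.hom_add m.hom_mult m.hom_one)
qed

lemma monic_map_poly:
  assumes "lead_coeff p = 1"
  shows "degree (map_poly h p) = degree p" "lead_coeff (map_poly h p) = 1"
proof -
  show "degree (map_poly h p) = degree p"
    using assms by (intro map_poly_degree_eq) (simp add: hom_one)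
  then show "lead_coeff (map_poly h p) = 1"
    using assms by (simp add: coeff_map_poly hom_one)
qed

end

text \<open>The substitution X -> c X^q. With c = 1 the new variable is a q-th root of the old one
  (ramification); with q = 1 and c a root of unity it is a rotation of that extension; with c = -1
  and real coefficients it looks at the negative side of 0.\<close>

definition ssub :: "'a::field \<Rightarrow> nat \<Rightarrow> 'a fps \<Rightarrow> 'a fps" where
  "ssub c q f = f oo (fps_const c * fps_X ^ q)"

lemma rhom_ssub: "q > 0 \<Longrightarrow> rhom (ssub c q)"
  unfolding ssub_def
  by standard (auto simp: fps_compose_add_distrib intro!: fps_compose_mult_distrib)

lemma ssub_nth:
  assumes "q > 0"
  shows "fps_nth (ssub c q f) n = (if q dvd n then c ^ (n div q) * fps_nth f (n div q) else 0)"
proof -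
  have "fps_nth ((fps_const c * fps_X ^ q) ^ i) n = (if n = q * i then c ^ i else 0)" for i
    by (simp add: power_mult_distrib flip: power_mult fps_const_power)
      (auto simp: fps_X_power_nth)
  then have "fps_nth (ssub c q f) n = (\<Sum>i=0..n. fps_nth f i * (if n = q * i then c ^ i else 0))"
    by (simp add: ssub_def fps_compose_nth)
  also have "\<dots> = (if q dvd n then c ^ (n div q) * fps_nth f (n div q) else 0)"
  proof (cases "q dvd n")
    case True
    then obtain k where k: "n = q * k" by auto
    have "(\<Sum>i=0..n. fps_nth f i * (if n = q * i then c ^ i else 0)) = (\<Sum>i=0..n. if i = k then c ^ k * fps_nth f k else 0)"
      using assms k by (intro sum.cong) auto
    then show ?thesis using assms k by auto
  next
    case False
    then have "n \<noteq> q * i" for i by auto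
    then show ?thesis using False by simp
  qed
  finally show ?thesis .
qed

lemma ssub_ssub:
  assumes "q > 0" "r > 0"
  shows "ssub d r (ssub c q f) = ssub (c * d ^ q) (q * r) f"
proof (rule fps_ext)
  fix n
  show "fps_nth (ssub d r (ssub c q f)) n = fps_nth (ssub (c * d ^ q) (q * r) f) n"
    using assms
    by (auto simp: ssub_nth power_mult_distrib div_mult2_eq mult.commute dvd_mult_div_cancel simp flip: power_mult div_mult2_eq)
qed

lemma ssub_inj: "q > 0 \<Longrightarrow> c \<noteq> 0 \<Longrightarrow> ssub c q f = ssub c q g \<Longrightarrow> f = g"
proof (rule fps_ext)
  fix n assume a: "q > 0" "c \<noteq> 0" "ssub c q f = ssub c q g"
  have "fps_nth (ssub c q f) (q * n) = fps_nth (ssub c q g) (q * n)" using a by simp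
  then show "fps_nth f n = fps_nth g n" using a(1,2) by (simp add: ssub_nth)
qed

lemma ssub_X_power: "q > 0 \<Longrightarrow> ssub c q (fps_X ^ k) = fps_const (c ^ k) * fps_X ^ (q * k)"
  unfolding ssub_def
  by (subst fps_X_power_compose) (auto simp: power_mult_distrib fps_const_power simp flip: power_mult)

subsection \<open>Evaluation of bivariate polynomials\<close>

lemma rhom_eval: "rhom (\<lambda>p::real poly. poly p x)"
  by standard auto

interpretation ev: rhom "\<lambda>f. eval2 f x y" for x y
  unfolding eval2_def by (rule rhom.rhom_poly_map[OF rhom_eval])

definition fib :: "real poly poly \<Rightarrow> real \<Rightarrow> real poly" where
  "fib f x = map_poly (\<lambda>c. poly c x) f"

lemma poly_fib: "poly (fib f x) y = eval2 f x y"
  by (simp add: fib_def eval2_def)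

lemma coeff_fib [simp]: "coeff (fib f x) i = poly (coeff f i) x"
  by (simp add: fib_def coeff_map_poly)

lemma degree_fib_le: "degree (fib f x) \<le> degree f"
  by (simp add: fib_def map_poly_degree_leq)

lemma eval2_0 [simp]: "eval2 0 x y = 0"
  by (simp add: eval2_def)

lemma eval2_pCons [simp]: "eval2 (pCons c f) x y = poly c x + y * eval2 f x y"
  by (simp add: eval2_def map_poly_pCons)

lemma eval2_smult [simp]: "eval2 (smult c f) x y = poly c x * eval2 f x y"
  using ev.hom_mult[of "[:c:]" f x y] by simp

lemma eval2_altdef:
  assumes "degree f \<le> n"
  shows "eval2 f x y = (\<Sum>i\<le>n. poly (coeff f i) x * y ^ i)"
proof -
  have "degree (fib f x) \<le> n" using degree_fib_le assms order_trans by blast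
  then have "fib f x = (\<Sum>i\<le>n. monom (coeff (fib f x) i) i)" by (metis poly_as_sum_of_monoms')
  then have "poly (fib f x) y = poly (\<Sum>i\<le>n. monom (coeff (fib f x) i) i) y" by metis
  then show ?thesis by (simp add: poly_fib poly_sum poly_monom)
qed

text \<open>The weight \<open>(1 + y\<^sup>2) ^ d\<close> dominates all monomials of degree at most
  2d, also near 0; bounds relative to it are uniform in the unbounded variable.\<close>

lemma abs_power_le:
  fixes y :: real
  assumes "i \<le> 2 * d" shows "\<bar>y\<bar> ^ i \<le> (1 + y\<^sup>2) ^ d"
proof (cases "\<bar>y\<bar> \<le> 1")
  case True
  then have "\<bar>y\<bar> ^ i \<le> 1" by (simp add: power_le_one)
  also have "\<dots> \<le> (1 + y\<^sup>2) ^ d" by (rule one_le_power) simp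
  finally show ?thesis .
next
  case False
  then have "\<bar>y\<bar> ^ i \<le> \<bar>y\<bar> ^ (2 * d)" using assms by (intro power_increasing) auto
  also have "\<dots> = (y\<^sup>2) ^ d" by (simp add: power_mult)
  also have "\<dots> \<le> (1 + y\<^sup>2) ^ d" by (rule power_mono) auto
  finally show ?thesis .
qed

lemma abs_eval2_le:
  assumes "degree f \<le> 2 * d"
  shows "\<bar>eval2 f x y\<bar> \<le> (\<Sum>i\<le>2 * d. \<bar>poly (coeff f i) x\<bar>) * (1 + y\<^sup>2) ^ d"
proof -
  have "\<bar>eval2 f x y\<bar> \<le> (\<Sum>i\<le>2 * d. \<bar>poly (coeff f i) x * y ^ i\<bar>)"
    unfolding eval2_altdef[OF assms] by (rule sum_abs)
  also have "\<dots> \<le> (\<Sum>i\<le>2 * d. \<bar>poly (coeff f i) x\<bar> * (1 + y\<^sup>2) ^ d)"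
    by (intro sum_mono) (auto simp: abs_mult power_abs intro!: mult_left_mono abs_power_le)
  finally show ?thesis by (simp add: sum_distrib_right)
qed

lemma poly_bounded:
  fixes p :: "real poly"
  assumes "compact U"
  obtains K where "K > 0" "\<And>x. x \<in> U \<Longrightarrow> \<bar>poly p x\<bar> \<le> K"
proof -
  have "compact (poly p ` U)" using assms by (intro compact_continuous_image continuous_intros)
  then obtain K where "K > 0" "\<forall>z\<in>poly p ` U. norm z \<le> K"
    using compact_imp_bounded bounded_pos by blast
  then show ?thesis using that by auto
qed

lemma eval2_bounded:
  assumes "compact U" "degree f \<le> 2 * d"
  obtains K where "K > 0" "\<And>x y. x \<in> U \<Longrightarrow> \<bar>eval2 f x y\<bar> \<le> K * (1 + y\<^sup>2) ^ d"
proof -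
  have "\<exists>K>0. \<forall>x\<in>U. \<bar>poly (coeff f i) x\<bar> \<le> K" for i
    using poly_bounded[OF assms(1)] by metis
  then obtain K where K: "\<And>i. K i > 0" "\<And>i x. x \<in> U \<Longrightarrow> \<bar>poly (coeff f i) x\<bar> \<le> K i" by metis
  show ?thesis
  proof (rule that[of "\<Sum>i\<le>2 * d. K i"])
    show "(\<Sum>i\<le>2 * d. K i) > 0" by (rule sum_pos) (auto simp: K)
    fix x y assume "x \<in> U"
    have "\<bar>eval2 f x y\<bar> \<le> (\<Sum>i\<le>2 * d. \<bar>poly (coeff f i) x\<bar>) * (1 + y\<^sup>2) ^ d"
      by (rule abs_eval2_le[OF assms(2)])
    also have "\<dots> \<le> (\<Sum>i\<le>2 * d. K i) * (1 + y\<^sup>2) ^ d"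
      by (intro mult_right_mono sum_mono K \<open>x \<in> U\<close>) auto
    finally show "\<bar>eval2 f x y\<bar> \<le> (\<Sum>i\<le>2 * d. K i) * (1 + y\<^sup>2) ^ d" .
  qed
qed

lemma psd_coeff_nonneg:
  fixes r :: "real poly"
  assumes "\<And>y. poly r y \<ge> 0" "degree r \<le> n"
  shows "coeff r n \<ge> 0"
proof (rule ccontr)
  assume a: "\<not> coeff r n \<ge> 0"
  then have "degree r = n" using assms(2) by (metis coeff_eq_0 le_less order_refl)
  then have "lead_coeff (- r) > 0" using a by simp
  then obtain m where "\<forall>x\<ge>m. lead_coeff (- r) \<le> poly (- r) x" using poly_pinfty_gt_lc by blast
  then have "poly r m < 0" using \<open>lead_coeff (- r) > 0\<close> by (auto dest: spec[of _ m])
  then show False using assms(1)[of m] by simp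
qed

text \<open>The bound is inherited at infinity: \<open>p - k (1 + y^2)^d\<close> is nonnegative,
  hence so is its coefficient at 2d, and that of \<open>(1 + y^2)^d\<close> is 1.\<close>

lemma coeff_ge_of_ge:
  fixes p :: "real poly"
  assumes "\<And>y. poly p y \<ge> k * (1 + y\<^sup>2) ^ d" "degree p \<le> 2 * d"
  shows "coeff p (2 * d) \<ge> k"
proof -
  have deg: "degree ([:1, 0, 1:] ^ d :: real poly) = 2 * d" by (simp add: degree_power_eq)
  have "lead_coeff ([:1, 0, 1:] ^ d :: real poly) = 1" by (subst lead_coeff_power) simp
  then have c: "coeff ([:1, 0, 1:] ^ d :: real poly) (2 * d) = 1" by (simp add: deg)
  have "coeff (p - smult k ([:1, 0, 1:] ^ d)) (2 * d) \<ge> 0"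
  proof (rule psd_coeff_nonneg)
    show "poly (p - smult k ([:1, 0, 1:] ^ d)) y \<ge> 0" for y
      using assms(1)[of y] by (simp add: poly_power power2_eq_square)
    have "degree (smult k ([:1, 0, 1:] ^ d)) \<le> 2 * d" using deg degree_smult_le order_trans by metis
    then show "degree (p - smult k ([:1, 0, 1:] ^ d)) \<le> 2 * d"
      using assms(2) by (intro degree_diff_le)
  qed
  then show ?thesis by (simp add: c)
qed

subsection \<open>Hensel's lemma and the Newton-Puiseux theorem\<close>

text \<open>A polynomial over K[[X]] is read as a power series in X with coefficients in K[y];
  Hensel lifting proceeds along these coefficients.\<close>

definition slice :: "nat \<Rightarrow> 'a::field fps poly \<Rightarrow> 'a poly" where
  "slice k P = map_poly (\<lambda>a. fps_nth a k) P"

lemma coeff_slice [simp]: "coeff (slice k P) j = fps_nth (coeff P j) k"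
  by (simp add: slice_def coeff_map_poly)

lemma slice_eqI: "(\<And>k. slice k P = slice k Q) \<Longrightarrow> P = Q"
  by (intro poly_eqI fps_ext) (metis coeff_slice)

lemma slice_mult: "slice k (P * Q) = (\<Sum>i\<le>k. slice i P * slice (k - i) Q)"
proof (rule poly_eqI)
  fix n
  have "coeff (slice k (P * Q)) n = (\<Sum>j\<le>n. \<Sum>i\<le>k. fps_nth (coeff P j) i * fps_nth (coeff Q (n - j)) (k - i))"
    by (simp add: coeff_mult fps_sum_nth fps_mult_nth atMost_atLeast0)
  also have "\<dots> = (\<Sum>i\<le>k. \<Sum>j\<le>n. fps_nth (coeff P j) i * fps_nth (coeff Q (n - j)) (k - i))"
    by (rule sum.swap)
  finally show "coeff (slice k (P * Q)) n = coeff (\<Sum>i\<le>k. slice i P * slice (k - i) Q) n"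
    by (simp add: coeff_mult coeff_sum)
qed

lemma fps_poly_of_slices:
  fixes S :: "nat \<Rightarrow> 'a::field poly"
  assumes "\<And>k. degree (S k) \<le> n"
  obtains P where "\<And>k. slice k P = S k"
proof
  fix k
  show "slice k (\<Sum>j\<le>n. monom (Abs_fps (\<lambda>k. coeff (S k) j)) j) = S k"
  proof (rule poly_eqI)
    fix i
    show "coeff (slice k (\<Sum>j\<le>n. monom (Abs_fps (\<lambda>k. coeff (S k) j)) j)) i = coeff (S k) i"
      using assms[of k] by (simp add: coeff_sum coeff_eq_0 not_le)
  qed
qed

lemma monic_of_slices:
  fixes P :: "'a::field fps poly"
  assumes "slice 0 P = A" "lead_coeff A = 1" "\<And>k j. k > 0 \<Longrightarrow> j \<ge> degree A \<Longrightarrow> coeff (slice k P) j = 0"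
  shows "degree P = degree A" "lead_coeff P = 1"
proof -
  have c: "coeff P j = (if j = degree A then 1 else 0)" if "j \<ge> degree A" for j
  proof (rule fps_ext)
    fix k
    show "fps_nth (coeff P j) k = fps_nth (if j = degree A then 1 else 0) k"
    proof (cases "k = 0")
      case True
      have "fps_nth (coeff P j) 0 = coeff A j" using assms(1) by (metis coeff_slice)
      then show ?thesis using True that assms(2) by (auto simp: coeff_eq_0)
    next
      case False
      then show ?thesis using assms(3)[of k j] that by auto
    qed
  qed
  then show 1: "degree P = degree A"
    by (intro antisym degree_le le_degree) (auto simp: c)
  show "lead_coeff P = 1" using 1 c by simp
qed

text \<open>Reducing \<open>R * v\<close> modulo A fixes the degree of a; b is then forced, and its
  degree bound follows by counting degrees in \<open>A * b = R - a * B\<close>. These bounds keep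
  the lifted factors monic of unchanged degree.\<close>

lemma bezout_solve:
  fixes A B R :: "'a::field_gcd poly"
  assumes "coprime A B" "A \<noteq> 0" "B \<noteq> 0" "R = 0 \<or> degree R < degree A + degree B"
  obtains a b where "A * b + a * B = R" "a = 0 \<or> degree a < degree A" "b = 0 \<or> degree b < degree B"
proof -
  define v where "v = snd (bezout_coefficients A B)"
  define u where "u = fst (bezout_coefficients A B)"
  have uv: "u * A + v * B = 1"
    using bezout_coefficients_fst_snd[of A B] assms(1) unfolding u_def v_def by simp
  define a where "a = (R * v) mod A"
  have "R - a * B = R * (u * A + v * B) - a * B" by (simp add: uv)
  also have "\<dots> = A * (R * u) + (R * v - a) * B" by (simp add: algebra_simps)
  also have "A dvd \<dots>" unfolding a_def by (simp add: minus_mod_eq_mult_div)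
  finally obtain b where b: "R - a * B = A * b" by auto
  have a: "a = 0 \<or> degree a < degree A"
    using assms(2) unfolding a_def by (rule degree_mod_less)
  have "degree b < degree B" if "b \<noteq> 0"
  proof -
    have "degree (A * b) < degree A + degree B"
    proof -
      have "degree (a * B) < degree A + degree B" if "a * B \<noteq> 0"
        using a that by (auto simp: degree_mult_eq)
      moreover have "A * b \<noteq> 0" using \<open>b \<noteq> 0\<close> assms(2) by simp
      moreover have "degree (R - a * B) \<le> max (degree R) (degree (a * B))"
        by (rule degree_diff_le_max)
      ultimately show ?thesis using assms(4) unfolding b[symmetric]
        by (cases "R = 0"; cases "a * B = 0") auto
    qed
    then show ?thesis using that assms(2) by (simp add: degree_mult_eq)
  qed
  moreover have "A * b + a * B = R" using b by (simp add: algebra_simps)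
  ultimately show ?thesis using a that by blast
qed

lemma sum_atMost_ends:
  fixes f :: "nat \<Rightarrow> 'a::comm_monoid_add"
  assumes "k > 0"
  shows "(\<Sum>i\<le>k. f i) = f 0 + f k + (\<Sum>i\<in>{0<..<k}. f i)"
proof -
  have "{..k} = insert 0 (insert k {0<..<k})" using assms by auto
  then show ?thesis using assms by (simp add: add.assoc)
qed

lemma hensel:
  fixes P :: "'a::field_gcd fps poly"
  assumes P: "lead_coeff P = 1" and f: "slice 0 P = A0 * B0"
    and A0: "lead_coeff A0 = 1" and B0: "lead_coeff B0 = 1" and co: "coprime A0 B0"
  obtains A B where "P = A * B" "lead_coeff A = 1" "degree A = degree A0"
    "lead_coeff B = 1" "degree B = degree B0"
proof -
  \<comment> \<open>The slices of both factors are found by well-founded recursion. Comparing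
    coefficients of X^k in P = A B leaves a linear equation for the pair at k, in which the products
    of earlier slices are known; corrections stay below the degrees of \<open>A0\<close> and
    \<open>B0\<close>.\<close>
  define Rec where "Rec S k ab \<longleftrightarrow>
      (if k = 0 then ab = (A0, B0) else
       (fst ab = 0 \<or> degree (fst ab) < degree A0) \<and> (snd ab = 0 \<or> degree (snd ab) < degree B0) \<and>
       A0 * snd ab + fst ab * B0 + (\<Sum>i\<in>{0<..<k}. fst (S i) * snd (S (k - i))) = slice k P)"
    for S :: "nat \<Rightarrow> 'a poly \<times> 'a poly" and k ab
  have nz: "A0 \<noteq> 0" "B0 \<noteq> 0" using A0 B0 by auto
  have dP: "degree P = degree A0 + degree B0"
  proof -
    have "coeff (slice 0 P) (degree P) = 1" using P by simp
    then have "degree P \<le> degree (slice 0 P)" by (intro le_degree) auto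
    moreover have "degree (slice 0 P) \<le> degree P" by (simp add: slice_def map_poly_degree_leq)
    ultimately show ?thesis using nz by (simp add: f degree_mult_eq)
  qed
  have "\<exists>S. \<forall>k. Rec S k (S k)"
  proof (rule dependent_wf_choice[of "{(x, y). x < y}"])
    show "wf {(x, y::nat). x < y}" by (rule wf_less)
    fix S1 S2 :: "nat \<Rightarrow> 'a poly \<times> 'a poly" and k ab
    assume eq: "\<And>z. (z, k) \<in> {(x, y). x < y} \<Longrightarrow> S1 z = S2 z"
    have "(\<Sum>i\<in>{0<..<k}. fst (S1 i) * snd (S1 (k - i))) = (\<Sum>i\<in>{0<..<k}. fst (S2 i) * snd (S2 (k - i)))"
      by (intro sum.cong refl) (use eq in auto)
    then show "Rec S1 k ab = Rec S2 k ab" by (simp add: Rec_def)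
  next
    fix k and S :: "nat \<Rightarrow> 'a poly \<times> 'a poly"
    assume IH: "\<And>z. (z, k) \<in> {(x, y). x < y} \<Longrightarrow> Rec S z (S z)"
    show "\<exists>ab. Rec S k ab"
    proof (cases "k = 0")
      case False
      define R where "R = slice k P - (\<Sum>i\<in>{0<..<k}. fst (S i) * snd (S (k - i)))"
      \<comment> \<open>P is monic of degree deg A0 + deg B0, so its slices beyond the first have
        smaller degree; the same is true of the earlier products. This is the degree hypothesis of
        \<open>bezout_solve\<close>.\<close>
      have cR: "coeff R j = 0" if "j \<ge> degree A0 + degree B0" for j
      proof -
        have "coeff (slice k P) j = 0"
          using that dP P False by (cases "j = degree P") (auto simp: coeff_eq_0)
        moreover have "coeff (fst (S i) * snd (S (k - i))) j = 0" if i: "i \<in> {0<..<k}" for i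
        proof -
          have "Rec S i (S i)" "Rec S (k - i) (S (k - i))" using IH i by auto
          then have "fst (S i) = 0 \<or> degree (fst (S i)) < degree A0"
            "snd (S (k - i)) = 0 \<or> degree (snd (S (k - i))) < degree B0" using i by (auto simp: Rec_def)
          then show ?thesis using \<open>j \<ge> _\<close> degree_mult_le[of "fst (S i)" "snd (S (k - i))"]
            by (cases "fst (S i) = 0 \<or> snd (S (k - i)) = 0") (auto simp: coeff_eq_0)
        qed
        ultimately show ?thesis by (simp add: R_def coeff_sum)
      qed
      have "R = 0 \<or> degree R < degree A0 + degree B0"
        using cR by (metis leading_coeff_0_iff not_le)
      then obtain a b where "A0 * b + a * B0 = R" "a = 0 \<or> degree a < degree A0" "b = 0 \<or> degree b < degree B0"
        using bezout_solve[OF co nz] by metis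
      then have "Rec S k (a, b)" using False by (simp add: Rec_def R_def)
      then show ?thesis by blast
    qed (auto simp: Rec_def)
  qed
  then obtain S where S: "\<And>k. Rec S k (S k)" by blast
  have S0: "S 0 = (A0, B0)" using S[of 0] by (simp add: Rec_def)
  have dS: "fst (S k) = 0 \<or> degree (fst (S k)) < degree A0" "snd (S k) = 0 \<or> degree (snd (S k)) < degree B0"
    if "k > 0" for k using S[of k] that by (auto simp: Rec_def)
  have cS: "coeff (fst (S k)) j = 0" if "k > 0" "j \<ge> degree A0" for k j
    using dS(1)[OF that(1)] that(2) by (cases "fst (S k) = 0") (simp_all add: coeff_eq_0)
  have cS': "coeff (snd (S k)) j = 0" if "k > 0" "j \<ge> degree B0" for k j
    using dS(2)[OF that(1)] that(2) by (cases "snd (S k) = 0") (simp_all add: coeff_eq_0)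
  note cS = cS cS'
  have "degree (fst (S k)) \<le> degree A0" "degree (snd (S k)) \<le> degree B0" for k
    using dS[of k] by (cases "k = 0"; auto simp: S0)+
  then obtain A B where A: "\<And>k. slice k A = fst (S k)" and B: "\<And>k. slice k B = snd (S k)"
    using fps_poly_of_slices[of "\<lambda>k. fst (S k)"] fps_poly_of_slices[of "\<lambda>k. snd (S k)"] by metis
  have "P = A * B"
  proof (rule slice_eqI)
    fix k
    show "slice k P = slice k (A * B)"
    proof (cases "k = 0")
      case True then show ?thesis by (simp add: slice_mult A B S0 f)
    next
      case False
      then show ?thesis using S[of k]
        by (simp add: slice_mult A B S0 sum_atMost_ends Rec_def)
    qed
  qed
  moreover have "degree A = degree A0" "lead_coeff A = 1"
    using monic_of_slices[of A A0] A0 cS(1) by (simp_all add: A S0)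
  moreover have "degree B = degree B0" "lead_coeff B = 1"
    using monic_of_slices[of B B0] B0 cS(2) by (simp_all add: B S0)
  ultimately show ?thesis using that by blast
qed

section \<open>Shifts, rescalings and Puiseux roots of monic polynomials\<close>

lemma (in rhom) poly_map_pcompose:
  "poly (map_poly h (pcompose p [:s, 1:])) z = poly (map_poly h p) (h s + z)"
proof -
  interpret m: rhom "map_poly h" by (rule rhom_map_poly)
  show ?thesis
    by (induction p)
      (simp_all add: pcompose_pCons map_poly_pCons m.hom_add m.hom_mult hom_one map_poly_smult hom_mult algebra_simps)
qed

lemma coeff_pcompose_shift:
  fixes P :: "'a::idom poly"
  assumes "degree P = Suc m" "lead_coeff P = 1"
  shows "coeff (pcompose P [:s, 1:]) m = coeff P m + of_nat (Suc m) * s"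
proof -
  have "pcompose P [:s, 1:] = (\<Sum>i\<le>Suc m. smult (coeff P i) ([:s, 1:] ^ i))"
  proof -
    have "pcompose (monom c i) [:s, 1:] = smult c ([:s, 1:] ^ i)" for c i
      by (induction i) (auto simp: monom_0 monom_Suc pcompose_pCons algebra_simps)
    then show ?thesis
      using poly_as_sum_of_monoms'[of P "Suc m"] assms pcompose_sum[of "\<lambda>i. monom (coeff P i) i" "{..Suc m}"]
      by (metis (no_types, lifting) order_refl sum.cong)
  qed
  then have "coeff (pcompose P [:s, 1:]) m = (\<Sum>i\<le>Suc m. coeff P i * coeff ([:s, 1:] ^ i) m)"
    by (simp add: coeff_sum)
  also have "\<dots> = (\<Sum>i\<in>{m, Suc m}. coeff P i * coeff ([:s, 1:] ^ i) m)"
  proof (rule sum.mono_neutral_right)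
    show "\<forall>i\<in>{..Suc m} - {m, Suc m}. coeff P i * coeff ([:s, 1:] ^ i) m = 0"
      by (auto intro!: coeff_eq_0 simp: degree_power_eq)
  qed auto
  also have "\<dots> = coeff P m + of_nat (Suc m) * s"
    using assms by (simp add: coeff_linear_poly_power del: power_Suc)
  finally show ?thesis .
qed

text \<open>The coefficients of A and B differ exactly by the weights of the substitution z -> t z.
  It serves the Newton polygon, with t a power of X, and the clearing of a leading
  coefficient.\<close>

lemma poly_scale:
  fixes A B :: "'a::idom poly"
  assumes "\<And>i. coeff A i * t ^ i = t ^ n * coeff B i"
  shows "poly A (t * z) = t ^ n * poly B z"
proof -
  have "pcompose A [:0, t:] = smult (t ^ n) B"
    by (intro poly_eqI) (use assms in \<open>simp add: coeff_pcompose_linear mult.commute\<close>)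
  then have "poly (pcompose A [:0, t:]) z = t ^ n * poly B z" by simp
  then show ?thesis by (simp add: poly_pcompose mult.commute)
qed

text \<open>A monic polynomial with a single root c is \<open>(y - c)^(m+1)\<close>. The vanishing
  coefficient at m would force c = 0, against the nonzero coefficient at j. So the full power of y -
  c at one root is a proper factor, coprime to the rest.\<close>

lemma split_off_root:
  fixes p :: "complex poly"
  assumes "lead_coeff p = 1" "degree p = Suc m" "coeff p m = 0" "j < Suc m" "coeff p j \<noteq> 0"
  obtains A B where "p = A * B" "coprime A B" "lead_coeff A = 1" "lead_coeff B = 1" "0 < degree A" "degree A < degree p"
proof -
  have "\<not> constant (poly p)" using assms(2) by (metis constant_degree Zero_not_Suc)
  then obtain c where c: "poly p c = 0" using fundamental_theorem_of_algebra by blast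
  have p0: "p \<noteq> 0" using assms by auto
  obtain B where B: "p = [:- c, 1:] ^ order c p * B" "\<not> [:- c, 1:] dvd B"
    using order_decomp[OF p0] by blast
  define A where "A = [:- c, 1:] ^ order c p"
  have ord: "order c p > 0" using c p0 order_root[of p c] by auto
  have lA: "lead_coeff A = 1" "degree A = order c p" by (simp_all add: A_def degree_power_eq coeff_linear_power)
  have "coprime A B"
  proof -
    have "prime_elem [:- c, 1:]" by (rule prime_elem_linear_field_poly) simp
    from prime_elem_imp_power_coprime[OF this B(2)] show ?thesis
      unfolding A_def by (simp only: coprime_commute)
  qed
  moreover have "lead_coeff B = 1"
    using assms(1) lA(1) lead_coeff_mult[of A B] B(1)[folded A_def] by simp
  moreover have "degree A < degree p"
  proof (rule ccontr)
    assume "\<not> degree A < degree p"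
    moreover have "degree p = degree A + degree B"
      using degree_mult_eq[of A B] B(1)[folded A_def] p0 by auto
    ultimately have "degree B = 0" "degree A = degree p" by auto
    then have "B = 1" using \<open>lead_coeff B = 1\<close> by (metis degree_eq_zeroE lead_coeff_pCons(2) one_pCons)
    then have p: "p = [:- c, 1:] ^ Suc m" using B(1) \<open>degree A = degree p\<close> assms(2) lA(2) by simp
    have "coeff p m = of_nat (Suc m) * (- c)"
      unfolding p by (subst coeff_linear_poly_power) (auto simp del: power_Suc)
    then have "c = 0" using assms(3) by (metis mult_eq_0_iff neg_equal_0_iff_equal of_nat_neq_0)
    then have "coeff p j = 0" unfolding p using assms(4)
      by (subst coeff_linear_poly_power) (auto simp del: power_Suc)
    then show False using assms(5) by simp
  qed
  moreover have "0 < degree A" using ord lA by simp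
  ultimately show ?thesis using that[of A B] B(1) lA(1) by (simp add: A_def)
qed

text \<open>After the subleading coefficient is killed and the variables are rescaled along the
  least slope of the Newton polygon, the polynomial at X = 0 has at least two distinct roots.
  Hensel's lemma then yields a factor of smaller degree, and a root of it is transported
  back.\<close>

theorem newton_puiseux:
  fixes P :: "complex fps poly"
  assumes "lead_coeff P = 1" "degree P > 0"
  shows "\<exists>q>0. \<exists>\<alpha>. poly (map_poly (ssub 1 q) P) \<alpha> = 0"
  using assms
proof (induction "degree P" arbitrary: P rule: less_induct)
  case (less P)
  obtain m where m: "degree P = Suc m" using less.prems(2) gr0_implies_Suc by blast
  \<comment> \<open>Tschirnhaus shift, removing the coefficient at m; characteristic 0 is used
    here.\<close>
  define s where "s = - fps_const (1 / of_nat (Suc m)) * coeff P m"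
  define Q where "Q = pcompose P [:s, 1:]"
  have dQ: "degree Q = Suc m" "lead_coeff Q = 1"
    using m less.prems lead_coeff_comp[of "[:s, 1:]" P] by (simp_all add: Q_def degree_pcompose)
  have "of_nat (Suc m) * fps_const (1 / of_nat (Suc m) :: complex) = 1"
    by (simp add: fps_of_nat[symmetric] del: of_nat_Suc)
  then have "of_nat (Suc m) * s = - coeff P m"
    unfolding s_def by (metis (no_types, opaque_lifting) mult.assoc mult_1 mult_minus_left mult_minus_right)
  then have cQ: "coeff Q m = 0"
    unfolding Q_def using coeff_pcompose_shift[of P m s] m less.prems(1) by simp
  have shift: "\<exists>q>0. \<exists>\<alpha>. poly (map_poly (ssub 1 q) P) \<alpha> = 0"
    if "q > 0" "poly (map_poly (ssub 1 q) Q) \<beta> = 0" for q \<beta>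
    using that rhom.poly_map_pcompose[OF rhom_ssub] unfolding Q_def by metis
  show ?case
  proof (cases "\<forall>i<Suc m. coeff Q i = 0")
    case True
    have "coeff Q 0 = 0" using True by simp
    then have "poly (map_poly (ssub 1 1) Q) 0 = 0"
      by (simp add: poly_0_coeff_0 coeff_map_poly ssub_def)
    from shift[OF _ this] show ?thesis by simp
  next
    case False
    define I where "I = {i. i < Suc m \<and> coeff Q i \<noteq> 0}"
    \<comment> \<open>Slopes of the Newton polygon seen from the leading term, whose coefficient has
      order 0. For the least slope p / q, the substitutions X -> X^q and y -> X^p y leave a common
      factor X^(p (m+1)) in all coefficients. The fraction need not be in lowest terms.\<close>
    define slope where "slope i = real (subdegree (coeff Q i)) / real (Suc m - i)" for i
    have "finite I" "I \<noteq> {}" using False by (auto simp: I_def)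
    define i0 where "i0 = arg_min_on slope I"
    have i0: "i0 \<in> I" and i0min: "\<And>i. i \<in> I \<Longrightarrow> slope i0 \<le> slope i"
      unfolding i0_def using arg_min_if_finite[OF \<open>finite I\<close> \<open>I \<noteq> {}\<close>, of slope] by (auto simp: not_less)
    define p q where "p = subdegree (coeff Q i0)" and "q = Suc m - i0"
    have q: "q > 0" using i0 by (auto simp: q_def I_def)
    interpret h: rhom "ssub (1::complex) q" using q by (rule rhom_ssub)
    have min: "p * (Suc m - i) \<le> q * subdegree (coeff Q i)" if "i \<in> I" for i
    proof -
      have "real (Suc m - i) > 0" using that by (auto simp: I_def)
      with i0min[OF that] q have "real p * real (Suc m - i) \<le> real q * real (subdegree (coeff Q i))"
        by (simp add: slope_def divide_simps p_def q_def mult.commute)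
      then show ?thesis by (metis of_nat_le_iff of_nat_mult)
    qed
    define b where "b i = fps_shift (p * (Suc m - i)) (ssub 1 q (coeff Q i))" for i
    have b: "ssub 1 q (coeff Q i) = fps_X ^ (p * (Suc m - i)) * b i" if "i \<le> Suc m" for i
    proof -
      have "p * (Suc m - i) \<le> subdegree (ssub 1 q (coeff Q i))" if "ssub 1 q (coeff Q i) \<noteq> 0"
      proof (rule subdegree_geI[OF that])
        fix n assume n: "n < p * (Suc m - i)"
        have "i \<in> I" using n \<open>i \<le> Suc m\<close> that by (cases "i = Suc m") (auto simp: I_def)
        have "n div q < subdegree (coeff Q i)" using n min[OF \<open>i \<in> I\<close>] q
          by (simp add: div_less_iff_less_mult mult.commute)
        then have "fps_nth (coeff Q i) (n div q) = 0" by (rule nth_less_subdegree_zero)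
        then show "fps_nth (ssub 1 q (coeff Q i)) n = 0" by (simp add: ssub_nth[OF q])
      qed
      then have "ssub 1 q (coeff Q i) = 0 \<or> p * (Suc m - i) \<le> subdegree (ssub 1 q (coeff Q i))" by blast
      then show ?thesis unfolding b_def by (rule fps_conv_fps_X_power_mult_fps_shift)
    qed
    define P1 where "P1 = (\<Sum>i\<le>Suc m. monom (b i) i)"
    have cP1: "coeff P1 i = (if i \<le> Suc m then b i else 0)" for i
      by (auto simp: P1_def coeff_sum)
    have bm: "b (Suc m) = 1" using dQ by (simp add: b_def h.hom_one)
    have dP1: "degree P1 = Suc m"
      by (intro antisym degree_le le_degree) (auto simp: cP1 bm)
    then have lP1: "lead_coeff P1 = 1" by (simp add: cP1 bm)
    have coefid: "ssub 1 q (coeff Q i) * (fps_X ^ p) ^ i = (fps_X ^ p) ^ Suc m * coeff P1 i" for i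
    proof (cases "i \<le> Suc m")
      case True
      have "(fps_X ^ p) ^ Suc m = fps_X ^ (p * (Suc m - i)) * (fps_X ^ p :: complex fps) ^ i"
        using True by (simp add: power_add[symmetric] power_mult[symmetric] add_mult_distrib2[symmetric] del: power_Suc mult_Suc_right)
      then show ?thesis using True b[OF True] by (simp add: cP1 mult_ac del: power_Suc)
    next
      case False
      then show ?thesis using dQ by (simp add: cP1 coeff_eq_0)
    qed
    define p0 where "p0 = slice 0 P1"
    have cp0: "coeff p0 i = fps_nth (coeff P1 i) 0" for i by (simp add: p0_def)
    have "degree p0 = Suc m"
      by (intro antisym degree_le le_degree) (auto simp: cp0 cP1 bm)
    moreover from this have "lead_coeff p0 = 1" by (simp add: cp0 cP1 bm)
    moreover have "coeff p0 m = 0" by (simp add: cp0 cP1 b_def cQ)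
    moreover have "i0 < Suc m" using i0 by (simp add: I_def)
    \<comment> \<open>At the index of least slope the order equals the power divided out, so the
      lowest coefficient survives at X = 0. This rules out the pure power y^(m+1).\<close>
    moreover have "coeff p0 i0 \<noteq> 0"
    proof -
      have "coeff p0 i0 = fps_nth (ssub 1 q (coeff Q i0)) (q * p)"
        using \<open>i0 < Suc m\<close> by (simp add: cp0 cP1 b_def q_def mult.commute)
      also have "\<dots> = fps_nth (coeff Q i0) p" using q by (simp add: ssub_nth)
      also have "\<dots> \<noteq> 0" using i0 by (simp add: p_def I_def)
      finally show ?thesis .
    qed
    ultimately obtain A0 B0 where AB0: "p0 = A0 * B0" "coprime A0 B0" "lead_coeff A0 = 1" "lead_coeff B0 = 1"
        "0 < degree A0" "degree A0 < degree p0"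
      using split_off_root[of p0 m i0] by metis
    then obtain A B where AB: "P1 = A * B" "lead_coeff A = 1" "degree A = degree A0"
      using hensel[of P1 A0 B0] lP1 unfolding p0_def by metis
    have "degree A < degree P" using AB(3) AB0(6) \<open>degree p0 = Suc m\<close> m by simp
    then obtain r \<beta> where r: "r > 0" "poly (map_poly (ssub 1 r) A) \<beta> = 0"
      using less.hyps[of A] AB AB0 by auto
    interpret g: rhom "ssub (1::complex) r" using r(1) by (rule rhom_ssub)
    have "poly (map_poly (ssub 1 r) P1) \<beta> = 0"
      unfolding AB(1) using rhom.hom_mult[OF g.rhom_map_poly, of A B] r(2) by simp
    moreover have "poly (map_poly (ssub 1 (q * r)) Q) (ssub 1 r (fps_X ^ p) * \<beta>)
        = ssub 1 r (fps_X ^ p) ^ Suc m * poly (map_poly (ssub 1 r) P1) \<beta>"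
    proof (rule poly_scale)
      fix i
      have "coeff (map_poly (ssub 1 (q * r)) Q) i = ssub 1 r (ssub 1 q (coeff Q i))"
        using q r(1) by (simp add: coeff_map_poly ssub_ssub rhom.hom_zero[OF rhom_ssub])
      then have "coeff (map_poly (ssub 1 (q * r)) Q) i * ssub 1 r (fps_X ^ p) ^ i
          = ssub 1 r (ssub 1 q (coeff Q i) * (fps_X ^ p) ^ i)"
        by (simp only: g.hom_mult g.hom_power)
      also have "\<dots> = ssub 1 r (fps_X ^ p) ^ Suc m * ssub 1 r (coeff P1 i)"
        by (simp only: coefid g.hom_mult g.hom_power)
      also have "ssub 1 r (coeff P1 i) = coeff (map_poly (ssub 1 r) P1) i"
        by (simp add: coeff_map_poly)
      finally show "coeff (map_poly (ssub 1 (q * r)) Q) i * ssub 1 r (fps_X ^ p) ^ i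
          = ssub 1 r (fps_X ^ p) ^ Suc m * coeff (map_poly (ssub 1 r) P1) i" .
    qed
    ultimately have "poly (map_poly (ssub 1 (q * r)) Q) (ssub 1 r (fps_X ^ p) * \<beta>) = 0" by simp
    from shift[OF _ this] show ?thesis using q r(1) by simp
  qed
qed

subsection \<open>Norms of polynomials without real roots\<close>

lemma ssub_0 [simp]: "ssub c q 0 = 0"
  by (simp add: ssub_def)

definition cnjf :: "complex fps \<Rightarrow> complex fps" where
  "cnjf f = Abs_fps (\<lambda>n. cnj (fps_nth f n))"

definition rcf :: "real fps \<Rightarrow> complex fps" where
  "rcf f = Abs_fps (\<lambda>n. complex_of_real (fps_nth f n))"

lemma cnjf_nth [simp]: "fps_nth (cnjf f) n = cnj (fps_nth f n)"
  by (simp add: cnjf_def)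

lemma rcf_nth [simp]: "fps_nth (rcf f) n = complex_of_real (fps_nth f n)"
  by (simp add: rcf_def)

interpretation cnjf: rhom cnjf
  by standard (auto simp: fps_eq_iff fps_mult_nth)

interpretation rcf: rhom rcf
  by standard (auto simp: fps_eq_iff fps_mult_nth)

interpretation mcnjf: rhom "map_poly cnjf" by (rule cnjf.rhom_map_poly)

interpretation mrcf: rhom "map_poly rcf" by (rule rcf.rhom_map_poly)

lemma rcf_inj: "rcf f = rcf g \<Longrightarrow> f = g"
  by (simp add: fps_eq_iff)

lemma rcf_eq_iff [simp]: "rcf f = 0 \<longleftrightarrow> f = 0" "rcf f = 1 \<longleftrightarrow> f = 1"
  using rcf_inj[of f 0] rcf_inj[of f 1] by (auto simp: rcf.hom_one)

lemma degree_map_rcf [simp]: "degree (map_poly rcf p) = degree p"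
  by (rule degree_map_poly) simp

lemma map_rcf_inj: "map_poly rcf p = map_poly rcf q \<Longrightarrow> p = q"
  by (simp add: poly_eq_iff coeff_map_poly) (metis rcf_inj)

lemma cnjf_cnjf [simp]: "cnjf (cnjf f) = f"
  by (simp add: fps_eq_iff)

lemma map_cnjf_cnjf [simp]: "map_poly cnjf (map_poly cnjf p) = p"
  by (simp add: poly_eq_iff coeff_map_poly)

lemma cnjf_rcf [simp]: "cnjf (rcf f) = rcf f"
  by (simp add: fps_eq_iff)

lemma cnjf_ssub: "q > 0 \<Longrightarrow> cnjf (ssub c q f) = ssub (cnj c) q (cnjf f)"
  by (simp add: fps_eq_iff ssub_nth)

lemma rcf_ssub: "q > 0 \<Longrightarrow> rcf (ssub c q f) = ssub (of_real c) q (rcf f)"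
  by (simp add: fps_eq_iff ssub_nth)

lemma cnjf_eq_imp_rcf: "cnjf f = f \<Longrightarrow> \<exists>g. f = rcf g"
  by (rule exI[of _ "Abs_fps (\<lambda>n. Re (fps_nth f n))"])
     (auto simp: fps_eq_iff complex_eq_iff)

lemma Abs_fps_zero [simp]: "Abs_fps (\<lambda>n. 0) = 0"
  by (simp add: fps_eq_iff)

lemma map_cnjf_eq_imp_rcf:
  assumes "map_poly cnjf p = p" shows "\<exists>g. p = map_poly rcf g"
proof -
  have "cnjf (coeff p i) = coeff p i" for i using assms by (metis cnjf.hom_zero coeff_map_poly)
  then have "rcf (Abs_fps (\<lambda>n. Re (fps_nth (coeff p i) n))) = coeff p i" for i
    by (auto simp: fps_eq_iff complex_eq_iff)
  then have "p = map_poly rcf (map_poly (\<lambda>c. Abs_fps (\<lambda>n. Re (fps_nth c n))) p)"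
    by (intro poly_eqI) (simp add: coeff_map_poly)
  then show ?thesis by blast
qed

lemma prod_linear_dvd:
  fixes P :: "'a::idom poly"
  assumes "finite S" "\<And>a. a \<in> S \<Longrightarrow> poly P a = 0"
  shows "(\<Prod>a\<in>S. [:- a, 1:]) dvd P"
  using assms
proof (induction S rule: finite_induct)
  case (insert a S)
  then obtain Q where Q: "P = (\<Prod>a\<in>S. [:- a, 1:]) * Q" by (auto elim: dvdE)
  have "poly (\<Prod>b\<in>S. [:- b, 1:]) a \<noteq> 0" using insert.hyps by (auto simp: poly_prod)
  moreover have "poly P a = 0" using insert.prems by simp
  ultimately have "[:- a, 1:] dvd Q" unfolding Q by (simp add: poly_eq_0_iff_dvd)
  then have "[:- a, 1:] * (\<Prod>a\<in>S. [:- a, 1:]) dvd Q * (\<Prod>a\<in>S. [:- a, 1:])"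
    by (rule mult_dvd_mono) simp
  then show ?case using insert.hyps Q by (simp only: prod.insert[OF insert.hyps(1,2)] mult.commute)
qed simp

lemma monic_division:
  fixes P R :: "'a::idom poly"
  assumes "lead_coeff R = 1"
  obtains Q r where "P = R * Q + r" "r = 0 \<or> degree r < degree R"
proof -
  obtain Q r where qr: "pseudo_divmod P R = (Q, r)" by fastforce
  have "R \<noteq> 0" using assms by auto
  from pseudo_divmod[OF this qr] that[of Q r] assms show ?thesis by simp
qed

lemma map_ssub_map_ssub:
  "q > 0 \<Longrightarrow> r > 0 \<Longrightarrow> map_poly (ssub d r) (map_poly (ssub c q) P) = map_poly (ssub (c * d ^ q) (q * r)) P"
  by (subst map_poly_map_poly) (auto simp: ssub_ssub o_def rhom.hom_zero[OF rhom_ssub])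

text \<open>Invariance under multiplication of X by a primitive q-th root of unity kills all
  exponents not divisible by q, so the series is a series in X^q; the coefficients at multiples of q
  describe it before the ramification.\<close>

lemma rotation_invariant:
  fixes q :: nat
  assumes q: "q > 0" and inv: "ssub (cis (2 * pi / real q)) 1 c = c"
  shows "ssub 1 q (Abs_fps (\<lambda>n. fps_nth c (q * n))) = c"
proof (rule fps_ext)
  fix n
  have "fps_nth c n = 0" if "\<not> q dvd n"
  proof -
    have "cis (2 * pi / real q) ^ n * fps_nth c n = fps_nth c n"
      using inv by (metis One_nat_def div_by_Suc_0 one_dvd ssub_nth zero_less_one)
    moreover have "cis (2 * pi / real q) ^ n \<noteq> 1"
    proof
      assume "cis (2 * pi / real q) ^ n = 1"
      then have "cis (real n * (2 * pi / real q)) = 1" by (simp only: Complex.DeMoivre)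
      then have "exp (\<i> * complex_of_real (real n * (2 * pi / real q))) = 1"
        by (simp only: cis_conv_exp)
      then obtain i :: int where "real n * (2 * pi / real q) = of_int (2 * i) * pi"
        unfolding exp_eq_1 by auto
      then have "real n = of_int i * real q" using q by (simp add: field_simps)
      then have "int n = i * int q" by (metis of_int_eq_iff of_int_mult of_int_of_nat_eq)
      then show False using that by (metis dvd_triv_right int_dvd_int_iff)
    qed
    ultimately show ?thesis by simp
  qed
  then show "fps_nth (ssub 1 q (Abs_fps (\<lambda>n. fps_nth c (q * n)))) n = fps_nth c n"
    using q by (auto simp: ssub_nth)
qed

text \<open>Excludes real Puiseux branches on both sides of 0. Both signs occur because for even q
  the substitution x = s^q sees only x >= 0.\<close>

definition real_root_free :: "real fps poly \<Rightarrow> bool" where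
  "real_root_free P \<longleftrightarrow>
     (\<forall>q>0. \<forall>\<sigma>\<in>{1, -1}. \<forall>\<beta>. poly (map_poly (ssub \<sigma> q) P) \<beta> \<noteq> 0)"

text \<open>Equality would make the conjugate of each coefficient a_n of \<open>\<alpha>\<close>
  equal to \<open>\<zeta>^((k+l) n) a_n\<close>. Rotating by a square root \<open>\<omega>\<close>
  of \<open>\<zeta>^(k+l)\<close> makes all coefficients real, and since \<open>\<omega>^q\<close>
  is 1 or -1, the rotated series is a real root of P(X^q) or P(-X^q), which is excluded.\<close>

lemma root_neq_conjugate:
  fixes P :: "real fps poly"
  assumes free: "real_root_free P" and q: "q > 0"
    and root: "poly (map_poly (ssub 1 q) (map_poly rcf P)) \<alpha> = 0"
  shows "ssub (cis (2 * pi / real q) ^ k) 1 \<alpha> \<noteq> cnjf (ssub (cis (2 * pi / real q) ^ l) 1 \<alpha>)"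
proof
  assume eq: "ssub (cis (2 * pi / real q) ^ k) 1 \<alpha> = cnjf (ssub (cis (2 * pi / real q) ^ l) 1 \<alpha>)"
  define \<zeta> where "\<zeta> = cis (2 * pi / real q)"
  define \<omega> where "\<omega> = cis (pi * real (k + l) / real q)"
  have \<zeta>\<omega>: "\<omega> ^ 2 = \<zeta> ^ (k + l)"
    by (simp add: \<omega>_def \<zeta>_def Complex.DeMoivre field_simps)
  have \<omega>q: "\<omega> ^ q = of_real ((-1) ^ (k + l))"
  proof -
    have "\<omega> ^ q = cis (real (k + l) * pi)" using q by (simp add: \<omega>_def Complex.DeMoivre mult.commute)
    also have "\<dots> = cis pi ^ (k + l)" by (simp only: Complex.DeMoivre)
    finally show ?thesis by simp
  qed
  have u: "cnj \<zeta> * \<zeta> = 1" "cnj \<omega> * \<omega> = 1" by (simp_all add: \<zeta>_def \<omega>_def cis_cnj cis_mult)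
  have "cnjf (ssub \<omega> 1 \<alpha>) = ssub \<omega> 1 \<alpha>"
  proof (rule fps_ext)
    fix n
    define a where "a = fps_nth \<alpha> n"
    have "fps_nth (ssub (\<zeta> ^ k) 1 \<alpha>) n = fps_nth (cnjf (ssub (\<zeta> ^ l) 1 \<alpha>)) n"
      using eq by (simp add: \<zeta>_def)
    then have e: "(\<zeta> ^ k) ^ n * a = (cnj \<zeta> ^ l) ^ n * cnj a" by (simp add: ssub_nth a_def)
    have "(\<zeta> ^ l) ^ n * ((\<zeta> ^ k) ^ n * a) = (cnj \<zeta> * \<zeta>) ^ (l * n) * cnj a"
      unfolding e by (simp add: power_mult_distrib power_mult mult_ac)
    also have "\<dots> = cnj a" by (simp add: u)
    finally have "cnj a = (\<zeta> ^ (k + l)) ^ n * a" by (simp add: power_add power_mult_distrib mult_ac)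
    then have "cnj \<omega> ^ n * cnj a = (cnj \<omega> * \<omega>) ^ n * \<omega> ^ n * a"
      unfolding \<zeta>\<omega>[symmetric] by (simp add: power_mult_distrib power2_eq_square mult_ac)
    then show "fps_nth (cnjf (ssub \<omega> 1 \<alpha>)) n = fps_nth (ssub \<omega> 1 \<alpha>) n"
      by (simp add: ssub_nth a_def u)
  qed
  then obtain \<beta> where \<beta>: "ssub \<omega> 1 \<alpha> = rcf \<beta>" using cnjf_eq_imp_rcf by blast
  interpret s: rhom "ssub \<omega> 1" by (rule rhom_ssub) simp
  have "poly (map_poly (ssub \<omega> 1) (map_poly (ssub 1 q) (map_poly rcf P))) (rcf \<beta>) = 0"
    unfolding \<beta>[symmetric] s.poly_map_hom root by simp
  also have "map_poly (ssub \<omega> 1) (map_poly (ssub 1 q) (map_poly rcf P)) = map_poly rcf (map_poly (ssub ((-1) ^ (k + l)) q) P)"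
    using q by (simp add: map_ssub_map_ssub \<omega>q poly_eq_iff coeff_map_poly rcf_ssub rhom.hom_zero[OF rhom_ssub])
  finally have "rcf (poly (map_poly (ssub ((-1) ^ (k + l)) q) P) \<beta>) = rcf 0"
    by (simp add: rcf.poly_map_hom)
  then have "poly (map_poly (ssub ((-1) ^ (k + l)) q) P) \<beta> = 0" by (rule rcf_inj)
  moreover have "(-1 :: real) ^ (k + l) \<in> {1, -1}" by (cases "even (k + l)") auto
  ultimately show False using free q unfolding real_root_free_def by blast
qed

text \<open>The product over the rotation orbit of one Puiseux root has coefficients in X^q and
  descends to a factor p over C[[X]]. The orbit is disjoint from its conjugate, so p times its
  conjugate divides P; the quotient is real, monic, of smaller degree and still has no real
  branch.\<close>

theorem real_root_free_norm:
  fixes P :: "real fps poly"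
  assumes "lead_coeff P = 1" "real_root_free P"
  shows "\<exists>g. lead_coeff g = 1 \<and> map_poly rcf P = g * map_poly cnjf g"
  using assms
proof (induction "degree P" arbitrary: P rule: less_induct)
  case (less P)
  show ?case
  proof (cases "degree P = 0")
    case True
    then have "P = 1" using less.prems(1) by (metis degree_eq_zeroE lead_coeff_pCons(2) one_pCons)
    then show ?thesis by (intro exI[of _ 1]) (simp add: mrcf.hom_one mcnjf.hom_one)
  next
    case False
    define P0 where "P0 = map_poly rcf P"
    have P0: "lead_coeff P0 = 1" "degree P0 = degree P"
      using rcf.monic_map_poly less.prems(1) by (auto simp: P0_def)
    then obtain q \<alpha> where q: "q > 0" and root: "poly (map_poly (ssub 1 q) P0) \<alpha> = 0"
      using newton_puiseux[of P0] False by auto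
    interpret sq: rhom "ssub (1::complex) q" using q by (rule rhom_ssub)
    interpret msq: rhom "map_poly (ssub (1::complex) q)" by (rule sq.rhom_map_poly)
    define \<zeta> where "\<zeta> = cis (2 * pi / real q)"
    have \<zeta>q: "\<zeta> ^ q = 1" using q by (simp add: \<zeta>_def Complex.DeMoivre)
    \<comment> \<open>A set, not a family: if \<open>\<alpha>\<close> is already a series in a
      higher power of X, rotated copies coincide and must be counted once.\<close>
    define Orb where "Orb = (\<lambda>k. ssub (\<zeta> ^ k) 1 \<alpha>) ` {..<q}"
    have fin: "finite Orb" and ne: "Orb \<noteq> {}" using q by (auto simp: Orb_def)
    define PT where "PT = map_poly (ssub 1 q) P0"
    have rootO: "poly PT a = 0" if "a \<in> Orb" for a
    proof -
      obtain k where a: "a = ssub (\<zeta> ^ k) 1 \<alpha>" using \<open>a \<in> Orb\<close> by (auto simp: Orb_def)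
      have "(\<zeta> ^ k) ^ q = 1" using \<zeta>q by (metis power_commutes power_mult mult.commute power_one)
      then have "map_poly (ssub (\<zeta> ^ k) 1) PT = PT"
        using q by (simp add: PT_def map_ssub_map_ssub)
      moreover have "poly (map_poly (ssub (\<zeta> ^ k) 1) PT) a = 0"
        unfolding a by (subst rhom.poly_map_hom[OF rhom_ssub])
          (use root in \<open>auto simp: PT_def rhom.hom_zero[OF rhom_ssub]\<close>)
      ultimately show ?thesis by simp
    qed
    have cPT: "map_poly cnjf PT = PT"
      using q by (simp add: PT_def P0_def poly_eq_iff coeff_map_poly cnjf_ssub)
    have rootO': "poly PT (cnjf a) = 0" if "a \<in> Orb" for a
      using cnjf.poly_map_hom[of PT a] rootO[OF that] cPT by simp
    have disj: "Orb \<inter> cnjf ` Orb = {}"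
      using root_neq_conjugate[OF less.prems(2) q root[unfolded P0_def]] by (auto simp: Orb_def \<zeta>_def)
    define pO where "pO = (\<Prod>a\<in>Orb. [:- a, 1:])"
    have "map_poly cnjf pO = (\<Prod>a\<in>Orb. [:- cnjf a, 1:])"
      by (simp add: pO_def mcnjf.hom_prod map_poly_pCons cnjf.hom_uminus cnjf.hom_one)
    also have "\<dots> = (\<Prod>a\<in>cnjf ` Orb. [:- a, 1:])"
      by (subst prod.reindex) (auto intro: inj_on_inverseI[of _ cnjf])
    finally have "pO * map_poly cnjf pO = (\<Prod>a\<in>Orb \<union> cnjf ` Orb. [:- a, 1:])"
      using fin disj by (simp add: pO_def prod.union_disjoint)
    then have dvd: "pO * map_poly cnjf pO dvd PT"
      using prod_linear_dvd[of "Orb \<union> cnjf ` Orb" PT] fin rootO rootO' by auto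
    have rot: "ssub \<zeta> 1 ` Orb = Orb"
    proof -
      have "ssub \<zeta> 1 ` Orb = (\<lambda>k. ssub (\<zeta> ^ Suc k) 1 \<alpha>) ` {..<q}"
        by (simp add: Orb_def image_image ssub_ssub mult.commute)
      also have "\<dots> = (\<lambda>k. ssub (\<zeta> ^ k) 1 \<alpha>) ` (Suc ` {..<q})" by (simp add: image_image)
      also have "Suc ` {..<q} = {1..q}" by (simp add: image_Suc_lessThan)
      also have "(\<lambda>k. ssub (\<zeta> ^ k) 1 \<alpha>) ` {1..q} = Orb"
      proof -
        have "{1..q} = insert q {1..<q}" "{..<q} = insert 0 {1..<q}" using q by auto
        then show ?thesis by (simp add: Orb_def \<zeta>q)
      qed
      finally show ?thesis .
    qed
    interpret sz: rhom "ssub \<zeta> 1" by (rule rhom_ssub) simp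
    interpret msz: rhom "map_poly (ssub \<zeta> 1)" by (rule sz.rhom_map_poly)
    have "map_poly (ssub \<zeta> 1) pO = (\<Prod>a\<in>Orb. [:- ssub \<zeta> 1 a, 1:])"
      by (simp add: pO_def msz.hom_prod map_poly_pCons sz.hom_uminus sz.hom_one del: One_nat_def)
    also have "\<dots> = (\<Prod>a\<in>ssub \<zeta> 1 ` Orb. [:- a, 1:])"
    proof (subst prod.reindex)
      show "inj_on (ssub \<zeta> 1) Orb"
        by (rule inj_onI, rule ssub_inj[of 1 \<zeta>]) (simp_all add: \<zeta>_def)
    qed (simp add: o_def)
    finally have "map_poly (ssub \<zeta> 1) pO = pO" by (simp only: rot pO_def)
    then have "ssub \<zeta> 1 (coeff pO i) = coeff pO i" for i
      by (metis coeff_map_poly sz.hom_zero)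
    then have inv: "ssub 1 q (Abs_fps (\<lambda>n. fps_nth (coeff pO i) (q * n))) = coeff pO i" for i
      using rotation_invariant[OF q] by (simp add: \<zeta>_def)
    define p where "p = map_poly (\<lambda>c. Abs_fps (\<lambda>n. fps_nth c (q * n))) pO"
    have mp: "map_poly (ssub 1 q) p = pO"
      by (intro poly_eqI) (simp add: p_def coeff_map_poly inv)
    have lpO: "lead_coeff pO = 1" by (simp add: pO_def lead_coeff_prod)
    have "degree pO = card Orb" by (simp add: pO_def degree_prod_sum_eq)
    then have dpO: "degree pO > 0" using fin ne by (simp add: card_gt_0_iff)
    have cp: "coeff p i = Abs_fps (\<lambda>n. fps_nth (coeff pO i) (q * n))" for i
      by (simp add: p_def coeff_map_poly)
    have dp: "degree p = degree pO"
      by (intro antisym degree_le le_degree) (use lpO q in \<open>auto simp: cp coeff_eq_0 fps_eq_iff\<close>)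
    have lp: "lead_coeff p = 1"
      using lpO q by (auto simp: dp cp fps_eq_iff)
    define R where "R = p * map_poly cnjf p"
    have lR: "lead_coeff R = 1"
      using lp cnjf.monic_map_poly[OF lp] by (simp add: R_def lead_coeff_mult)
    have mR: "map_poly (ssub 1 q) R dvd map_poly (ssub 1 q) P0"
    proof -
      have "map_poly (ssub 1 q) (map_poly cnjf p) = map_poly cnjf pO"
        unfolding mp[symmetric] using q by (simp add: poly_eq_iff coeff_map_poly cnjf_ssub)
      then show ?thesis using dvd by (simp add: R_def msq.hom_mult mp PT_def)
    qed
    \<comment> \<open>Divisibility is known only after X -> X^q. Division with remainder by the
      monic R survives this substitution, so the substituted remainder vanishes by degree, and the
      substitution is injective.\<close>
    obtain Q r where Qr: "P0 = R * Q + r" "r = 0 \<or> degree r < degree R"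
      using monic_division[OF lR] by metis
    have "map_poly (ssub 1 q) R dvd map_poly (ssub 1 q) r"
      using mR by (simp add: Qr(1) msq.hom_add msq.hom_mult dvd_add_right_iff)
    moreover have "degree (map_poly (ssub 1 q) r) < degree (map_poly (ssub 1 q) R)" if "r \<noteq> 0"
      using that Qr(2) sq.monic_map_poly[OF lR] map_poly_degree_leq[of "ssub 1 q" r] by auto
    ultimately have "r = 0 \<or> map_poly (ssub 1 q) r = 0"
      using dvd_imp_degree_le[of "map_poly (ssub 1 q) R" "map_poly (ssub 1 q) r"] by fastforce
    moreover have "r = 0" if "map_poly (ssub 1 q) r = 0"
    proof (rule poly_eqI)
      fix i
      have "ssub (1::complex) q (coeff r i) = ssub 1 q 0"
        using that by (metis coeff_0 coeff_map_poly sq.hom_zero)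
      from ssub_inj[OF q _ this] show "coeff r i = coeff 0 i" by simp
    qed
    ultimately have P0R: "P0 = R * Q" using Qr by auto
    have cP0: "map_poly cnjf P0 = P0" by (simp add: P0_def poly_eq_iff coeff_map_poly)
    have cR: "map_poly cnjf R = R" by (simp add: R_def mcnjf.hom_mult mult.commute)
    have "R * map_poly cnjf Q = R * Q"
      using cP0 cR by (metis P0R mcnjf.hom_mult)
    then have "map_poly cnjf Q = Q" using lR by (metis leading_coeff_0_iff mult_left_cancel zero_neq_one)
    then obtain \<Psi> where \<Psi>: "Q = map_poly rcf \<Psi>" using map_cnjf_eq_imp_rcf by blast
    obtain R' where R': "R = map_poly rcf R'" using cR map_cnjf_eq_imp_rcf by metis
    have P: "P = R' * \<Psi>"
      by (rule map_rcf_inj) (use P0R in \<open>simp add: P0_def \<Psi> R' mrcf.hom_mult\<close>)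
    have lR': "lead_coeff R' = 1" "degree R' = degree R"
    proof -
      show "degree R' = degree R" unfolding R' by simp
      show "lead_coeff R' = 1" using lR unfolding R' by (simp add: coeff_map_poly)
    qed
    have l\<Psi>: "lead_coeff \<Psi> = 1" using less.prems(1) lR' by (simp add: P lead_coeff_mult)
    have "degree P = degree R' + degree \<Psi>"
      unfolding P by (rule degree_mult_eq) (use lR' l\<Psi> in auto)
    moreover have "degree R > 0"
      using dp dpO lp cnjf.monic_map_poly[OF lp] unfolding R_def
      by (subst degree_mult_eq) auto
    ultimately have "degree \<Psi> < degree P" using lR'(2) by simp
    moreover have "real_root_free \<Psi>"
    proof (unfold real_root_free_def, intro allI impI ballI)
      fix n :: nat and \<sigma> :: real and \<beta>
      assume n: "n > 0" "\<sigma> \<in> {1, -1}"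
      have "poly (map_poly (ssub \<sigma> n) P) \<beta> \<noteq> 0"
        using less.prems(2) n unfolding real_root_free_def by blast
      then show "poly (map_poly (ssub \<sigma> n) \<Psi>) \<beta> \<noteq> 0"
        unfolding P rhom.hom_mult[OF rhom.rhom_map_poly[OF rhom_ssub[OF n(1)]]] by simp
    qed
    ultimately obtain g where g: "lead_coeff g = 1" "map_poly rcf \<Psi> = g * map_poly cnjf g"
      using less.hyps l\<Psi> by blast
    have "map_poly rcf P = (p * g) * map_poly cnjf (p * g)"
      using P0R g(2) by (simp add: P0_def \<Psi> R_def mcnjf.hom_mult mult_ac)
    moreover have "lead_coeff (p * g) = 1" using lp g(1) by (simp add: lead_coeff_mult)
    ultimately show ?thesis by blast
  qed
qed

subsection \<open>Local sums of squares over the power series ring\<close>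

lemma rhom_fps_of_poly: "rhom (fps_of_poly :: real poly \<Rightarrow> real fps)"
  by standard (auto simp: fps_of_poly_add fps_of_poly_mult)

interpretation fpp: rhom "fps_of_poly :: real poly \<Rightarrow> real fps" by (rule rhom_fps_of_poly)

interpretation mfpp: rhom "map_poly (fps_of_poly :: real poly \<Rightarrow> real fps)" by (rule fpp.rhom_map_poly)

lemma fps_sqrt:
  fixes f :: "real fps"
  assumes "fps_nth f 0 > 0"
  obtains s where "s\<^sup>2 = f"
proof -
  have r: "root (Suc 1) (fps_nth f 0) ^ Suc 1 = fps_nth f 0"
    using assms by (intro real_root_pow_pos2) auto
  then have "fps_radical root (Suc 1) f ^ Suc 1 = f"
    using power_radical[of f root 1] assms by simp
  then show ?thesis using that[of "fps_radical root (Suc 1) f"] by (simp add: power2_eq_square)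
qed

text \<open>Write l = t^m u with u(0) nonzero. Positivity on both sides of 0 forces u(0) > 0 and m
  even, and such a u has a square root among the power series.\<close>

lemma local_nonneg_square:
  fixes l :: "real poly"
  assumes "\<epsilon> > 0" "\<And>t. \<bar>t\<bar> < \<epsilon> \<Longrightarrow> t \<noteq> 0 \<Longrightarrow> poly l t > 0"
  obtains s where "fps_of_poly l = s\<^sup>2" "s \<noteq> 0"
proof -
  have l0: "l \<noteq> 0" using assms(2)[of "\<epsilon> / 2"] assms(1) by auto
  obtain u where u: "l = [:- 0, 1:] ^ order 0 l * u" "\<not> [:- 0, 1:] dvd u"
    using order_decomp[OF l0] by blast
  define m where "m = order 0 l"
  have lm: "poly l t = t ^ m * poly u t" for t
    by (subst u(1)) (simp add: m_def)
  have u0: "poly u 0 \<noteq> 0" using u(2) by (auto simp: poly_eq_0_iff_dvd)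
  have "isCont (poly u) 0" by simp
  then obtain \<delta> where \<delta>: "\<delta> > 0" "\<And>t. \<bar>t\<bar> < \<delta> \<Longrightarrow> \<bar>poly u t - poly u 0\<bar> < \<bar>poly u 0\<bar>"
    using u0 unfolding continuous_at_eps_delta dist_real_def by (metis diff_zero zero_less_abs_iff)
  define t where "t = min \<epsilon> \<delta> / 2"
  have t: "t > 0" "t < \<epsilon>" "t < \<delta>" using assms(1) \<delta>(1) by (auto simp: t_def min_def)
  have p: "t ^ m * poly u t > 0" "(- t) ^ m * poly u (- t) > 0"
    using assms(2)[of t] assms(2)[of "- t"] t by (auto simp: lm)
  then have "poly u t > 0" using t(1) by (simp add: zero_less_mult_iff)
  then have up: "poly u 0 > 0" using \<delta>(2)[of t] t by (simp add: abs_if split: if_splits)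
  then have "poly u (- t) > 0" using \<delta>(2)[of "- t"] t by (simp add: abs_if split: if_splits)
  then have "(- t) ^ m > 0" using p(2) by (simp add: zero_less_mult_iff)
  then have "even m" using t(1) by (intro ccontr[of "even m"]) (simp add: power_minus_odd)
  then obtain k where k: "m = 2 * k" by auto
  have "fps_nth (fps_of_poly u) 0 > 0" using up by (simp add: poly_0_coeff_0)
  then obtain s where s: "s\<^sup>2 = fps_of_poly u" by (rule fps_sqrt)
  have "l = [:0, 1:] ^ m * u" using u(1) by (simp add: m_def)
  then have "fps_of_poly l = fps_X ^ m * s\<^sup>2"
    by (simp add: fps_of_poly_mult fps_of_poly_power s fps_of_poly_pCons)
  then have "fps_of_poly l = (fps_X ^ k * s)\<^sup>2" by (simp add: k power_mult_distrib power_mult[symmetric] mult.commute)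
  moreover have "s \<noteq> 0" using s u0 by auto
  then have "fps_X ^ k * s \<noteq> 0" by simp
  ultimately show ?thesis using that by blast
qed

lemma sum_squares_poly_zero:
  fixes p q :: "real poly"
  assumes "p * p + q * q = 0" shows "p = 0 \<and> q = 0"
proof -
  have "poly p x * poly p x + poly q x * poly q x = 0" for x
    using assms by (metis poly_0 poly_add poly_mult)
  then have "poly p x = 0 \<and> poly q x = 0" for x by (metis sum_squares_eq_zero_iff)
  then show ?thesis using poly_all_0_iff_0 by blast
qed

lemma slice_0_zero:
  assumes "slice 0 A = 0"
  obtains A' where "A = smult fps_X A'" "degree A' \<le> degree A"
proof -
  define A' where "A' = map_poly (fps_shift 1) A"
  have "fps_nth (coeff A i) 0 = 0" for i using assms by (metis coeff_0 coeff_slice)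
  then have "A = smult fps_X A'"
    by (intro poly_eqI) (auto simp: A'_def coeff_map_poly fps_eq_iff)
  moreover have "degree A' \<le> degree A" by (simp add: A'_def map_poly_degree_leq)
  ultimately show ?thesis using that by blast
qed

lemma smult_eq_iff_fps_X:
  fixes P Q :: "real fps poly"
  shows "smult (fps_X\<^sup>2) P = smult (fps_X\<^sup>2) Q \<longleftrightarrow> P = Q"
proof
  assume "smult (fps_X\<^sup>2) P = smult (fps_X\<^sup>2) Q"
  then have "smult (fps_X\<^sup>2) (P - Q) = 0" by (simp only: smult_diff_right) simp
  then show "P = Q" by simp
qed simp

text \<open>At X = 0 the squares of two real polynomials sum to 0, so both vanish there and X can be
  divided out of A and B, without raising degrees.\<close>

lemma cancel_X_power_sos:
  fixes F A B :: "real fps poly"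
  assumes "smult ((fps_X ^ k)\<^sup>2) F = A\<^sup>2 + B\<^sup>2" "degree A \<le> d" "degree B \<le> d"
  shows "\<exists>A B. F = A\<^sup>2 + B\<^sup>2 \<and> degree A \<le> d \<and> degree B \<le> d"
  using assms
proof (induction k arbitrary: A B)
  case (Suc k)
  have "slice 0 (A\<^sup>2 + B\<^sup>2) = 0"
    by (intro poly_eqI) (simp flip: Suc.prems(1) add: power_mult_distrib)
  moreover have "slice 0 (A\<^sup>2 + B\<^sup>2) = slice 0 (A\<^sup>2) + slice 0 (B\<^sup>2)" by (intro poly_eqI) simp
  ultimately have "slice 0 A * slice 0 A + slice 0 B * slice 0 B = 0"
    by (simp add: power2_eq_square slice_mult)
  then have z: "slice 0 A = 0" "slice 0 B = 0" using sum_squares_poly_zero[of "slice 0 A" "slice 0 B"] by blast+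
  obtain A' where A': "A = smult fps_X A'" "degree A' \<le> degree A" using slice_0_zero[OF z(1)] .
  obtain B' where B': "B = smult fps_X B'" "degree B' \<le> degree B" using slice_0_zero[OF z(2)] .
  have "smult (fps_X\<^sup>2) (smult ((fps_X ^ k)\<^sup>2) F) = smult (fps_X\<^sup>2) (A'\<^sup>2 + B'\<^sup>2)"
  proof -
    have "smult (fps_X\<^sup>2) (smult ((fps_X ^ k)\<^sup>2) F) = smult ((fps_X ^ Suc k)\<^sup>2) F"
      by (simp add: power_mult_distrib)
    also have "\<dots> = smult (fps_X\<^sup>2) (A'\<^sup>2 + B'\<^sup>2)"
      unfolding Suc.prems(1) by (simp add: A'(1) B'(1) smult_add_right power2_eq_square)
    finally show ?thesis .
  qed
  then have "smult ((fps_X ^ k)\<^sup>2) F = A'\<^sup>2 + B'\<^sup>2"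
    by (simp only: smult_eq_iff_fps_X)
  then show ?case using Suc.IH A'(2) B'(2) Suc.prems by (meson order_trans)
qed auto

lemma cancel_square_sos:
  fixes F A B :: "real fps poly"
  assumes "w \<noteq> 0" "smult (w\<^sup>2) F = A\<^sup>2 + B\<^sup>2" "degree A \<le> d" "degree B \<le> d"
  shows "\<exists>A B. F = A\<^sup>2 + B\<^sup>2 \<and> degree A \<le> d \<and> degree B \<le> d"
proof -
  define k v where "k = subdegree w" and "v = fps_shift k w"
  have w: "w = v * fps_X ^ k" unfolding v_def k_def by (rule subdegree_decompose)
  have v0: "fps_nth v 0 \<noteq> 0" using assms(1) by (simp add: v_def k_def)
  then have v: "v * inverse v = 1" by (simp add: inverse_mult_eq_1')
  have "smult ((inverse v)\<^sup>2) (smult (w\<^sup>2) F) = smult ((v * inverse v)\<^sup>2 * (fps_X ^ k)\<^sup>2) F"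
    by (simp add: w power_mult_distrib mult_ac)
  then have "smult ((fps_X ^ k)\<^sup>2) F = (smult (inverse v) A)\<^sup>2 + (smult (inverse v) B)\<^sup>2"
    by (simp add: v assms(2) smult_add_right smult_power[symmetric])
  moreover have "degree (smult (inverse v) A) \<le> d" "degree (smult (inverse v) B) \<le> d"
    using assms(3,4) degree_smult_le order_trans by blast+
  ultimately show ?thesis by (rule cancel_X_power_sos)
qed

text \<open>A real branch, truncated to a polynomial curve, would make \<open>\<Phi>\<close> decay
  along that curve faster than the lower bound allows.\<close>

lemma real_root_free_of_positive:
  fixes \<Phi> :: "real poly poly"
  assumes "\<epsilon> > 0" "\<kappa> > 0" "even M"
    and pos: "\<And>t z. \<bar>t\<bar> < \<epsilon> \<Longrightarrow> t \<noteq> 0 \<Longrightarrow> eval2 \<Phi> t z \<ge> \<kappa> * t ^ M"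
  shows "real_root_free (map_poly fps_of_poly \<Phi>)"
  unfolding real_root_free_def
proof (intro allI impI ballI notI)
  fix q :: nat and \<sigma> :: real and \<beta>
  assume q: "q > 0" and \<sigma>: "\<sigma> \<in> {1, -1}"
    and root: "poly (map_poly (ssub \<sigma> q) (map_poly fps_of_poly \<Phi>)) \<beta> = 0"
  \<comment> \<open>One order beyond q M, the order of the lower bound along the curve x =
    \<open>\<sigma>\<close> s^q.\<close>
  define N where "N = Suc (q * M)"
  define b where "b = (\<Sum>i<N. monom (fps_nth \<beta> i) i)"
  define P where "P = map_poly (ssub \<sigma> q) (map_poly fps_of_poly \<Phi>)"
  define \<Psi> where "\<Psi> = poly (map_poly (\<lambda>c. pcompose c (monom \<sigma> q)) \<Phi>) b"
  have sub: "fps_of_poly (pcompose c (monom \<sigma> q)) = ssub \<sigma> q (fps_of_poly c)" for c :: "real poly"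
    using q by (simp add: fps_of_poly_pcompose ssub_def fps_of_poly_monom)
  have "P = map_poly fps_of_poly (map_poly (\<lambda>c. pcompose c (monom \<sigma> q)) \<Phi>)"
    by (intro poly_eqI) (simp add: P_def coeff_map_poly sub)
  then have f\<Psi>: "fps_of_poly \<Psi> = poly P (fps_of_poly b)"
    by (simp add: \<Psi>_def fpp.poly_map_hom)
  have "fps_X ^ N dvd \<beta> - fps_of_poly b"
  proof -
    have "fps_cutoff N (\<beta> - fps_of_poly b) = 0"
      by (auto simp: fps_eq_iff b_def coeff_sum)
    then have "\<beta> - fps_of_poly b = fps_shift N (\<beta> - fps_of_poly b) * fps_X ^ N"
      using fps_shift_cutoff[of N "\<beta> - fps_of_poly b"] by simp
    then show ?thesis by (metis dvd_triv_right)
  qed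
  moreover have "\<beta> - fps_of_poly b dvd poly P \<beta> - poly P (fps_of_poly b)"
  proof -
    have "[:- fps_of_poly b, 1:] dvd P - [:poly P (fps_of_poly b):]"
      by (simp add: poly_eq_0_iff_dvd[symmetric])
    then obtain Q where "P - [:poly P (fps_of_poly b):] = [:- fps_of_poly b, 1:] * Q" by (auto elim: dvdE)
    then have "poly (P - [:poly P (fps_of_poly b):]) \<beta> = poly ([:- fps_of_poly b, 1:] * Q) \<beta>" by (simp only:)
    then have "poly P \<beta> - poly P (fps_of_poly b) = (\<beta> - fps_of_poly b) * poly Q \<beta>" by (simp add: left_diff_distrib)
    then show ?thesis by simp
  qed
  ultimately have "fps_X ^ N dvd poly P \<beta> - poly P (fps_of_poly b)" by (rule dvd_trans)
  then have "fps_X ^ N dvd fps_of_poly \<Psi>" using root by (simp add: P_def[symmetric] f\<Psi>)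
  then have "coeff \<Psi> k = 0" if "k < N" for k
    using that by (auto elim!: dvdE simp: fps_X_power_mult_nth simp flip: fps_of_poly_nth)
  then have "monom 1 N dvd \<Psi>" by (simp add: monom_1_dvd_iff')
  then obtain \<Psi>' where \<Psi>': "\<Psi> = monom 1 N * \<Psi>'" by (auto elim: dvdE)
  obtain K where K: "K > 0" "\<And>s. s \<in> {0..1} \<Longrightarrow> \<bar>poly \<Psi>' s\<bar> \<le> K"
    using poly_bounded[of "{0..1}" \<Psi>'] by auto
  define m where "m = min (min 1 \<epsilon>) (\<kappa> / K)"
  define s where "s = m / 2"
  have m: "m > 0" "m \<le> 1" "m \<le> \<epsilon>" "m \<le> \<kappa> / K" using assms(1,2) K(1) by (simp_all add: m_def)
  have s: "s > 0" "s < 1" "s < \<epsilon>" "s * K < \<kappa>"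
  proof -
    show "s > 0" "s < 1" "s < \<epsilon>" using m by (simp_all add: s_def)
    have "s < m" using m by (simp add: s_def)
    then have "s < \<kappa> / K" using m(4) by (rule less_le_trans)
    then show "s * K < \<kappa>" using K(1) by (simp add: field_simps)
  qed
  have abs: "\<bar>\<sigma> * s ^ q\<bar> = s ^ q" using \<sigma> s(1) by (auto simp: abs_mult)
  have "s ^ q \<le> s ^ 1" using s q by (intro power_decreasing) auto
  then have "\<bar>\<sigma> * s ^ q\<bar> < \<epsilon>" using s(3) abs by simp
  moreover have "\<sigma> * s ^ q \<noteq> 0" using \<sigma> s(1) by auto
  ultimately have "eval2 \<Phi> (\<sigma> * s ^ q) (poly b s) \<ge> \<kappa> * (\<sigma> * s ^ q) ^ M" by (rule pos)
  also have "(\<sigma> * s ^ q) ^ M = s ^ (q * M)"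
    using abs assms(3) by (metis power_even_abs power_mult)
  also have "eval2 \<Phi> (\<sigma> * s ^ q) (poly b s) = poly \<Psi> s"
  proof -
    have "poly \<Psi> s = poly (map_poly (\<lambda>p. poly p s) (map_poly (\<lambda>c. pcompose c (monom \<sigma> q)) \<Phi>)) (poly b s)"
      using rhom.poly_map_hom[OF rhom_eval, of s] by (simp add: \<Psi>_def)
    also have "map_poly (\<lambda>p. poly p s) (map_poly (\<lambda>c. pcompose c (monom \<sigma> q)) \<Phi>) = fib \<Phi> (\<sigma> * s ^ q)"
      by (intro poly_eqI) (simp add: coeff_map_poly poly_pcompose poly_monom)
    finally show ?thesis by (simp add: poly_fib)
  qed
  also have "poly \<Psi> s \<le> s ^ N * K"
    using K(2)[of s] s by (simp add: \<Psi>' poly_monom mult_left_mono abs_le_iff)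
  also have "\<dots> = s ^ (q * M) * (s * K)" by (simp add: N_def)
  also have "\<dots> < s ^ (q * M) * \<kappa>" using s by (intro mult_strict_left_mono) auto
  finally show False by simp
qed

text \<open>The norm theorem applies to monic polynomials: there g times its conjugate is A^2 + B^2
  with A, B the real and imaginary parts of g. The leading coefficient l is cleared before and
  cancelled afterwards, which works because l is a square in R[[t]] and two-square representations
  can be divided by squares.\<close>

theorem local_sos:
  fixes \<phi> :: "real poly poly"
  assumes "degree \<phi> \<le> 2 * d" "\<epsilon> > 0" "\<kappa> > 0" "even M"
    and pos: "\<And>t y. \<bar>t\<bar> < \<epsilon> \<Longrightarrow> eval2 \<phi> t y \<ge> \<kappa> * t ^ M * (1 + y\<^sup>2) ^ d"
  shows "\<exists>A B. map_poly fps_of_poly \<phi> = A\<^sup>2 + B\<^sup>2 \<and> degree A \<le> d \<and> degree B \<le> d"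
proof -
  define l where "l = coeff \<phi> (2 * d)"
  have l: "poly l t \<ge> \<kappa> * t ^ M" if "\<bar>t\<bar> < \<epsilon>" for t
    using coeff_ge_of_ge[of "\<kappa> * t ^ M" d "fib \<phi> t"] pos[OF that] degree_fib_le[of \<phi> t] assms(1)
    by (simp add: l_def poly_fib)
  have tM: "t ^ M > 0" if "t \<noteq> 0" for t :: real using assms(4) that by (simp add: zero_less_power_eq)
  have lpos: "poly l t > 0" if "\<bar>t\<bar> < \<epsilon>" "t \<noteq> 0" for t
    using l[OF that(1)] tM[OF that(2)] assms(3) by (smt (verit) mult_pos_pos)
  \<comment> \<open>The monic form \<open>l^(2d-1) \<phi>(z / l)\<close>; for d = 0 the sum is empty
    and \<open>\<Phi>\<close> is 1.\<close>
  define \<Phi> where "\<Phi> = (\<Sum>i<2 * d. monom (coeff \<phi> i * l ^ (2 * d - 1 - i)) i) + monom 1 (2 * d)"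
  have c\<Phi>: "coeff \<Phi> i = (if i < 2 * d then coeff \<phi> i * l ^ (2 * d - 1 - i) else if i = 2 * d then 1 else 0)" for i
    by (auto simp: \<Phi>_def coeff_sum)
  have d\<Phi>: "degree \<Phi> = 2 * d"
    by (intro antisym degree_le le_degree) (auto simp: c\<Phi>)
  have key: "coeff (smult l \<Phi>) i * l ^ i = l ^ (2 * d) * coeff \<phi> i" for i
  proof -
    consider "i < 2 * d" | "i = 2 * d" | "i > 2 * d" by linarith
    then show ?thesis
    proof cases
      case 1
      then have "2 * d = Suc (2 * d - 1 - i) + i" by simp
      then have "l ^ (2 * d) = l * l ^ (2 * d - 1 - i) * l ^ i" by (metis power_Suc power_add)
      then show ?thesis using 1 by (simp add: c\<Phi> mult_ac)
    next
      case 2 then show ?thesis by (simp add: c\<Phi> l_def mult_ac)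
    next
      case 3 then show ?thesis using assms(1) by (simp add: c\<Phi> coeff_eq_0)
    qed
  qed
  obtain L where L: "L > 0" "\<And>t. t \<in> {-\<epsilon>..\<epsilon>} \<Longrightarrow> \<bar>poly l t\<bar> \<le> L"
    using poly_bounded[of "{-\<epsilon>..\<epsilon>}" l] by auto
  \<comment> \<open>In \<open>l \<Phi>(l y) = l^(2d) \<phi>(y)\<close> both l and
    \<open>\<phi>\<close> are at least \<open>\<kappa> t^M\<close>, which gives the exponent 2d + 1;
    the factor l on the left costs the upper bound L.\<close>
  have \<Phi>pos: "eval2 \<Phi> t z \<ge> (\<kappa> ^ Suc (2 * d) / L) * t ^ (M * Suc (2 * d))"
    if t: "\<bar>t\<bar> < \<epsilon>" "t \<noteq> 0" for t z
  proof -
    define y where "y = z / poly l t"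
    have z: "z = poly l t * y" using lpos[OF t] by (simp add: y_def)
    have "poly (fib (smult l \<Phi>) t) (poly l t * y) = poly l t ^ (2 * d) * poly (fib \<phi> t) y"
    proof (rule poly_scale)
      fix i
      have "poly (coeff (smult l \<Phi>) i * l ^ i) t = poly (l ^ (2 * d) * coeff \<phi> i) t" by (simp only: key)
      then show "coeff (fib (smult l \<Phi>) t) i * poly l t ^ i = poly l t ^ (2 * d) * coeff (fib \<phi> t) i"
        by (simp add: poly_power)
    qed
    then have e: "poly l t * eval2 \<Phi> t z = poly l t ^ (2 * d) * eval2 \<phi> t y"
      by (simp add: poly_fib z)
    have "(\<kappa> * t ^ M) ^ (2 * d) * (\<kappa> * t ^ M) \<le> poly l t ^ (2 * d) * eval2 \<phi> t y"
    proof (rule mult_mono)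
      show "(\<kappa> * t ^ M) ^ (2 * d) \<le> poly l t ^ (2 * d)"
        using l[OF t(1)] tM[OF t(2)] assms(3) by (intro power_mono) auto
      have "\<kappa> * t ^ M * 1 \<le> \<kappa> * t ^ M * (1 + y\<^sup>2) ^ d"
        using tM[OF t(2)] assms(3) by (intro mult_left_mono one_le_power) auto
      then show "\<kappa> * t ^ M \<le> eval2 \<phi> t y" using pos[OF t(1), of y] by simp
    qed (use tM[OF t(2)] assms(3) lpos[OF t] in auto)
    then have a: "(\<kappa> * t ^ M) ^ Suc (2 * d) \<le> poly l t * eval2 \<Phi> t z" using e by (simp add: mult.commute)
    have "(\<kappa> * t ^ M) ^ Suc (2 * d) > 0" using tM[OF t(2)] assms(3) by (intro zero_less_power) auto
    then have "eval2 \<Phi> t z > 0" using a lpos[OF t] by (smt (verit) zero_less_mult_pos)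
    moreover have "\<bar>poly l t\<bar> \<le> L" by (rule L(2)) (use t in auto)
    ultimately have "poly l t * eval2 \<Phi> t z \<le> L * eval2 \<Phi> t z" by (intro mult_right_mono) auto
    then have "(\<kappa> * t ^ M) ^ Suc (2 * d) / L \<le> eval2 \<Phi> t z" using a L(1) by (simp add: field_simps)
    then show ?thesis by (simp only: power_mult_distrib power_mult times_divide_eq_left)
  qed
  have "real_root_free (map_poly fps_of_poly \<Phi>)"
    by (rule real_root_free_of_positive[OF assms(2) _ _ \<Phi>pos]) (use assms(3,4) L(1) in auto)
  moreover have mon: "lead_coeff (map_poly fps_of_poly \<Phi>) = 1" "degree (map_poly fps_of_poly \<Phi>) = 2 * d"
    using fpp.monic_map_poly[of \<Phi>] d\<Phi> c\<Phi> by auto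
  ultimately obtain g where g: "lead_coeff g = 1" "map_poly rcf (map_poly fps_of_poly \<Phi>) = g * map_poly cnjf g"
    using real_root_free_norm by blast
  have dg: "degree g = d"
  proof -
    have "2 * d = degree (g * map_poly cnjf g)" using mon(2) g(2) by (metis degree_map_rcf)
    also have "\<dots> = degree g + degree g"
      using g(1) cnjf.monic_map_poly[OF g(1)] by (subst degree_mult_eq) auto
    finally show ?thesis by simp
  qed
  define A where "A = map_poly (\<lambda>c. Abs_fps (\<lambda>n. Re (fps_nth c n))) g"
  define B where "B = map_poly (\<lambda>c. Abs_fps (\<lambda>n. Im (fps_nth c n))) g"
  have dAB: "degree A \<le> d" "degree B \<le> d"
    unfolding A_def B_def dg[symmetric] by (rule map_poly_degree_leq)+
  have gA: "g = map_poly rcf A + smult (fps_const \<i>) (map_poly rcf B)"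
    "map_poly cnjf g = map_poly rcf A - smult (fps_const \<i>) (map_poly rcf B)"
    by (intro poly_eqI; simp add: A_def B_def coeff_map_poly fps_eq_iff complex_eq_iff)+
  have "smult (fps_const \<i>) X * smult (fps_const \<i>) X = - (X * X)" for X :: "complex fps poly"
  proof -
    have "smult (fps_const \<i>) X * smult (fps_const \<i>) X = smult (fps_const (\<i> * \<i>)) (X * X)"
      by (simp only: mult_smult_left mult_smult_right smult_smult fps_const_mult)
    also have "fps_const (\<i> * \<i>) = - 1" by (simp flip: fps_const_neg)
    finally show ?thesis by simp
  qed
  note sq = this
  have "g * map_poly cnjf g = (map_poly rcf A + smult (fps_const \<i>) (map_poly rcf B)) *
      (map_poly rcf A - smult (fps_const \<i>) (map_poly rcf B))"
    by (subst gA(2), subst gA(1), rule refl)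
  also have "\<dots> = map_poly rcf A * map_poly rcf A -
      smult (fps_const \<i>) (map_poly rcf B) * smult (fps_const \<i>) (map_poly rcf B)"
    by (simp only: ring_distribs) (simp add: mult.commute)
  also have "\<dots> = map_poly rcf (A\<^sup>2 + B\<^sup>2)"
    by (subst sq) (simp add: mrcf.hom_add mrcf.hom_mult power2_eq_square)
  finally have "g * map_poly cnjf g = map_poly rcf (A\<^sup>2 + B\<^sup>2)" .
  then have \<Phi>AB: "map_poly fps_of_poly \<Phi> = A\<^sup>2 + B\<^sup>2" using g(2) map_rcf_inj by metis
  obtain s where s: "fps_of_poly l = s\<^sup>2" "s \<noteq> 0"
    using local_nonneg_square[OF assms(2) lpos] by metis
  define L' where "L' = fps_of_poly l"
  have "pcompose (map_poly fps_of_poly (smult l \<Phi>)) [:0, L':] = smult (L' ^ (2 * d)) (map_poly fps_of_poly \<phi>)"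
  proof (rule poly_eqI)
    fix i
    have "fps_of_poly (coeff (smult l \<Phi>) i * l ^ i) = fps_of_poly (l ^ (2 * d) * coeff \<phi> i)" by (simp only: key)
    then show "coeff (pcompose (map_poly fps_of_poly (smult l \<Phi>)) [:0, L':]) i = coeff (smult (L' ^ (2 * d)) (map_poly fps_of_poly \<phi>)) i"
      by (simp add: coeff_pcompose_linear coeff_map_poly L'_def fpp.hom_mult fpp.hom_power mult_ac)
  qed
  also have "map_poly fps_of_poly (smult l \<Phi>) = smult L' (A\<^sup>2 + B\<^sup>2)"
    by (simp add: L'_def \<Phi>AB[symmetric] map_poly_smult fpp.hom_mult)
  finally have "smult (L' ^ (2 * d)) (map_poly fps_of_poly \<phi>)
      = smult (s\<^sup>2) ((pcompose A [:0, L':])\<^sup>2 + (pcompose B [:0, L':])\<^sup>2)"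
    by (simp add: pcompose_smult pcompose_add pcompose_mult power2_eq_square L'_def s(1))
  then have "smult ((L' ^ d)\<^sup>2) (map_poly fps_of_poly \<phi>)
      = (smult s (pcompose A [:0, L':]))\<^sup>2 + (smult s (pcompose B [:0, L':]))\<^sup>2"
    by (simp add: smult_power[symmetric] smult_add_right power_mult[symmetric] mult.commute)
  moreover have "degree (smult s (pcompose C [:0, L':])) \<le> d" if "degree C \<le> d" for C
  proof -
    have "degree (pcompose C [:0, L':]) \<le> degree C * degree [:0, L':]" by (rule degree_pcompose_le)
    also have "\<dots> \<le> degree C * 1" by (intro mult_left_mono) auto
    finally show ?thesis using that degree_smult_le order_trans by (metis mult.right_neutral)
  qed
  moreover have "L' ^ d \<noteq> 0" using s by (simp add: L'_def)
  ultimately show ?thesis using cancel_square_sos dAB by blast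
qed

subsection \<open>Positive polynomials on a union of intervals\<close>

lemma poly_nonneg_at_left_end:
  fixes p :: "real poly"
  assumes "\<And>x. x > r \<Longrightarrow> poly p x \<ge> 0" shows "poly p r \<ge> 0"
proof (rule tendsto_lowerbound)
  show "(poly p \<longlongrightarrow> poly p r) (at_right r)" by (intro tendsto_intros)
  show "\<forall>\<^sub>F x in at_right r. 0 \<le> poly p x"
    using assms by (intro eventually_mono[OF eventually_at_right_less]) auto
qed simp

lemma poly_nonneg_at_right_end:
  fixes p :: "real poly"
  assumes "\<And>x. x < r \<Longrightarrow> poly p x \<ge> 0" shows "poly p r \<ge> 0"
  using poly_nonneg_at_left_end[of "- r" "pcompose p [:0, -1:]"] assms by (simp add: poly_pcompose)

text \<open>Induction on the degree. A real root is double and its square is split off; otherwise a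
  complex root u + iv gives the factor (x - u)^2 + v^2, and a product of two sums of two squares is
  one again. The degree bounds let fibres enter \<open>ycone\<close> with the right d.\<close>

theorem psd_poly_two_squares:
  fixes p :: "real poly"
  assumes "\<And>x. poly p x \<ge> 0"
  shows "\<exists>a b. p = a\<^sup>2 + b\<^sup>2 \<and> 2 * degree a \<le> degree p \<and> 2 * degree b \<le> degree p"
  using assms
proof (induction "degree p" arbitrary: p rule: less_induct)
  case (less p)
  consider "degree p = 0" | r where "degree p > 0" "poly p r = 0" | "degree p > 0" "\<And>r. poly p r \<noteq> 0" by blast
  then show ?case
  proof cases
    case 1
    then obtain c where c: "p = [:c:]" using degree_eq_zeroE by blast
    then have "c \<ge> 0" using less.prems[of 0] by simp
    then show ?thesis by (intro exI[of _ "[:sqrt c:]"] exI[of _ 0]) (simp add: c power2_eq_square)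
  next
    case 2
    obtain p1 where p1: "p = [:- r, 1:] * p1" using 2(2) by (auto simp: poly_eq_0_iff_dvd elim: dvdE)
    have "poly p1 r \<ge> 0"
    proof (rule poly_nonneg_at_left_end)
      fix x assume "x > r"
      moreover have "0 \<le> (x - r) * poly p1 x" using less.prems[of x] by (simp add: p1 left_diff_distrib)
      ultimately show "poly p1 x \<ge> 0" by (simp add: zero_le_mult_iff)
    qed
    moreover have "poly (- p1) r \<ge> 0"
    proof (rule poly_nonneg_at_right_end)
      fix x assume "x < r"
      moreover have "0 \<le> (x - r) * poly p1 x" using less.prems[of x] by (simp add: p1 left_diff_distrib)
      ultimately show "poly (- p1) x \<ge> 0" by (simp add: zero_le_mult_iff)
    qed
    ultimately have "poly p1 r = 0" by simp
    then obtain p2 where p2: "p1 = [:- r, 1:] * p2" by (auto simp: poly_eq_0_iff_dvd elim: dvdE)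
    have p: "p = [:- r, 1:]\<^sup>2 * p2" by (simp only: p1 p2 power2_eq_square mult.assoc)
    have "p2 \<noteq> 0" using 2(1) p by auto
    then have dp: "degree p = 2 + degree p2" unfolding p by (subst degree_mult_eq) (auto simp: degree_power_eq)
    have off: "poly p2 x \<ge> 0" if "x \<noteq> r" for x
    proof -
      have "0 \<le> (x - r)\<^sup>2 * poly p2 x" using less.prems[of x] by (simp add: p poly_power)
      moreover have "(x - r)\<^sup>2 > 0" using that by simp
      ultimately show ?thesis by (simp add: zero_le_mult_iff)
    qed
    have "poly p2 x \<ge> 0" for x
      using off poly_nonneg_at_left_end[of r p2] by (cases "x = r") auto
    then obtain a b where ab: "p2 = a\<^sup>2 + b\<^sup>2" "2 * degree a \<le> degree p2" "2 * degree b \<le> degree p2"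
      using less.hyps[of p2] dp by auto
    have "p = ([:- r, 1:] * a)\<^sup>2 + ([:- r, 1:] * b)\<^sup>2"
      by (simp only: p ab(1) power_mult_distrib distrib_left)
    moreover have "2 * degree ([:- r, 1:] * c) \<le> degree p" if "2 * degree c \<le> degree p2" for c
      using degree_mult_le[of "[:- r, 1:]" c] that dp by simp
    ultimately show ?thesis using ab(2,3) by blast
  next
    case 3
    interpret cr: rhom complex_of_real by standard auto
    interpret mcr: rhom "map_poly complex_of_real" by (rule cr.rhom_map_poly)
    have "\<not> constant (poly (map_poly complex_of_real p))"
      using 3(1) by (simp add: constant_degree degree_map_poly)
    then obtain z where z: "poly (map_poly complex_of_real p) z = 0"
      using fundamental_theorem_of_algebra by blast
    define u v where "u = Re z" and "v = Im z"
    have "v \<noteq> 0"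
    proof
      assume "v = 0"
      then have "z = complex_of_real u" by (simp add: u_def v_def complex_eq_iff)
      then have "complex_of_real (poly p u) = 0" using z by (simp add: cr.poly_map_hom)
      then show False using 3(2) by simp
    qed
    define q where "q = [:u\<^sup>2 + v\<^sup>2, - 2 * u, 1:]"
    have qpos: "poly q x > 0" for x
    proof -
      have "poly q x = (x - u)\<^sup>2 + v\<^sup>2" by (simp add: q_def power2_eq_square algebra_simps)
      then show ?thesis using \<open>v \<noteq> 0\<close> by (simp add: add_nonneg_pos)
    qed
    have "lead_coeff q = 1" by (simp add: q_def)
    define r p2 where "r = p mod q" and "p2 = p div q"
    have pqr: "p = q * p2 + r" by (simp add: r_def p2_def)
    have "degree q = 2" by (simp add: q_def)
    then have "degree r < 2" using degree_mod_less[of q p] by (cases "q = 0") (auto simp: r_def)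
    then have r: "r = [:coeff r 0, coeff r 1:]"
      by (intro poly_eqI) (simp add: coeff_pCons coeff_eq_0 split: nat.split)
    have "poly (map_poly complex_of_real q) z = 0"
      by (simp add: q_def map_poly_pCons u_def v_def complex_eq_iff power2_eq_square algebra_simps)
    then have "poly (map_poly complex_of_real r) z = 0"
      using z by (simp add: pqr mcr.hom_add mcr.hom_mult)
    then have "complex_of_real (coeff r 0) + z * complex_of_real (coeff r 1) = 0"
      by (subst (asm) r) (simp add: map_poly_pCons)
    then have "coeff r 0 + u * coeff r 1 = 0" "v * coeff r 1 = 0"
      by (auto simp: complex_eq_iff u_def v_def)
    then have "r = 0" using \<open>v \<noteq> 0\<close> by (subst r) simp
    then have p: "p = q * p2" using pqr by simp
    have "p2 \<noteq> 0" using 3(1) p by auto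
    moreover have "q \<noteq> 0" by (simp add: q_def)
    ultimately have dp: "degree p = 2 + degree p2" unfolding p \<open>degree q = 2\<close>[symmetric] by (rule degree_mult_eq[rotated])
    have "poly p2 x \<ge> 0" for x
      using less.prems[of x] qpos[of x] by (simp add: p zero_le_mult_iff)
    then obtain a b where ab: "p2 = a\<^sup>2 + b\<^sup>2" "2 * degree a \<le> degree p2" "2 * degree b \<le> degree p2"
      using less.hyps[of p2] dp by auto
    have "q = [:- u, 1:]\<^sup>2 + [:v:]\<^sup>2" by (simp add: q_def power2_eq_square)
    then have "p = ([:- u, 1:] * a - [:v:] * b)\<^sup>2 + ([:- u, 1:] * b + [:v:] * a)\<^sup>2"
      unfolding p ab(1) by algebra
    moreover have "2 * degree ([:- u, 1:] * c + [:w:] * e) \<le> degree p" if "2 * degree c \<le> degree p2" "2 * degree e \<le> degree p2" for c e w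
    proof -
      have "degree ([:- u, 1:] * c + [:w:] * e) \<le> 1 + degree p2 div 2"
        using degree_mult_le[of "[:- u, 1:]" c] degree_mult_le[of "[:w:]" e] that
        by (intro degree_add_le) auto
      then show ?thesis using dp by simp
    qed
    from this[of a b "- v"] this[of b a v] ab(2,3) have "2 * degree ([:- u, 1:] * a - [:v:] * b) \<le> degree p"
      "2 * degree ([:- u, 1:] * b + [:v:] * a) \<le> degree p" by simp_all
    ultimately show ?thesis by blast
  qed
qed

text \<open>The preordering of R[x] generated by G, given by closure rules so that membership needs
  no bookkeeping over subsets of generators. It is translated to the format of
  \<open>preordering\<close> in \<open>preordering_po_mult\<close>.\<close>

inductive_set po :: "real poly set \<Rightarrow> real poly set" for G where
  gen: "g \<in> G \<Longrightarrow> g \<in> po G"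
| square: "p\<^sup>2 \<in> po G"
| add: "p \<in> po G \<Longrightarrow> q \<in> po G \<Longrightarrow> p + q \<in> po G"
| mult: "p \<in> po G \<Longrightarrow> q \<in> po G \<Longrightarrow> p * q \<in> po G"

lemma po_psd: "(\<And>x. poly p x \<ge> 0) \<Longrightarrow> p \<in> po G"
  using psd_poly_two_squares[of p] by (metis po.square po.add)

text \<open>In the affine coordinate t that maps the gap to [-1, 1], with r', s' in it, the
  multiplier (1 - r' s') / 2 equalises the coefficients of t^2 and 1. Up to a positive factor the
  difference is m/2 (t^2 + 1) - (r' + s') t with m = 1 + r' s', and |r' + s'| <= m makes it
  nonnegative.\<close>

lemma gap_quadratic:
  fixes A B r s :: real
  assumes "A < B" "A \<le> r" "r \<le> B" "A \<le> s" "s \<le> B"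
  obtains l where "l \<ge> 0" "\<And>x. (x - r) * (x - s) - l * ((x - A) * (x - B)) \<ge> 0"
proof -
  define h where "h = (B - A) / 2"
  define \<mu> where "\<mu> = (A + B) / 2"
  have h: "h > 0" using assms(1) by (simp add: h_def)
  define r' s' where "r' = (r - \<mu>) / h" and "s' = (s - \<mu>) / h"
  have rs: "r = \<mu> + h * r'" "s = \<mu> + h * s'" using h by (simp_all add: r'_def s'_def)
  have AB: "A = \<mu> - h" "B = \<mu> + h" by (simp_all add: h_def \<mu>_def field_simps)
  have b: "\<bar>r'\<bar> \<le> 1" "\<bar>s'\<bar> \<le> 1"
    using assms h by (auto simp: r'_def s'_def abs_le_iff field_simps AB)
  define m where "m = 1 + r' * s'"
  have "(1 + r') * (1 + s') \<ge> 0" "(1 - r') * (1 - s') \<ge> 0" using b by (auto simp: abs_le_iff)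
  then have mb: "\<bar>r' + s'\<bar> \<le> m" by (simp add: m_def abs_le_iff algebra_simps)
  have "\<bar>r' * s'\<bar> \<le> 1" using b by (simp add: abs_mult mult_le_one)
  then have l: "(1 - r' * s') / 2 \<ge> 0" by (simp add: abs_le_iff)
  show ?thesis
  proof (rule that[OF l])
    fix x
    define t where "t = (x - \<mu>) / h"
    have x: "x = \<mu> + h * t" using h by (simp add: t_def)
    have "2 * \<bar>t\<bar> \<le> t\<^sup>2 + 1" using zero_le_power2[of "\<bar>t\<bar> - 1"] by (simp add: power2_eq_square algebra_simps)
    then have "m * (2 * \<bar>t\<bar>) \<le> m * (t\<^sup>2 + 1)" using mb by (intro mult_left_mono) auto
    moreover have "(r' + s') * t \<le> \<bar>r' + s'\<bar> * \<bar>t\<bar>" by (metis abs_ge_self abs_mult)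
    moreover have "\<bar>r' + s'\<bar> * \<bar>t\<bar> \<le> m * \<bar>t\<bar>" using mb by (intro mult_right_mono) auto
    ultimately have "0 \<le> m / 2 * (t\<^sup>2 + 1) - (r' + s') * t" by simp
    then have "0 \<le> h\<^sup>2 * (m / 2 * (t\<^sup>2 + 1) - (r' + s') * t)" by simp
    also have "\<dots> = (x - r) * (x - s) - (1 - r' * s') / 2 * ((x - A) * (x - B))"
      unfolding x rs AB m_def by (simp add: field_simps power2_eq_square)
    finally show "(x - r) * (x - s) - (1 - r' * s') / 2 * ((x - A) * (x - B)) \<ge> 0" .
  qed
qed


lemma po_const: "c \<ge> 0 \<Longrightarrow> [:c:] \<in> po G"
  by (rule po_psd) simp

lemma poly_root_between:
  fixes p :: "real poly"
  assumes "x < y" "poly p x * poly p y < 0"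
  obtains z where "x < z" "z < y" "poly p z = 0"
  using poly_IVT[of x y p] assms by auto

section \<open>Unions of intervals and their preordering in one variable\<close>

locale intervals =
  fixes k :: nat and a b :: "nat \<Rightarrow> real"
  assumes k: "k \<ge> 1" and ab: "\<And>i. i < k \<Longrightarrow> a i \<le> b i"
    and ba: "\<And>i. Suc i < k \<Longrightarrow> b i < a (Suc i)"
begin

definition U :: "real set" where "U = (\<Union>i<k. {a i..b i})"

definition gens :: "real poly set" where
  "gens = {[:- a 0, 1:], [:b (k - 1), -1:]} \<union> {[:- a (Suc i), 1:] * [:- b i, 1:] | i. Suc i < k}"

abbreviation C :: "real poly set" where "C \<equiv> po gens"

lemma compact_U: "compact U"
  unfolding U_def by (intro compact_UN) auto

lemma a_in_U: "i < k \<Longrightarrow> a i \<in> U" and b_in_U: "i < k \<Longrightarrow> b i \<in> U"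
  using ab by (auto simp: U_def)

lemma U_nonempty: "U \<noteq> {}"
  using a_in_U[of 0] k by auto

lemma b_less_a: "j < k \<Longrightarrow> i < j \<Longrightarrow> b i < a j"
proof (induction j)
  case (Suc j)
  show ?case
  proof (cases "i = j")
    case False
    then have "b i < a j" using Suc by auto
    also have "a j \<le> b j" using ab Suc.prems by auto
    also have "b j < a (Suc j)" using ba Suc.prems by auto
    finally show ?thesis .
  qed (use ba Suc.prems in auto)
qed simp

lemma U_gap: "Suc i < k \<Longrightarrow> x \<in> U \<Longrightarrow> x \<le> b i \<or> a (Suc i) \<le> x"
proof -
  assume i: "Suc i < k" and "x \<in> U"
  then obtain j where j: "j < k" "a j \<le> x" "x \<le> b j" by (auto simp: U_def)
  consider "j \<le> i" | "j \<ge> Suc i" by linarith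
  then show ?thesis
  proof cases
    case 1
    then have "b j \<le> b i" using b_less_a[of i j] ab[of i] i by (cases "j = i") auto
    then show ?thesis using j by simp
  next
    case 2
    then have "a (Suc i) \<le> a j" using b_less_a[of j "Suc i"] ab[of "Suc i"] j i by (cases "j = Suc i") auto
    then show ?thesis using j by simp
  qed
qed

lemma U_bounds: "x \<in> U \<Longrightarrow> a 0 \<le> x \<and> x \<le> b (k - 1)"
proof -
  assume "x \<in> U"
  then obtain j where j: "j < k" "a j \<le> x" "x \<le> b j" by (auto simp: U_def)
  have "a 0 \<le> a j" using b_less_a[of j 0] ab[of 0] j by (cases "j = 0") auto
  moreover have "b j \<le> b (k - 1)"
  proof (cases "j = k - 1")
    case False
    then have "b j < a (k - 1)" using b_less_a[of "k - 1" j] j by linarith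
    then show ?thesis using ab[of "k - 1"] j by linarith
  qed simp
  ultimately show ?thesis using j by linarith
qed

lemma gap_of_not_in_U:
  assumes "x \<notin> U" "a 0 \<le> x" "x \<le> b (k - 1)"
  obtains i where "Suc i < k" "b i < x" "x < a (Suc i)"
proof -
  define I where "I = {i. i < k \<and> a i \<le> x}"
  have I: "finite I" "I \<noteq> {}" using assms(2) k by (auto simp: I_def intro!: exI[of _ 0])
  define i where "i = Max I"
  have "i \<in> I" unfolding i_def using I by (rule Max_in)
  then have i: "i < k" "a i \<le> x" by (auto simp: I_def)
  then have bx: "b i < x" using assms(1) unfolding U_def by (meson UN_I atLeastAtMost_iff lessThan_iff not_le)
  have Si: "Suc i < k"
  proof (rule ccontr)
    assume "\<not> Suc i < k"
    then have "i = k - 1" using i by simp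
    then show False using bx assms(3) by simp
  qed
  have "Suc i \<notin> I" using Max_ge[OF I(1), of "Suc i"] by (auto simp: i_def)
  then have "x < a (Suc i)" using Si by (auto simp: I_def)
  then show ?thesis using that Si bx by blast
qed

lemma gens_nonneg: "g \<in> gens \<Longrightarrow> x \<in> U \<Longrightarrow> poly g x \<ge> 0"
proof -
  assume g: "g \<in> gens" and x: "x \<in> U"
  have "0 \<le> (x - a (Suc i)) * (x - b i)" if "Suc i < k" for i
    using U_gap[OF that x] ba[OF that] by (auto simp: zero_le_mult_iff)
  then show ?thesis using g U_bounds[OF x] by (auto simp: gens_def algebra_simps)
qed

text \<open>Roots, none of which lies in U, are split off. Outside the hull, the linear factor is an
  outer generator plus a constant. In a gap, positivity at both ends forces a second root in the
  same gap, and the pair is covered by \<open>gap_quadratic\<close>. Without roots the polynomial is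
  nonnegative on R.\<close>

lemma pos_in_C:
  assumes "\<And>x. x \<in> U \<Longrightarrow> poly c x > 0"
  shows "c \<in> C"
  using assms
proof (induction "degree c" arbitrary: c rule: less_induct)
  case (less c)
  have c0: "c \<noteq> 0" using less.prems U_nonempty by auto
  have quot: "\<exists>c1. c = [:- r, 1:] * c1 \<and> degree c1 < degree c" if "poly c r = 0" for r
  proof -
    obtain c1 where c1: "c = [:- r, 1:] * c1" using \<open>poly c r = 0\<close> by (auto simp: poly_eq_0_iff_dvd elim: dvdE)
    then have "c1 \<noteq> 0" using c0 by auto
    then have "degree c = 1 + degree c1" unfolding c1 by (subst degree_mult_eq) auto
    then show ?thesis using c1 by auto
  qed
  show ?case
  proof (cases "\<exists>r. poly c r = 0")
    case False
    obtain u where u: "u \<in> U" using U_nonempty by blast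
    have "poly c x \<ge> 0" for x
    proof (rule ccontr)
      assume "\<not> poly c x \<ge> 0"
      then have "poly c x * poly c u < 0" "x \<noteq> u" using less.prems[OF u] by (auto simp: mult_neg_pos)
      then show False using poly_root_between[of x u c] poly_root_between[of u x c] False
        by (metis linorder_neqE mult.commute)
    qed
    then show ?thesis by (rule po_psd)
  next
    case True
    then obtain r where r: "poly c r = 0" by blast
    then have rU: "r \<notin> U" using less.prems by force
    obtain c1 where c1: "c = [:- r, 1:] * c1" "degree c1 < degree c" using quot[OF r] by blast
    have val: "poly c x = (x - r) * poly c1 x" for x by (simp add: c1(1) left_diff_distrib)
    consider "r < a 0" | "r > b (k - 1)" | "a 0 \<le> r" "r \<le> b (k - 1)" by linarith
    then show ?thesis
    proof cases
      case 1
      have "poly c1 x > 0" if "x \<in> U" for x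
        using less.prems[OF that] U_bounds[OF that] 1 by (simp add: val zero_less_mult_iff)
      then have "c1 \<in> C" using less.hyps c1(2) by blast
      moreover have "[:- r, 1:] = [:- a 0, 1:] + [:a 0 - r:]" by simp
      then have "[:- r, 1:] \<in> C"
        using po.add[OF po.gen po_const, of "[:- a 0, 1:]" gens "a 0 - r"] 1 by (simp add: gens_def)
      ultimately show ?thesis unfolding c1(1) by (intro po.mult)
    next
      case 2
      have "poly (- c1) x > 0" if "x \<in> U" for x
        using less.prems[OF that] U_bounds[OF that] 2 by (simp add: val zero_less_mult_iff)
      then have "- c1 \<in> C" using less.hyps c1(2) by (metis degree_minus)
      moreover have "[:r, -1:] = [:b (k - 1), -1:] + [:r - b (k - 1):]" by simp
      then have "[:r, -1:] \<in> C"
        using po.add[OF po.gen po_const, of "[:b (k - 1), -1:]" gens "r - b (k - 1)"] 2 by (simp add: gens_def)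
      moreover have "c = [:r, -1:] * (- c1)"
      proof -
        have "[:r, -1:] = - [:- r, 1:]" by simp
        then show ?thesis by (simp only: c1(1) minus_mult_minus)
      qed
      ultimately show ?thesis using po.mult by metis
    next
      case 3
      obtain i where i: "Suc i < k" "b i < r" "r < a (Suc i)" using gap_of_not_in_U[OF rU 3] .
      have lr: "poly c (b i) > 0" "poly c (a (Suc i)) > 0"
        using less.prems b_in_U[of i] a_in_U[of "Suc i"] i(1) by auto
      have "poly c1 (b i) < 0" "poly c1 (a (Suc i)) > 0"
        using lr i by (auto simp: val zero_less_mult_iff)
      then obtain s where s: "b i < s" "s < a (Suc i)" "poly c1 s = 0"
        using poly_root_between[of "b i" "a (Suc i)" c1] ba[OF i(1)] by (auto simp: mult_neg_pos)
      obtain c2 where c2: "c1 = [:- s, 1:] * c2" using s(3) by (auto simp: poly_eq_0_iff_dvd elim: dvdE)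
      have "c1 \<noteq> 0" using c1(1) c0 by auto
      then have "degree c2 \<le> degree c1" unfolding c2 by (subst degree_mult_eq) auto
      moreover have "poly c2 x > 0" if "x \<in> U" for x
      proof -
        have "poly c1 x = (x - s) * poly c2 x" by (simp add: c2 left_diff_distrib)
        then have "0 < ((x - r) * (x - s)) * poly c2 x"
          using less.prems[OF that] by (simp only: val mult.assoc)
        moreover have "0 < (x - r) * (x - s)"
          using U_gap[OF i(1) that] i s by (auto simp: zero_less_mult_iff)
        ultimately show ?thesis by (simp add: zero_less_mult_iff)
      qed
      ultimately have "c2 \<in> C" using less.hyps[of c2] c1(2) by auto
      moreover have "[:- r, 1:] * [:- s, 1:] \<in> C"
      proof -
        obtain l where l: "l \<ge> 0" "\<And>x. (x - r) * (x - s) - l * ((x - b i) * (x - a (Suc i))) \<ge> 0"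
          using gap_quadratic[of "b i" "a (Suc i)" r s] i s ba[OF i(1)] by (auto simp del: mult_eq_0_iff)
        define g where "g = [:- a (Suc i), 1:] * [:- b i, 1:]"
        have "g \<in> C" using i(1) by (intro po.gen) (auto simp: gens_def g_def)
        then have "[:l:] * g \<in> C" using po_const[OF l(1)] by (intro po.mult)
        moreover have "[:- r, 1:] * [:- s, 1:] - [:l:] * g \<in> C"
        proof (rule po_psd)
          fix x
          show "0 \<le> poly ([:- r, 1:] * [:- s, 1:] - [:l:] * g) x"
            using l(2)[of x] by (simp add: g_def algebra_simps)
        qed
        ultimately have "[:l:] * g + ([:- r, 1:] * [:- s, 1:] - [:l:] * g) \<in> C" by (rule po.add)
        then show ?thesis by simp
      qed
      ultimately have "([:- r, 1:] * [:- s, 1:]) * c2 \<in> C" by (rule po.mult[rotated])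
      then show ?thesis by (simp only: c1(1) c2 mult.assoc)
    qed
  qed
qed

text \<open>A Bezout inverse of u modulo e = \<open>(x - \<beta>)^N\<close> need not be positive on
  U. A large multiple of e, nonnegative because N is even, repairs this without changing the residue
  class, and \<open>pos_in_C\<close> applies.\<close>

lemma modular_inverse_pos:
  assumes "poly u \<beta> > 0" "even N"
  obtains p where "[:- \<beta>, 1:] ^ N dvd u * p - 1" "p \<in> C"
proof -
  define e where "e = [:- \<beta>, 1:] ^ N"
  have "\<not> [:- \<beta>, 1:] dvd u" using assms(1) by (auto simp: poly_eq_0_iff_dvd[symmetric])
  moreover have "prime_elem [:- \<beta>, 1:]" by (rule prime_elem_linear_field_poly) simp
  ultimately have "coprime u e" unfolding e_def by (metis prime_elem_imp_power_coprime)
  then obtain s t where st: "s * u + t * e = 1"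
    by (metis bezout_coefficients_fst_snd coprime_imp_gcd_eq_1)
  have ev: "poly e x = (x - \<beta>) ^ N" for x by (simp add: e_def poly_power)
  have sb: "N > 0 \<Longrightarrow> poly s \<beta> > 0"
  proof -
    assume "N > 0"
    have "poly (s * u + t * e) \<beta> = 1" by (simp add: st)
    then have "poly s \<beta> * poly u \<beta> = 1" using \<open>N > 0\<close> by (simp add: ev zero_power)
    then show ?thesis using assms(1) by (metis zero_less_mult_pos2 zero_less_one)
  qed
  obtain S where S: "S > 0" "\<And>x. x \<in> U \<Longrightarrow> \<bar>poly s x\<bar> \<le> S" using poly_bounded[OF compact_U] by metis
  \<comment> \<open>For N = 0 the modulus is 1, s may have any sign at \<open>\<beta>\<close>, and a
    constant suffices. Otherwise s is positive near \<open>\<beta>\<close>, and farther away e is at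
    least \<open>\<delta>^N\<close>, which determines K.\<close>
  obtain K where K: "\<And>x. x \<in> U \<Longrightarrow> poly (s + [:K:] * e) x > 0"
  proof (cases "N = 0")
    case True
    show ?thesis
    proof (rule that[of "S + 1"])
      fix x assume "x \<in> U"
      then show "poly (s + [:S + 1:] * e) x > 0" using S(2)[of x] True by (simp add: ev abs_le_iff)
    qed
  next
    case False
    have "isCont (poly s) \<beta>" by simp
    then obtain \<delta> where \<delta>: "\<delta> > 0" "\<And>x. \<bar>x - \<beta>\<bar> < \<delta> \<Longrightarrow> \<bar>poly s x - poly s \<beta>\<bar> < poly s \<beta>"
      using sb False unfolding continuous_at_eps_delta dist_real_def by blast
    show ?thesis
    proof (rule that[of "(S + 1) / \<delta> ^ N"])
      fix x assume x: "x \<in> U"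
      have K0: "(S + 1) / \<delta> ^ N > 0" using S(1) \<delta>(1) by simp
      have e0: "(x - \<beta>) ^ N \<ge> 0" using assms(2) by (simp add: zero_le_even_power)
      show "poly (s + [:(S + 1) / \<delta> ^ N:] * e) x > 0"
      proof (cases "\<bar>x - \<beta>\<bar> < \<delta>")
        case True
        then have "poly s x > 0" using \<delta>(2)[of x] by (simp add: abs_less_iff)
        moreover have "(S + 1) / \<delta> ^ N * (x - \<beta>) ^ N \<ge> 0" using K0 e0 by (intro mult_nonneg_nonneg) auto
        ultimately show ?thesis by (simp add: ev)
      next
        case F: False
        have "\<delta> ^ N \<le> \<bar>x - \<beta>\<bar> ^ N" using F \<delta>(1) by (intro power_mono) auto
        also have "\<dots> = (x - \<beta>) ^ N" using assms(2) by (rule power_even_abs)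
        finally have "(S + 1) / \<delta> ^ N * \<delta> ^ N \<le> (S + 1) / \<delta> ^ N * (x - \<beta>) ^ N"
          using K0 by (intro mult_left_mono) auto
        then have "S + 1 \<le> (S + 1) / \<delta> ^ N * (x - \<beta>) ^ N" using \<delta>(1) by simp
        then show ?thesis using S(2)[OF x] by (simp add: ev abs_le_iff)
      qed
    qed
  qed
  show ?thesis
  proof (rule that)
    show "s + [:K:] * e \<in> C" using K by (rule pos_in_C)
    have "u * (s + [:K:] * e) - 1 = e * (u * [:K:] - t)"
      unfolding st[symmetric] by (simp add: algebra_simps)
    then show "[:- \<beta>, 1:] ^ N dvd u * (s + [:K:] * e) - 1" unfolding e_def by (metis dvd_triv_left)
  qed
qed

text \<open>For i > 0 the parameter x - a_i is negative on earlier intervals. The gap generator is x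
  - a_i times x - b_(i-1), and the second factor is positive at a_i; multiplying by its modular
  inverse from C restores the parameter up to order N.\<close>

lemma local_left_multiplier:
  assumes "i < k" "even N"
  obtains c where "c \<in> C" "[:- a i, 1:] ^ N dvd c - [:- a i, 1:]"
proof -
  obtain u where u: "[:- a i, 1:] * u \<in> C" "poly u (a i) > 0"
  proof (cases i)
    case 0
    show ?thesis by (rule that[of 1]) (auto simp: 0 gens_def intro: po.gen)
  next
    case (Suc j)
    show ?thesis
    proof (rule that[of "[:- b j, 1:]"])
      show "[:- a i, 1:] * [:- b j, 1:] \<in> C" using assms(1) by (intro po.gen) (auto simp: gens_def Suc)
    qed (use ba[of j] assms(1) Suc in auto)
  qed
  obtain p where p: "[:- a i, 1:] ^ N dvd u * p - 1" "p \<in> C" using modular_inverse_pos[OF u(2) assms(2)] .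
  show ?thesis
  proof (rule that)
    show "([:- a i, 1:] * u) * p \<in> C" using u(1) p(2) by (rule po.mult)
    have "([:- a i, 1:] * u) * p - [:- a i, 1:] = [:- a i, 1:] * (u * p - 1)" by (simp only: right_diff_distrib mult.assoc mult_1_right)
    then show "[:- a i, 1:] ^ N dvd ([:- a i, 1:] * u) * p - [:- a i, 1:]" using p(1) by (simp only: dvd_mult)
  qed
qed

lemma local_right_multiplier:
  assumes "i < k" "even N"
  obtains c where "c \<in> C" "[:- b i, 1:] ^ N dvd c - [:b i, -1:]"
proof -
  obtain u where u: "[:b i, -1:] * u \<in> C" "poly u (b i) > 0"
  proof (cases "i = k - 1")
    case True
    show ?thesis by (rule that[of 1]) (auto simp: True gens_def intro: po.gen)
  next
    case False
    then have i: "Suc i < k" using assms(1) by simp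
    show ?thesis
    proof (rule that[of "[:a (Suc i), -1:]"])
      have "[:b i, -1:] * [:a (Suc i), -1:] = [:- a (Suc i), 1:] * [:- b i, 1:]" by simp
      then show "[:b i, -1:] * [:a (Suc i), -1:] \<in> C" using i by (metis (mono_tags, lifting) UnI2 gens_def mem_Collect_eq po.gen)
    qed (use ba[OF i] in auto)
  qed
  obtain p where p: "[:- b i, 1:] ^ N dvd u * p - 1" "p \<in> C" using modular_inverse_pos[OF u(2) assms(2)] .
  show ?thesis
  proof (rule that)
    show "([:b i, -1:] * u) * p \<in> C" using u(1) p(2) by (rule po.mult)
    have "([:b i, -1:] * u) * p - [:b i, -1:] = [:b i, -1:] * (u * p - 1)" by (simp only: right_diff_distrib mult.assoc mult_1_right)
    then show "[:- b i, 1:] ^ N dvd ([:b i, -1:] * u) * p - [:b i, -1:]" using p(1) by (simp only: dvd_mult)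
  qed
qed

end

subsection \<open>Strictly positive polynomials on the strip\<close>

text \<open>Multipliers come from R[x] and each square has y-degree at most d, which excludes
  cancellation of high powers of y and makes (1 + y^2)^d the right scale for positivity.\<close>

inductive_set ycone :: "real poly set \<Rightarrow> nat \<Rightarrow> real poly poly set" for C d where
  zero: "0 \<in> ycone C d"
| step: "F \<in> ycone C d \<Longrightarrow> c \<in> C \<Longrightarrow> degree p \<le> d \<Longrightarrow> F + smult c (p\<^sup>2) \<in> ycone C d"

lemma ycone_add:
  assumes "F \<in> ycone C d" "G \<in> ycone C d"
  shows "F + G \<in> ycone C d"
  using assms(2)
proof (induction G rule: ycone.induct)
  case (step G c p)
  then have "F + G + smult c (p\<^sup>2) \<in> ycone C d" by (intro ycone.step)
  then show ?case by (simp add: add.assoc)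
qed (simp add: assms(1))

lemma ycone_single: "c \<in> C \<Longrightarrow> degree p \<le> d \<Longrightarrow> smult c (p\<^sup>2) \<in> ycone C d"
  using ycone.step[OF ycone.zero] by fastforce

lemma ycone_smult: "F \<in> ycone (po G) d \<Longrightarrow> c \<in> po G \<Longrightarrow> smult c F \<in> ycone (po G) d"
proof (induction F rule: ycone.induct)
  case (step F e p)
  then have "smult c F + smult (c * e) (p\<^sup>2) \<in> ycone (po G) d" by (intro ycone.step po.mult) auto
  then show ?case by (simp add: smult_add_right)
qed (simp add: ycone.zero)

lemma ycone_sum: "(\<And>i. i \<in> I \<Longrightarrow> F i \<in> ycone C d) \<Longrightarrow> sum F I \<in> ycone C d"
  by (induction I rule: infinite_finite_induct) (auto intro: ycone_add ycone.zero)

lemma degree_ycone: "F \<in> ycone C d \<Longrightarrow> degree F \<le> 2 * d"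
proof (induction F rule: ycone.induct)
  case (step F c p)
  have "degree (smult c (p\<^sup>2)) \<le> 2 * d"
    using degree_smult_le[of c "p\<^sup>2"] degree_power_le[of p 2] step by linarith
  then show ?case using step by (intro degree_add_le)
qed simp

abbreviation liftc :: "real poly \<Rightarrow> real poly poly" where
  "liftc \<equiv> map_poly (\<lambda>c. [:c:])"

lemma rhom_const: "rhom (\<lambda>c::real. [:c:])"
  by standard auto

interpretation liftc: rhom liftc by (rule rhom.rhom_map_poly[OF rhom_const])

lemma psd_liftc_in_ycone:
  assumes "\<And>y. poly p y \<ge> 0" "degree p \<le> 2 * d"
  shows "liftc p \<in> ycone (po G) d"
proof -
  obtain u v where uv: "p = u\<^sup>2 + v\<^sup>2" "2 * degree u \<le> degree p" "2 * degree v \<le> degree p"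
    using psd_poly_two_squares assms(1) by blast
  have "smult 1 ((liftc w)\<^sup>2) \<in> ycone (po G) d" if "2 * degree w \<le> degree p" for w
    using that assms(2) map_poly_degree_leq[of "\<lambda>c. [:c:]" w]
    by (intro ycone_single) (auto intro: po_const simp: one_pCons)
  from ycone_add[OF this[OF uv(2)] this[OF uv(3)]] show ?thesis
    by (simp add: uv(1) liftc.hom_add liftc.hom_power)
qed

lemma smult_sum_right: "smult c (sum f A) = (\<Sum>x\<in>A. smult c (f x))"
  by (induction A rule: infinite_finite_induct) (auto simp: smult_add_right)

lemma sum_even_odd:
  fixes f :: "nat \<Rightarrow> 'a::comm_monoid_add"
  shows "(\<Sum>i\<le>2 * d. f i) = (\<Sum>k\<le>d. f (2 * k)) + (\<Sum>k<d. f (2 * k + 1))"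
  by (induction d) (simp_all add: ac_simps)

text \<open>The sum 1 + y^2 + ... + y^(2d), an inner point of the cone: multiples of it absorb small
  perturbations of all coefficients up to degree 2d.\<close>

definition evens :: "nat \<Rightarrow> real poly poly" where
  "evens d = (\<Sum>k\<le>d. monom 1 (2 * k))"

text \<open>Half of each y^(2k) goes to either neighbouring pair of even powers; the two ends have
  only one neighbour and keep a half.\<close>

lemma evens_split:
  "smult [:\<eta>:] (evens d) = (\<Sum>k<d. smult [:\<eta> / 2:] (monom 1 (2 * k) + monom 1 (2 * k + 2)))
      + smult [:\<eta> / 2:] (monom 1 0 + monom 1 (2 * d))"
proof -
  have h: "smult [:\<eta>:] p = smult [:\<eta> / 2:] p + smult [:\<eta> / 2:] p" for p :: "real poly poly"
    by (simp flip: smult_add_left)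
  show ?thesis
  proof (induction d)
    case 0
    then show ?case by (simp only: evens_def h smult_add_right) (simp add: smult_add_right)
  next
    case (Suc d)
    then show ?case by (simp add: evens_def smult_add_right h algebra_simps)
  qed
qed

text \<open>One copy of \<open>\<eta>\<close> times \<open>evens d\<close> makes the even
  coefficients positive on U. The other copy serves an odd coefficient e through \<open>e y^(2k+1) +
  \<eta>/2 (y^(2k) + y^(2k+2)) = (\<eta> + e)/4 (y^k + y^(k+1))^2 + (\<eta> - e)/4 (y^k -
  y^(k+1))^2\<close>, whose multipliers are positive on U.\<close>

lemma (in intervals) small_coeffs_in_ycone:
  assumes "degree E \<le> 2 * d" "\<eta> > 0" "\<And>i x. x \<in> U \<Longrightarrow> \<bar>poly (coeff E i) x\<bar> < \<eta>"
  shows "E + smult [:2 * \<eta>:] (evens d) \<in> ycone C d"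
proof -
  let ?e = "coeff E" and ?y = "\<lambda>n. monom (1 :: real poly) n"
  define T where "T k = smult (smult (1/4) (?e (2 * k + 1) + [:\<eta>:])) ((?y k + ?y (k + 1))\<^sup>2)
    + smult (smult (1/4) ([:\<eta>:] - ?e (2 * k + 1))) ((?y k - ?y (k + 1))\<^sup>2)" for k
  have pos: "smult (1/4) (?e i + [:\<eta>:]) \<in> C" "smult (1/4) ([:\<eta>:] - ?e i) \<in> C" "?e i + [:\<eta>:] \<in> C" for i
    using assms(3)[of _ i] by (auto intro!: pos_in_C simp: abs_less_iff; smt (verit))+
  have deg: "degree (?y k + ?y (k + 1)) \<le> d" "degree (?y k - ?y (k + 1)) \<le> d" if "k < d" for k
    using that by (intro degree_add_le degree_diff_le; simp add: degree_monom_eq)+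
  have T: "T k \<in> ycone C d" if "k < d" for k
    unfolding T_def by (intro ycone_add ycone_single pos deg that)
  have Teq: "T k = monom (?e (2 * k + 1)) (2 * k + 1) + smult [:\<eta> / 2:] (?y (2 * k) + ?y (2 * k + 2))" for k
  proof -
    have y: "?y k * ?y k = ?y (2 * k)" "?y (k + 1) * ?y (k + 1) = ?y (2 * k + 2)" "?y k * ?y (k + 1) = ?y (2 * k + 1)"
      by (simp_all add: mult_monom mult_2)
    have s: "(?y k + ?y (k + 1))\<^sup>2 = ?y (2 * k) + ?y (2 * k + 2) + (?y (2 * k + 1) + ?y (2 * k + 1))"
      "(?y k - ?y (k + 1))\<^sup>2 = ?y (2 * k) + ?y (2 * k + 2) - (?y (2 * k + 1) + ?y (2 * k + 1))"
      unfolding y[symmetric] by (simp_all add: power2_eq_square algebra_simps)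
    have gen: "smult P (Y + Z) + smult Q (Y - Z) = smult (P + Q) Y + smult (P - Q) Z" for P Q :: "real poly" and Y Z
      by (simp add: smult_add_left smult_add_right smult_diff_left smult_diff_right)
    have "T k = smult (smult (1/4) (?e (2 * k + 1) + [:\<eta>:]) + smult (1/4) ([:\<eta>:] - ?e (2 * k + 1))) (?y (2 * k) + ?y (2 * k + 2))
       + smult (smult (1/4) (?e (2 * k + 1) + [:\<eta>:]) - smult (1/4) ([:\<eta>:] - ?e (2 * k + 1))) ((?y (2 * k + 1) + ?y (2 * k + 1)))"
      unfolding T_def s by (rule gen)
    also have "smult (1/4) (?e (2 * k + 1) + [:\<eta>:]) + smult (1/4) ([:\<eta>:] - ?e (2 * k + 1)) = [:\<eta> / 2:]"
      by (intro poly_eqI) (simp add: coeff_pCons field_simps split: nat.split)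
    also have "smult (1/4) (?e (2 * k + 1) + [:\<eta>:]) - smult (1/4) ([:\<eta>:] - ?e (2 * k + 1)) = smult (1/2) (?e (2 * k + 1))"
      by (intro poly_eqI) (simp add: coeff_pCons field_simps split: nat.split)
    also have "smult (smult (1/2) (?e (2 * k + 1))) (?y (2 * k + 1) + ?y (2 * k + 1))
        = smult (smult (1/2) (?e (2 * k + 1)) + smult (1/2) (?e (2 * k + 1))) (?y (2 * k + 1))"
      by (simp only: smult_add_left smult_add_right)
    also have "smult (1/2) (?e (2 * k + 1)) + smult (1/2) (?e (2 * k + 1)) = ?e (2 * k + 1)"
      by (simp flip: smult_add_left)
    also have "smult (?e (2 * k + 1)) (?y (2 * k + 1)) = monom (?e (2 * k + 1)) (2 * k + 1)"
      by (simp add: smult_monom)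
    finally show ?thesis by (simp add: add.commute)
  qed
  have sq: "smult c (?y (2 * k)) \<in> ycone C d" if "c \<in> C" "k \<le> d" for c k
  proof -
    have "smult c ((?y k)\<^sup>2) \<in> ycone C d" using that by (intro ycone_single) (auto simp: degree_monom_eq)
    then show ?thesis by (simp add: power2_eq_square mult_monom mult_2)
  qed
  have hc: "[:\<eta> / 2:] \<in> C" using assms(2) by (intro po_const) simp
  have "(\<Sum>k\<le>d. smult (?e (2 * k) + [:\<eta>:]) (?y (2 * k))) + (\<Sum>k<d. T k)
      + (smult [:\<eta> / 2:] (?y (2 * 0)) + smult [:\<eta> / 2:] (?y (2 * d))) \<in> ycone C d"
    by (intro ycone_add ycone_sum sq pos hc T) auto
  also have "(\<Sum>k\<le>d. smult (?e (2 * k) + [:\<eta>:]) (?y (2 * k))) = (\<Sum>k\<le>d. monom (?e (2 * k)) (2 * k)) + smult [:\<eta>:] (evens d)"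
    by (simp add: evens_def smult_sum_right sum.distrib smult_monom flip: add_monom)
  also have "(\<Sum>k<d. T k) = (\<Sum>k<d. monom (?e (2 * k + 1)) (2 * k + 1)) + (\<Sum>k<d. smult [:\<eta> / 2:] (?y (2 * k) + ?y (2 * k + 2)))"
    unfolding Teq by (simp only: sum.distrib)
  finally have "(\<Sum>k\<le>d. monom (?e (2 * k)) (2 * k)) + (\<Sum>k<d. monom (?e (2 * k + 1)) (2 * k + 1)) + (smult [:\<eta>:] (evens d) + smult [:\<eta>:] (evens d)) \<in> ycone C d"
    by (subst (2) evens_split) (simp add: smult_add_right ac_simps)
  also have "(\<Sum>k\<le>d. monom (?e (2 * k)) (2 * k)) + (\<Sum>k<d. monom (?e (2 * k + 1)) (2 * k + 1)) = E"
    using sum_even_odd[of "\<lambda>i. monom (?e i) i" d] poly_as_sum_of_monoms'[OF assms(1)] by simp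
  also have "smult [:\<eta>:] (evens d) + smult [:\<eta>:] (evens d) = smult [:2 * \<eta>:] (evens d)"
    by (simp flip: smult_add_left)
  finally show ?thesis .
qed

section \<open>Bernstein approximation in x of strictly positive polynomials\<close>

lemma poly_lipschitz:
  fixes p :: "real poly"
  obtains M where "M > 0" "\<And>x y. x \<in> {A..B} \<Longrightarrow> y \<in> {A..B} \<Longrightarrow> \<bar>poly p x - poly p y\<bar> \<le> M * \<bar>x - y\<bar>"
proof -
  obtain M where M: "M > 0" "\<And>x. x \<in> {A..B} \<Longrightarrow> \<bar>poly (pderiv p) x\<bar> \<le> M"
    using poly_bounded[of "{A..B}" "pderiv p"] by auto
  have *: "\<bar>poly p y - poly p x\<bar> \<le> M * \<bar>y - x\<bar>" if xy: "x \<in> {A..B}" "y \<in> {A..B}" "x < y" for x y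
  proof -
    obtain z where z: "x < z" "z < y" "poly p y - poly p x = (y - x) * poly (pderiv p) z"
      using poly_MVT[OF xy(3)] by blast
    have "\<bar>poly (pderiv p) z\<bar> \<le> M" using M(2)[of z] z xy by auto
    then show ?thesis unfolding z(3) abs_mult by (subst mult.commute, intro mult_right_mono) auto
  qed
  show ?thesis
  proof (rule that[OF M(1)])
    fix x y assume "x \<in> {A..B}" "y \<in> {A..B}"
    then show "\<bar>poly p x - poly p y\<bar> \<le> M * \<bar>x - y\<bar>"
      using *[of x y] *[of y x] by (cases x y rule: linorder_cases) (auto simp: abs_minus_commute)
  qed
qed

text \<open>The binomial variance t (1 - t) / n and the inequality
  \<open>|s| <= \<eta>/2 + s^2 / (2 \<eta>)\<close> bound the mean deviation; any n above
  \<open>1 / \<eta>^2\<close> suffices.\<close>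

lemma Bernstein_deviation:
  assumes "\<eta> > 0"
  obtains n where "n > 0" "\<And>t. t \<in> {0..1} \<Longrightarrow> (\<Sum>j\<le>n. Bernstein n j t * \<bar>t - real j / real n\<bar>) \<le> \<eta>"
proof -
  obtain n :: nat where n: "real n > 1 / \<eta>\<^sup>2" using reals_Archimedean2 by blast
  have n0: "n > 0" using n assms by (cases n) (auto simp: field_simps)
  show ?thesis
  proof (rule that[OF n0])
    fix t :: real assume t: "t \<in> {0..1}"
    have var: "(\<Sum>j\<le>n. Bernstein n j t * (t - real j / real n)\<^sup>2) = t * (1 - t) / real n"
    proof -
      have "(real n)\<^sup>2 * (\<Sum>j\<le>n. Bernstein n j t * (t - real j / real n)\<^sup>2)
          = (\<Sum>j\<le>n. (real n * t)\<^sup>2 * Bernstein n j t + (1 - 2 * (real n * t)) * (real j * Bernstein n j t) + real j * (real j - 1) * Bernstein n j t)"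
        unfolding sum_distrib_left using n0 by (intro sum.cong) (auto simp: field_simps power2_eq_square)
      also have "\<dots> = (real n * t)\<^sup>2 * 1 + (1 - 2 * (real n * t)) * (real n * t) + real n * (real n - 1) * t\<^sup>2"
        by (simp only: sum.distrib sum_distrib_left[symmetric] sum_Bernstein sum_k_Bernstein sum_kk_Bernstein)
      also have "\<dots> = (real n)\<^sup>2 * (t * (1 - t) / real n)" using n0 by (simp add: field_simps power2_eq_square)
      finally show ?thesis unfolding mult_cancel_left using n0 by simp
    qed
    have abs: "\<bar>s\<bar> \<le> \<eta> / 2 + s\<^sup>2 / (2 * \<eta>)" for s :: real
    proof -
      have "0 \<le> (\<bar>s\<bar> - \<eta>)\<^sup>2" by simp
      then have "2 * \<eta> * \<bar>s\<bar> \<le> \<eta>\<^sup>2 + s\<^sup>2" by (simp add: power2_eq_square algebra_simps)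
      then show ?thesis using assms by (simp add: field_simps power2_eq_square)
    qed
    have "(\<Sum>j\<le>n. Bernstein n j t * \<bar>t - real j / real n\<bar>)
        \<le> (\<Sum>j\<le>n. Bernstein n j t * (\<eta> / 2 + (t - real j / real n)\<^sup>2 / (2 * \<eta>)))"
      using t by (intro sum_mono mult_left_mono abs Bernstein_nonneg) auto
    also have "\<dots> = (\<Sum>j\<le>n. Bernstein n j t * (\<eta> / 2)) + (\<Sum>j\<le>n. Bernstein n j t * (t - real j / real n)\<^sup>2 / (2 * \<eta>))"
      by (simp only: distrib_left sum.distrib times_divide_eq_right)
    also have "\<dots> = (\<Sum>j\<le>n. Bernstein n j t) * (\<eta> / 2) + (\<Sum>j\<le>n. Bernstein n j t * (t - real j / real n)\<^sup>2) / (2 * \<eta>)"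
      by (simp only: sum_distrib_right sum_divide_distrib)
    also have "\<dots> = \<eta> / 2 + t * (1 - t) / real n / (2 * \<eta>)" by (simp only: sum_Bernstein var mult_1)
    also have "\<dots> \<le> \<eta>"
    proof -
      have "t * (1 - t) \<le> 1" using t by (intro mult_le_one) auto
      then have "t * (1 - t) / real n \<le> 1 / real n" by (intro divide_right_mono) auto
      also have "1 / real n \<le> \<eta>\<^sup>2" using n assms n0 by (simp add: field_simps)
      finally have "t * (1 - t) / real n / (2 * \<eta>) \<le> \<eta>\<^sup>2 / (2 * \<eta>)" using assms by (intro divide_right_mono) auto
      also have "\<eta>\<^sup>2 / (2 * \<eta>) = \<eta> / 2" using assms by (simp add: power2_eq_square)
      finally show ?thesis by linarith
    qed
    finally show "(\<Sum>j\<le>n. Bernstein n j t * \<bar>t - real j / real n\<bar>) \<le> \<eta>" .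
  qed
qed

text \<open>F is approximated by a combination of finitely many of its own fibres with Bernstein
  weights from C. Each fibre stays nonnegative after a margin \<open>\<epsilon>' W\<close> is
  removed, so it is a sum of two squares in y, and the margin absorbs the error in the
  coefficients.\<close>

theorem (in intervals) strict_in_ycone:
  assumes deg: "degree F \<le> 2 * d" and "\<epsilon> > 0"
    and pos: "\<And>x y. x \<in> U \<Longrightarrow> eval2 F x y \<ge> \<epsilon> * (1 + y\<^sup>2) ^ d"
  shows "F \<in> ycone C d"
proof -
  \<comment> \<open>The extra 1 keeps L positive when U is a single point; A + L - x is then the
    outer generator plus 1, hence still in C.\<close>
  define A L where "A = a 0" and "L = b (k - 1) + 1 - a 0"
  have UA: "x \<in> {A..A + L}" if "x \<in> U" for x using U_bounds[OF that] by (auto simp: A_def L_def)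
  have L: "L > 0" using UA U_nonempty unfolding L_def A_def using U_bounds by fastforce
  define \<epsilon>' where "\<epsilon>' = \<epsilon> / real (d + 1)"
  have \<epsilon>': "\<epsilon>' > 0" using \<open>\<epsilon> > 0\<close> by (simp add: \<epsilon>'_def)
  define W where "W = (\<Sum>k\<le>d. monom (1::real) (2 * k))"
  have lW: "liftc W = evens d"
    by (simp add: W_def evens_def liftc.hom_sum map_poly_monom one_pCons)
  have Wle: "\<epsilon>' * poly W y \<le> \<epsilon> * (1 + y\<^sup>2) ^ d" for y
  proof -
    have "poly W y \<le> (\<Sum>k\<le>d. (1 + y\<^sup>2) ^ d)"
      unfolding W_def poly_sum
    proof (rule sum_mono)
      fix i assume "i \<in> {..d}"
      then have "\<bar>y\<bar> ^ (2 * i) \<le> (1 + y\<^sup>2) ^ d" by (intro abs_power_le) auto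
      then show "poly (monom 1 (2 * i)) y \<le> (1 + y\<^sup>2) ^ d" by (simp add: poly_monom power_even_abs)
    qed
    then have "poly W y \<le> real (d + 1) * (1 + y\<^sup>2) ^ d" by simp
    then have "\<epsilon>' * poly W y \<le> \<epsilon>' * (real (d + 1) * (1 + y\<^sup>2) ^ d)" using \<epsilon>' by (intro mult_left_mono) auto
    then show ?thesis by (simp add: \<epsilon>'_def)
  qed
  have "\<exists>M>0. \<forall>x\<in>{A..A + L}. \<forall>y\<in>{A..A + L}. \<bar>poly (coeff F i) x - poly (coeff F i) y\<bar> \<le> M * \<bar>x - y\<bar>" for i
    using poly_lipschitz[of A "A + L" "coeff F i"] by metis
  then obtain M where M: "\<And>i. M i > 0" "\<And>i x y. x \<in> {A..A + L} \<Longrightarrow> y \<in> {A..A + L} \<Longrightarrow> \<bar>poly (coeff F i) x - poly (coeff F i) y\<bar> \<le> M i * \<bar>x - y\<bar>"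
    by metis
  define M0 where "M0 = (\<Sum>i\<le>2 * d. M i)"
  have MM0: "M i \<le> M0" if "i \<le> 2 * d" for i
    unfolding M0_def using that M(1) by (intro member_le_sum) (auto intro: less_imp_le)
  have M0: "M0 > 0" using MM0[of 0] M(1)[of 0] by simp
  \<comment> \<open>The coefficient error comes out as at most
    \<open>2 M0 L \<eta> = \<epsilon>'/8\<close>, below the \<open>\<epsilon>'/2\<close> that the
    margin can absorb.\<close>
  define \<eta> where "\<eta> = \<epsilon>' / (16 * M0 * L)"
  have \<eta>: "\<eta> > 0" using \<epsilon>' M0 L by (simp add: \<eta>_def)
  obtain n where n: "n > 0" "\<And>t. t \<in> {0..1} \<Longrightarrow> (\<Sum>j\<le>n. Bernstein n j t * \<bar>t - real j / real n\<bar>) \<le> \<eta>"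
    using Bernstein_deviation[OF \<eta>] by blast
  define bern where "bern j = [:real (n choose j) / L ^ n:] * ([:- A, 1:] ^ j * [:A + L, -1:] ^ (n - j))" for j
  have bern_C: "bern j \<in> C" for j
  proof -
    have "[:- A, 1:] \<in> C" by (rule po.gen) (simp add: gens_def A_def)
    moreover have "[:A + L, -1:] = [:b (k - 1), -1:] + [:1:]" by (simp add: A_def L_def)
    then have "[:A + L, -1:] \<in> C" using po.add[OF po.gen po_const, of "[:b (k - 1), -1:]" gens 1] by (simp add: gens_def)
    moreover have "p ^ m \<in> C" if "p \<in> C" for p m
      using that by (induction m) (auto intro: po.mult po_const[of 1, folded one_pCons])
    ultimately show ?thesis unfolding bern_def using L by (intro po.mult po_const) auto
  qed
  have bern_val: "poly (bern j) x = Bernstein n j ((x - A) / L)" if "j \<le> n" for x j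
  proof -
    have "1 - (x - A) / L = (A + L - x) / L" using L by (simp add: field_simps)
    moreover have "L ^ n = L ^ j * L ^ (n - j)" using that by (simp flip: power_add)
    ultimately show ?thesis by (simp add: bern_def Bernstein_def poly_power power_divide)
  qed
  have bern_sum: "(\<Sum>j\<le>n. bern j) = 1"
  proof -
    have "poly (\<Sum>j\<le>n. bern j) x = poly 1 x" for x
      using sum_Bernstein[of n "(x - A) / L"] by (simp add: poly_sum bern_val)
    then show ?thesis using poly_eq_poly_eq_iff by blast
  qed
  define node where "node j = A + L * (real j / real n)" for j
  \<comment> \<open>Nodes may fall outside U, where the fibre of F has no known sign, and are moved
    to a nearest point of U. For x in U this at most doubles the distance to x.\<close>
  define u where "u j = closest_point U (node j)" for j
  have clU: "closed U" using compact_U compact_imp_closed by blast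
  have uU: "u j \<in> U" for j unfolding u_def using closest_point_in_set[OF clU U_nonempty] .
  have udist: "\<bar>x - u j\<bar> \<le> 2 * \<bar>x - node j\<bar>" if "x \<in> U" for x j
    using closest_point_le[OF clU that, of "node j"] abs_triangle_ineq[of "x - node j" "node j - u j"]
    by (simp add: u_def dist_real_def abs_minus_commute)
  define H where "H = (\<Sum>j\<le>n. smult (bern j) (liftc (fib F (u j) - smult (\<epsilon>') W)))"
  have "H \<in> ycone C d"
    unfolding H_def
  proof (intro ycone_sum ycone_smult psd_liftc_in_ycone bern_C)
    fix j y
    show "0 \<le> poly (fib F (u j) - smult \<epsilon>' W) y"
      using pos[OF uU[of j], of y] Wle[of y] by (simp add: poly_fib)
    have "degree W \<le> 2 * d" unfolding W_def by (intro degree_sum_le) (auto simp: degree_monom_eq)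
    then have "degree (smult \<epsilon>' W) \<le> 2 * d" using degree_smult_le order_trans by blast
    moreover have "degree (fib F (u j)) \<le> 2 * d" using degree_fib_le deg order_trans by blast
    ultimately show "degree (fib F (u j) - smult \<epsilon>' W) \<le> 2 * d" by (intro degree_diff_le)
  qed
  define E where "E = F - (\<Sum>j\<le>n. smult (bern j) (liftc (fib F (u j))))"
  have FE: "F = H + (E + smult [:\<epsilon>':] (evens d))"
  proof -
    have "liftc (smult \<epsilon>' W) = smult [:\<epsilon>':] (evens d)"
      by (simp add: lW[symmetric] map_poly_smult)
    then have "H = (\<Sum>j\<le>n. smult (bern j) (liftc (fib F (u j)))) - smult (\<Sum>j\<le>n. bern j) (smult [:\<epsilon>':] (evens d))"
      by (simp only: H_def liftc.hom_diff smult_diff_right sum_subtractf smult_sum)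
    then show ?thesis by (simp add: E_def bern_sum)
  qed
  have coeffE: "poly (coeff E i) x = (\<Sum>j\<le>n. poly (bern j) x * (poly (coeff F i) x - poly (coeff F i) (u j)))" for i x
  proof -
    have "(\<Sum>j\<le>n. poly (bern j) x) = 1" using arg_cong[OF bern_sum, of "\<lambda>p. poly p x"] by (simp add: poly_sum)
    then have "(\<Sum>j\<le>n. poly (bern j) x * poly (coeff F i) x) = poly (coeff F i) x"
      by (simp flip: sum_distrib_right)
    then show ?thesis
      by (simp add: E_def coeff_sum coeff_map_poly poly_sum right_diff_distrib sum_subtractf mult.commute)
  qed
  have small: "\<bar>poly (coeff E i) x\<bar> < \<epsilon>' / 2" if x: "x \<in> U" for i x
  proof (cases "i \<le> 2 * d")
    case False
    then have "coeff F i = 0" using deg by (simp add: coeff_eq_0)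
    then show ?thesis using \<epsilon>' by (simp add: coeffE)
  next
    case True
    define t where "t = (x - A) / L"
    have t: "t \<in> {0..1}" using UA[OF x] L by (auto simp: t_def field_simps)
    have xt: "x = A + L * t" using L by (simp add: t_def)
    have "\<bar>poly (coeff E i) x\<bar> \<le> (\<Sum>j\<le>n. \<bar>poly (bern j) x * (poly (coeff F i) x - poly (coeff F i) (u j))\<bar>)"
      unfolding coeffE by (rule sum_abs)
    also have "\<dots> \<le> (\<Sum>j\<le>n. Bernstein n j t * (M0 * (2 * L * \<bar>t - real j / real n\<bar>)))"
    proof (rule sum_mono)
      fix j assume "j \<in> {..n}"
      have "\<bar>poly (coeff F i) x - poly (coeff F i) (u j)\<bar> \<le> M i * \<bar>x - u j\<bar>"
        by (rule M(2)) (use UA x uU in auto)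
      also have "\<dots> \<le> M0 * (2 * \<bar>x - node j\<bar>)"
        using MM0[OF True] M0 udist[OF x] by (intro mult_mono) auto
      also have "x - node j = L * (t - real j / real n)" by (simp add: xt node_def algebra_simps)
      finally have le: "\<bar>poly (coeff F i) x - poly (coeff F i) (u j)\<bar> \<le> M0 * (2 * L * \<bar>t - real j / real n\<bar>)"
        using L by (simp add: abs_mult mult.assoc)
      have B: "Bernstein n j t \<ge> 0" using t by (intro Bernstein_nonneg) auto
      have "poly (bern j) x = Bernstein n j t" using \<open>j \<in> {..n}\<close> by (simp add: bern_val t_def)
      then show "\<bar>poly (bern j) x * (poly (coeff F i) x - poly (coeff F i) (u j))\<bar> \<le> Bernstein n j t * (M0 * (2 * L * \<bar>t - real j / real n\<bar>))"
        using B le by (simp add: abs_mult mult_left_mono)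
    qed
    also have "\<dots> = M0 * (2 * L) * (\<Sum>j\<le>n. Bernstein n j t * \<bar>t - real j / real n\<bar>)"
      by (simp add: sum_distrib_left mult_ac)
    also have "\<dots> \<le> M0 * (2 * L) * \<eta>" using n(2)[OF t] M0 L by (intro mult_left_mono) auto
    also have "\<dots> = \<epsilon>' / 8" using M0 L by (simp add: \<eta>_def field_simps)
    also have "\<dots> < \<epsilon>' / 2" using \<epsilon>' by simp
    finally show ?thesis .
  qed
  have "degree E \<le> 2 * d"
  proof (rule degree_le, intro allI impI)
    fix i assume "2 * d < i"
    then have "coeff F i = 0" using deg by (simp add: coeff_eq_0)
    then show "coeff E i = 0" by (simp add: E_def coeff_sum coeff_map_poly)
  qed
  then have "E + smult [:2 * (\<epsilon>' / 2):] (evens d) \<in> ycone C d"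
    using small \<epsilon>' by (intro small_coeffs_in_ycone) auto
  then show ?thesis using FE \<open>H \<in> ycone C d\<close> ycone_add by simp
qed

subsection \<open>Gluing local representations\<close>

definition Dpoly :: "nat \<Rightarrow> real poly poly" where
  "Dpoly d = [:1, 0, 1:] ^ d"

lemma eval2_Dpoly [simp]: "eval2 (Dpoly d) x y = (1 + y\<^sup>2) ^ d"
  by (simp add: Dpoly_def ev.hom_power power2_eq_square)

lemma degree_Dpoly: "degree (Dpoly d) \<le> 2 * d"
  using degree_power_le[of "[:1, 0, 1:] :: real poly poly" d] by (simp add: Dpoly_def)

abbreviation lin :: "real \<Rightarrow> real poly" where "lin \<beta> \<equiv> [:- \<beta>, 1:]"

lemma coprime_lin_powers: "\<alpha> \<noteq> \<beta> \<Longrightarrow> coprime (lin \<alpha> ^ m) (lin \<beta> ^ n)"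
proof -
  assume "\<alpha> \<noteq> \<beta>"
  then have "\<not> lin \<alpha> dvd lin \<beta>" by (simp add: poly_eq_0_iff_dvd[symmetric])
  moreover have "prime_elem (lin \<alpha>)" by (rule prime_elem_linear_field_poly) simp
  ultimately have "coprime (lin \<alpha>) (lin \<beta>)" by (metis prime_elem_imp_coprime)
  then show ?thesis by simp
qed

lemma prod_lin_powers_dvd:
  assumes "finite B" "\<And>\<beta>. \<beta> \<in> B \<Longrightarrow> lin \<beta> ^ n dvd p"
  shows "(\<Prod>\<beta>\<in>B. lin \<beta> ^ n) dvd p"
  using assms
proof (induction B rule: finite_induct)
  case (insert \<alpha> B)
  have "coprime (lin \<alpha> ^ n) (\<Prod>\<beta>\<in>B. lin \<beta> ^ n)"
    using insert.hyps by (intro prod_coprime_right coprime_lin_powers) auto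
  then have "lin \<alpha> ^ n * (\<Prod>\<beta>\<in>B. lin \<beta> ^ n) dvd p"
    using insert by (intro divides_mult) auto
  then show ?case using insert.hyps by simp
qed simp

text \<open>The weight is v = r z^m. The factor r = s g^2 from a Bezout identity carries the
  congruences; z is 1 modulo e and smaller than 1 away from \<open>\<beta>\<close>, so a high power
  of it gives the decay without disturbing them.\<close>

lemma weight_exists:
  assumes U: "compact U" and B: "finite B" "\<beta> \<in> B" and N: "even N" and "\<rho> > 0" "\<eta> > 0"
  obtains v where "lin \<beta> ^ (2 * N) dvd v\<^sup>2 - 1"
    "\<And>\<beta>'. \<beta>' \<in> B \<Longrightarrow> \<beta>' \<noteq> \<beta> \<Longrightarrow> lin \<beta>' ^ (2 * N) dvd v\<^sup>2"
    "\<And>x. x \<in> U \<Longrightarrow> poly (v\<^sup>2) x \<le> 1"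
    "\<And>x. x \<in> U \<Longrightarrow> \<bar>x - \<beta>\<bar> \<ge> \<rho> \<Longrightarrow> poly (v\<^sup>2) x \<le> \<eta> * poly (\<Prod>\<beta>\<in>B. lin \<beta> ^ N) x"
proof -
  define g where "g = (\<Prod>\<beta>'\<in>B - {\<beta>}. lin \<beta>' ^ N)"
  define e where "e = lin \<beta> ^ (2 * N)"
  have gx: "poly g x = (\<Prod>\<beta>'\<in>B - {\<beta>}. (x - \<beta>') ^ N)" for x by (simp add: g_def poly_prod poly_power)
  have g0: "poly g x \<ge> 0" for x unfolding gx using N by (intro prod_nonneg) (auto simp: zero_le_even_power)
  have ex: "poly e x = (x - \<beta>) ^ (2 * N)" for x by (simp add: e_def poly_power)
  have e0: "poly e x \<ge> 0" for x by (simp add: ex zero_le_even_power)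
  have c0: "poly (\<Prod>\<beta>\<in>B. lin \<beta> ^ N) x = (x - \<beta>) ^ N * poly g x" for x
    using B by (simp add: gx prod.remove poly_prod poly_power)
  have "coprime g e"
    unfolding g_def e_def by (intro prod_coprime_left coprime_lin_powers) auto
  then have "coprime (g\<^sup>2) e" by simp
  then obtain s t where st: "s * g\<^sup>2 + t * e = 1"
    by (metis bezout_coefficients_fst_snd coprime_imp_gcd_eq_1)
  define r where "r = s * g\<^sup>2"
  have r1: "r\<^sup>2 - 1 = e * (- t * (r + 1))"
  proof -
    have "r - 1 = - t * e" using st by (simp add: r_def algebra_simps)
    then have "(r - 1) * (r + 1) = - t * e * (r + 1)" by simp
    then show ?thesis by (simp add: power2_eq_square algebra_simps)
  qed
  obtain K1 where K1: "K1 > 0" "\<And>x. x \<in> U \<Longrightarrow> \<bar>poly (- t * (r + 1)) x\<bar> \<le> K1" using poly_bounded[OF U] by metis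
  obtain K2 where K2: "K2 > 0" "\<And>x. x \<in> U \<Longrightarrow> \<bar>poly (s\<^sup>2 * g ^ 3) x\<bar> \<le> K2" using poly_bounded[OF U] by metis
  obtain \<Lambda>0 where \<Lambda>0: "\<Lambda>0 > 0" "\<And>x. x \<in> U \<Longrightarrow> \<bar>poly e x\<bar> \<le> \<Lambda>0" using poly_bounded[OF U] by metis
  define \<Lambda> where "\<Lambda> = \<Lambda>0 + \<rho> ^ (2 * N)"
  have \<Lambda>: "\<Lambda> > 0" "\<And>x. x \<in> U \<Longrightarrow> poly e x \<le> \<Lambda>" "\<rho> ^ (2 * N) < \<Lambda>"
    using \<Lambda>0 \<open>\<rho> > 0\<close> by (auto simp: \<Lambda>_def add_pos_pos abs_le_iff intro: add_increasing2)
  define \<theta> where "\<theta> = 1 - \<rho> ^ (2 * N) / \<Lambda>"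
  have \<theta>: "0 \<le> \<theta>" "\<theta> < 1" using \<Lambda> \<open>\<rho> > 0\<close> by (auto simp: \<theta>_def)
  have "(\<lambda>m. \<theta> ^ m) \<longlonglongrightarrow> 0" using \<theta> by (intro LIMSEQ_realpow_zero) auto
  moreover have "\<eta> * \<rho> ^ N / K2 > 0" using \<open>\<eta> > 0\<close> \<open>\<rho> > 0\<close> K2(1) by simp
  ultimately have "\<forall>\<^sub>F m in sequentially. \<theta> ^ m < \<eta> * \<rho> ^ N / K2" by (rule order_tendstoD)
  then obtain m0 where m0: "\<And>m. m \<ge> m0 \<Longrightarrow> \<theta> ^ m < \<eta> * \<rho> ^ N / K2"
    unfolding eventually_sequentially by blast
  obtain m1 :: nat where m1: "real m1 > K1 * \<Lambda>" using reals_Archimedean2 by blast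
  \<comment> \<open>From \<open>m0\<close> on, the decay away from \<open>\<beta>\<close> is as
    small as required. From \<open>m1\<close> on, the exponential bound for z^(2m) outweighs r^2 <=
    exp (K1 e), so v^2 <= 1 holds also close to \<open>\<beta>\<close>, where r^2 alone may exceed
    1.\<close>
  define m where "m = max m0 m1"
  define z where "z = 1 - smult (1 / \<Lambda>) e"
  define v where "v = r * z ^ m"
  have zx: "poly z x = 1 - poly e x / \<Lambda>" for x by (simp add: z_def)
  have z01: "0 \<le> poly z x" "poly z x \<le> 1" if "x \<in> U" for x
    using \<Lambda>(1) \<Lambda>(2)[OF that] e0[of x] by (auto simp: zx)
  have vx: "poly (v\<^sup>2) x = poly (r\<^sup>2) x * poly z x ^ (2 * m)" for x
    by (simp add: v_def poly_power power_mult_distrib power_mult[symmetric] mult.commute)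
  show ?thesis
  proof (rule that)
    have "e dvd z - 1" by (simp add: z_def dvd_smult)
    moreover have "z - 1 dvd z ^ (2 * m) - 1"
      by (subst power_diff_1_eq) simp
    ultimately have "e dvd z ^ (2 * m) - 1" by (rule dvd_trans)
    moreover have "e dvd r\<^sup>2 - 1" unfolding r1 by simp
    moreover have "v\<^sup>2 - 1 = r\<^sup>2 * (z ^ (2 * m) - 1) + (r\<^sup>2 - 1)"
      by (simp add: v_def power_mult_distrib power_mult[symmetric] right_diff_distrib mult.commute)
    ultimately show "lin \<beta> ^ (2 * N) dvd v\<^sup>2 - 1" unfolding e_def[symmetric] by (metis dvd_add dvd_mult)
  next
    fix \<beta>' assume "\<beta>' \<in> B" "\<beta>' \<noteq> \<beta>"
    then have "lin \<beta>' ^ N dvd g" unfolding g_def using B by (intro dvd_prodI) auto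
    then have "(lin \<beta>' ^ N)\<^sup>2 dvd g\<^sup>2" by (rule dvd_power_same)
    moreover have "g\<^sup>2 dvd v\<^sup>2" by (simp add: v_def r_def power2_eq_square)
    ultimately show "lin \<beta>' ^ (2 * N) dvd v\<^sup>2" by (metis dvd_trans power_mult mult.commute)
  next
    fix x assume x: "x \<in> U"
    have "poly (r\<^sup>2) x = 1 + poly e x * poly (- t * (r + 1)) x"
      using arg_cong[OF r1, of "\<lambda>p. poly p x"] by (simp add: algebra_simps)
    also have "\<dots> \<le> 1 + poly e x * K1" using K1(2)[OF x] e0 by (intro add_left_mono mult_left_mono) (auto simp: abs_le_iff)
    also have "\<dots> \<le> exp (poly e x * K1)" using exp_ge_add_one_self by simp
    finally have 1: "poly (r\<^sup>2) x \<le> exp (poly e x * K1)" .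
    have "poly z x ^ (2 * m) \<le> exp (- poly e x / \<Lambda>) ^ (2 * m)"
      using z01(1)[OF x] exp_ge_add_one_self[of "- poly e x / \<Lambda>"] by (intro power_mono) (auto simp: zx)
    also have "\<dots> = exp (- (poly e x * (real (2 * m) / \<Lambda>)))" by (simp flip: exp_of_nat_mult)
    also have "\<dots> \<le> exp (- (poly e x * K1))"
    proof -
      have "K1 \<le> real (2 * m) / \<Lambda>" using m1 \<Lambda>(1) by (simp add: m_def field_simps)
      then have "poly e x * K1 \<le> poly e x * (real (2 * m) / \<Lambda>)" using e0 by (rule mult_left_mono)
      then show ?thesis by (simp only: exp_le_cancel_iff neg_le_iff_le)
    qed
    finally have "poly z x ^ (2 * m) \<le> exp (- (poly e x * K1))" .
    with 1 have "poly (v\<^sup>2) x \<le> exp (poly e x * K1) * exp (- (poly e x * K1))"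
      unfolding vx using z01(1)[OF x] by (intro mult_mono) auto
    then show "poly (v\<^sup>2) x \<le> 1" by (simp flip: exp_add)
    assume far: "\<bar>x - \<beta>\<bar> \<ge> \<rho>"
    have "\<rho> ^ (2 * N) \<le> poly e x" unfolding ex using far \<open>\<rho> > 0\<close>
      by (subst power_even_abs[symmetric, of "2 * N"]) (auto intro!: power_mono)
    then have "poly z x \<le> \<theta>" using \<Lambda>(1) by (simp add: zx \<theta>_def divide_right_mono)
    then have "poly z x ^ (2 * m) \<le> \<theta> ^ (2 * m)" using z01(1)[OF x] by (intro power_mono) auto
    also have "\<dots> \<le> \<eta> * \<rho> ^ N / K2" using m0[of "2 * m"] by (intro less_imp_le) (auto simp: m_def)
    finally have 2: "poly z x ^ (2 * m) \<le> \<eta> * \<rho> ^ N / K2" .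
    \<comment> \<open>Since r^2 = s^2 g^4, one factor g can be kept: it is the part of the product
      that belongs to the other points, and the remaining factor is bounded.\<close>
    have "poly (r\<^sup>2) x = poly (s\<^sup>2 * g ^ 3) x * poly g x"
      by (simp add: r_def poly_power power_mult_distrib power2_eq_square power3_eq_cube mult_ac)
    also have "\<dots> \<le> K2 * poly g x" using K2(2)[OF x] g0 by (intro mult_right_mono) (auto simp: abs_le_iff)
    finally have "poly (v\<^sup>2) x \<le> (K2 * poly g x) * (\<eta> * \<rho> ^ N / K2)"
      unfolding vx using 2 z01(1)[OF x] K2(1) g0[of x] by (intro mult_mono) auto
    also have "\<dots> = \<eta> * (\<rho> ^ N * poly g x)" using K2(1) by simp
    also have "\<dots> \<le> \<eta> * ((x - \<beta>) ^ N * poly g x)"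
    proof -
      have "\<rho> ^ N \<le> (x - \<beta>) ^ N" using far \<open>\<rho> > 0\<close>
        by (subst power_even_abs[symmetric, OF N]) (auto intro!: power_mono)
      then show ?thesis using \<open>\<eta> > 0\<close> g0 by (intro mult_left_mono mult_right_mono) auto
    qed
    finally show "poly (v\<^sup>2) x \<le> \<eta> * poly (\<Prod>\<beta>\<in>B. lin \<beta> ^ N) x" unfolding c0 .
  qed
qed

lemma finite_separation:
  fixes B :: "real set"
  assumes "finite B"
  obtains \<delta> where "\<delta> > 0" "\<And>\<alpha> \<beta>. \<alpha> \<in> B \<Longrightarrow> \<beta> \<in> B \<Longrightarrow> \<alpha> \<noteq> \<beta> \<Longrightarrow> \<delta> \<le> \<bar>\<alpha> - \<beta>\<bar>"
proof
  let ?D = "insert 1 ((\<lambda>(\<alpha>, \<beta>). \<bar>\<alpha> - \<beta>\<bar>) ` {(\<alpha>, \<beta>). \<alpha> \<in> B \<and> \<beta> \<in> B \<and> \<alpha> \<noteq> \<beta>})"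
  have fin: "finite ?D"
    by (rule finite.insertI, rule finite_imageI, rule finite_subset[of _ "B \<times> B"]) (use assms in auto)
  show "Min ?D > 0" using fin by (subst Min_gr_iff) auto
  show "Min ?D \<le> \<bar>\<alpha> - \<beta>\<bar>" if "\<alpha> \<in> B" "\<beta> \<in> B" "\<alpha> \<noteq> \<beta>" for \<alpha> \<beta>
    using fin that by (intro Min_le) (auto intro!: image_eqI[of _ _ "(\<alpha>, \<beta>)"])
qed


text \<open>Removing the weighted local representations leaves R, at least
  \<open>\<kappa>/4 c (1 + y^2)^d\<close> on the strip and congruent to
  \<open>\<kappa> c (1 + y^2)^d\<close> modulo c^2. Thus R = c R', where R' equals
  \<open>\<kappa> (1 + y^2)^d\<close> over the zeros of c and is at least a quarter of it over the
  rest of U, so \<open>strict_in_ycone\<close> applies; c itself is a square.\<close>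

theorem (in intervals) glue:
  fixes B :: "real set" and f :: "real poly poly" and N d :: nat and \<kappa> :: real
  defines "c \<equiv> (\<Prod>\<beta>\<in>B. lin \<beta> ^ N)"
  assumes B: "finite B" and N: "even N" "N > 0" and "\<kappa> > 0" and deg: "degree f \<le> 2 * d"
    and bound: "\<And>x y. x \<in> U \<Longrightarrow> eval2 f x y \<ge> \<kappa> * poly c x * (1 + y\<^sup>2) ^ d"
    and local: "\<And>\<beta>. \<beta> \<in> B \<Longrightarrow> \<exists>F\<in>ycone C d. [:lin \<beta> ^ (2 * N):] dvd f - smult (smult \<kappa> c) (Dpoly d) - F"
  shows "f \<in> ycone C d"
proof -
  let ?D = "\<lambda>y::real. (1 + y\<^sup>2) ^ d"
  have cx: "poly c x = (\<Prod>\<beta>\<in>B. (x - \<beta>) ^ N)" for x by (simp add: c_def poly_prod poly_power)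
  have c0: "poly c x \<ge> 0" for x unfolding cx using N by (intro prod_nonneg) (auto simp: zero_le_even_power)
  have D0: "?D y \<ge> 0" for y by simp
  obtain F where F: "\<And>\<beta>. \<beta> \<in> B \<Longrightarrow> F \<beta> \<in> ycone C d"
    "\<And>\<beta>. \<beta> \<in> B \<Longrightarrow> [:lin \<beta> ^ (2 * N):] dvd f - smult (smult \<kappa> c) (Dpoly d) - F \<beta>"
    using local by metis
  have "\<exists>S. f - smult (smult \<kappa> c) (Dpoly d) - F \<beta> = smult (lin \<beta> ^ (2 * N)) S" if "\<beta> \<in> B" for \<beta>
    using F(2)[OF that] by (auto elim!: dvdE)
  then obtain S where S: "\<And>\<beta>. \<beta> \<in> B \<Longrightarrow> f - smult (smult \<kappa> c) (Dpoly d) - F \<beta> = smult (lin \<beta> ^ (2 * N)) (S \<beta>)"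
    by metis
  have degF: "degree (F \<beta>) \<le> 2 * d" if "\<beta> \<in> B" for \<beta> using degree_ycone F(1)[OF that] by blast
  have degcD: "degree (smult (smult \<kappa> c) (Dpoly d)) \<le> 2 * d"
    using degree_smult_le degree_Dpoly order_trans by blast
  have degS: "degree (S \<beta>) \<le> 2 * d" if "\<beta> \<in> B" for \<beta>
  proof -
    have "degree (smult (lin \<beta> ^ (2 * N)) (S \<beta>)) = degree (S \<beta>)" by simp
    then show ?thesis using S[OF that] degF[OF that] degcD deg by (metis degree_diff_le)
  qed
  have "\<exists>K>0. \<forall>x\<in>U. \<forall>y. \<bar>eval2 (F \<beta>) x y\<bar> \<le> K * ?D y \<and> \<bar>eval2 (S \<beta>) x y\<bar> \<le> K * ?D y" if \<beta>: "\<beta> \<in> B" for \<beta>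
  proof -
    obtain K1 where K1: "K1 > 0" "\<And>x y. x \<in> U \<Longrightarrow> \<bar>eval2 (F \<beta>) x y\<bar> \<le> K1 * ?D y"
      using eval2_bounded[OF compact_U degF[OF \<beta>]] by blast
    obtain K2 where K2: "K2 > 0" "\<And>x y. x \<in> U \<Longrightarrow> \<bar>eval2 (S \<beta>) x y\<bar> \<le> K2 * ?D y"
      using eval2_bounded[OF compact_U degS[OF \<beta>]] by blast
    have "K1 * ?D y \<le> (K1 + K2) * ?D y" "K2 * ?D y \<le> (K1 + K2) * ?D y" for y
      using K1(1) K2(1) by (auto intro!: mult_right_mono)
    then show ?thesis using K1 K2 by (intro exI[of _ "K1 + K2"]) (meson add_pos_pos order_trans)
  qed
  then obtain K\<beta> where K\<beta>: "\<And>\<beta>. \<beta> \<in> B \<Longrightarrow> K\<beta> \<beta> > 0"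
    "\<And>\<beta> x y. \<beta> \<in> B \<Longrightarrow> x \<in> U \<Longrightarrow> \<bar>eval2 (F \<beta>) x y\<bar> \<le> K\<beta> \<beta> * ?D y"
    "\<And>\<beta> x y. \<beta> \<in> B \<Longrightarrow> x \<in> U \<Longrightarrow> \<bar>eval2 (S \<beta>) x y\<bar> \<le> K\<beta> \<beta> * ?D y"
    by metis
  define K where "K = 1 + (\<Sum>\<beta>\<in>B. K\<beta> \<beta>)"
  have KK: "K\<beta> \<beta> \<le> K" if "\<beta> \<in> B" for \<beta>
  proof -
    have "K\<beta> \<beta> \<le> (\<Sum>\<beta>\<in>B. K\<beta> \<beta>)" using B K\<beta>(1) that by (intro member_le_sum) (auto intro: less_imp_le)
    then show ?thesis by (simp add: K_def)
  qed
  have K: "K > 0" using K\<beta>(1) by (simp add: K_def sum_nonneg add_pos_nonneg less_imp_le)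
  have KF: "\<bar>eval2 (F \<beta>) x y\<bar> \<le> K * ?D y" and KS: "\<bar>eval2 (S \<beta>) x y\<bar> \<le> K * ?D y"
    if "\<beta> \<in> B" "x \<in> U" for \<beta> x y
    using K\<beta>(2,3)[OF that, of y] mult_right_mono[OF KK[OF that(1)] D0[of y]] by linarith+
  obtain \<delta> where \<delta>: "\<delta> > 0" "\<And>\<alpha> \<beta>. \<alpha> \<in> B \<Longrightarrow> \<beta> \<in> B \<Longrightarrow> \<alpha> \<noteq> \<beta> \<Longrightarrow> \<delta> \<le> \<bar>\<alpha> - \<beta>\<bar>"
    using finite_separation[OF B] by blast
  define \<gamma> where "\<gamma> = ((min 1 (\<delta> / 2)) ^ N) ^ card B"
  have \<gamma>: "\<gamma> > 0" using \<delta>(1) by (simp add: \<gamma>_def)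
  \<comment> \<open>Within \<open>\<rho>\<close> of one point all others are at distance at least
    min(1, \<open>\<delta>/2\<close>), so \<open>\<gamma>\<close> bounds their share of c from
    below. The last term makes the error \<open>K (x - \<beta>)^(2N)\<close> at most half of
    \<open>\<kappa> c\<close>, since one of its two factors \<open>(x - \<beta>)^N\<close> is
    small.\<close>
  define \<rho> where "\<rho> = min (min 1 (\<delta> / 2)) (\<kappa> * \<gamma> / (2 * K))"
  have \<rho>: "\<rho> > 0" "\<rho> \<le> 1" "\<rho> \<le> \<delta> / 2" "\<rho> \<le> \<kappa> * \<gamma> / (2 * K)"
    using \<delta>(1) \<gamma> K \<open>\<kappa> > 0\<close> by (simp_all add: \<rho>_def)
  have near: "K * (x - \<beta>) ^ (2 * N) \<le> \<kappa> / 2 * poly c x" if \<beta>: "\<beta> \<in> B" and x: "\<bar>x - \<beta>\<bar> < \<rho>" for x \<beta>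
  proof -
    define m where "m = min 1 (\<delta> / 2)"
    have m: "0 < m" "m \<le> 1" using \<delta>(1) by (auto simp: m_def)
    have far: "m \<le> \<bar>x - \<beta>'\<bar>" if "\<beta>' \<in> B - {\<beta>}" for \<beta>'
      using \<delta>(2)[of \<beta> \<beta>'] that \<beta> x \<rho>(3) by (auto simp: m_def)
    have "(m ^ N) ^ card (B - {\<beta>}) \<le> (\<Prod>\<beta>'\<in>B - {\<beta>}. (x - \<beta>') ^ N)"
    proof (subst prod_constant[symmetric], rule prod_mono)
      fix \<beta>' assume "\<beta>' \<in> B - {\<beta>}"
      then have "m ^ N \<le> \<bar>x - \<beta>'\<bar> ^ N" using far m by (intro power_mono) auto
      then show "0 \<le> m ^ N \<and> m ^ N \<le> (x - \<beta>') ^ N" using m N by (simp add: power_even_abs)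
    qed
    moreover have "\<gamma> \<le> (m ^ N) ^ card (B - {\<beta>})"
      unfolding \<gamma>_def m_def[symmetric] using m B by (intro power_decreasing card_mono) (auto simp: power_le_one)
    ultimately have g: "\<gamma> \<le> (\<Prod>\<beta>'\<in>B - {\<beta>}. (x - \<beta>') ^ N)" by linarith
    have e0: "(x - \<beta>) ^ N \<ge> 0" using N by (simp add: zero_le_even_power)
    have "(x - \<beta>) ^ N = \<bar>x - \<beta>\<bar> ^ N" using N by (simp add: power_even_abs)
    also have "\<dots> \<le> \<rho> ^ N" using x by (intro power_mono) auto
    also have "\<dots> \<le> \<rho> ^ 1" using \<rho> N by (intro power_decreasing) auto
    finally have "K * (x - \<beta>) ^ N \<le> K * \<rho>" using K by simp
    also have "\<dots> \<le> \<kappa> / 2 * \<gamma>" using \<rho>(4) K by (simp add: field_simps)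
    also have "\<dots> \<le> \<kappa> / 2 * (\<Prod>\<beta>'\<in>B - {\<beta>}. (x - \<beta>') ^ N)" using g \<open>\<kappa> > 0\<close> by (intro mult_left_mono) auto
    finally have "(K * (x - \<beta>) ^ N) * (x - \<beta>) ^ N \<le> (\<kappa> / 2 * (\<Prod>\<beta>'\<in>B - {\<beta>}. (x - \<beta>') ^ N)) * (x - \<beta>) ^ N"
      using e0 by (rule mult_right_mono)
    also have "\<dots> = \<kappa> / 2 * poly c x" using B \<beta> by (simp add: cx prod.remove mult_ac)
    finally show ?thesis by (simp add: mult_2 power_add mult.assoc)
  qed
  \<comment> \<open>All far weights together may cost at most \<open>\<kappa>/4\<close> times c; the
    summand 1 covers an empty B.\<close>
  define \<eta> where "\<eta> = \<kappa> / (4 * K * (real (card B) + 1))"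
  have \<eta>: "\<eta> > 0" using \<open>\<kappa> > 0\<close> K by (simp add: \<eta>_def)
  have \<eta>': "real (card B) * (\<eta> * K) \<le> \<kappa> / 4"
  proof -
    have "n * (\<kappa> / (4 * K * (n + 1)) * K) = \<kappa> / 4 * (n / (n + 1))" if "n \<ge> 0" for n :: real
      using K that by (simp add: divide_simps)
    from this[of "real (card B)"]
    have "real (card B) * (\<eta> * K) = \<kappa> / 4 * (real (card B) / (real (card B) + 1))"
      by (simp add: \<eta>_def)
    also have "\<dots> \<le> \<kappa> / 4 * 1" using \<open>\<kappa> > 0\<close> by (intro mult_left_mono) auto
    finally show ?thesis by simp
  qed
  define good where "good \<beta> w \<longleftrightarrow> lin \<beta> ^ (2 * N) dvd w\<^sup>2 - 1 \<and>
      (\<forall>\<beta>'\<in>B. \<beta>' \<noteq> \<beta> \<longrightarrow> lin \<beta>' ^ (2 * N) dvd w\<^sup>2) \<and> (\<forall>x\<in>U. poly (w\<^sup>2) x \<le> 1) \<and>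
      (\<forall>x\<in>U. \<bar>x - \<beta>\<bar> \<ge> \<rho> \<longrightarrow> poly (w\<^sup>2) x \<le> \<eta> * poly c x)" for \<beta> w
  have "\<forall>\<beta>\<in>B. \<exists>w. good \<beta> w"
  proof
    fix \<beta> assume "\<beta> \<in> B"
    show "\<exists>w. good \<beta> w"
      using weight_exists[OF compact_U B \<open>\<beta> \<in> B\<close> N(1) \<rho>(1) \<eta>] unfolding c_def good_def by metis
  qed
  then obtain v where "\<forall>\<beta>\<in>B. good \<beta> (v \<beta>)" by (blast dest: bchoice)
  then have v: "\<And>\<beta>. \<beta> \<in> B \<Longrightarrow> lin \<beta> ^ (2 * N) dvd (v \<beta>)\<^sup>2 - 1"
    "\<And>\<beta> \<beta>'. \<beta> \<in> B \<Longrightarrow> \<beta>' \<in> B \<Longrightarrow> \<beta>' \<noteq> \<beta> \<Longrightarrow> lin \<beta>' ^ (2 * N) dvd (v \<beta>)\<^sup>2"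
    "\<And>\<beta> x. \<beta> \<in> B \<Longrightarrow> x \<in> U \<Longrightarrow> poly ((v \<beta>)\<^sup>2) x \<le> 1"
    "\<And>\<beta> x. \<beta> \<in> B \<Longrightarrow> x \<in> U \<Longrightarrow> \<bar>x - \<beta>\<bar> \<ge> \<rho> \<Longrightarrow> poly ((v \<beta>)\<^sup>2) x \<le> \<eta> * poly c x"
    unfolding good_def by blast+
  define G where "G = (\<Sum>\<beta>\<in>B. smult ((v \<beta>)\<^sup>2) (F \<beta>))"
  have G: "G \<in> ycone C d" unfolding G_def by (intro ycone_sum ycone_smult F po.square)
  define R where "R = f - G"
  have degR: "degree R \<le> 2 * d" unfolding R_def using deg degree_ycone[OF G] by (rule degree_diff_le)
  have small: "\<bar>\<Sum>\<beta>\<in>B'. poly ((v \<beta>)\<^sup>2) x * eval2 (F \<beta>) x y\<bar> \<le> \<kappa> / 4 * poly c x * ?D y"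
    if "B' \<subseteq> B" "\<And>\<beta>. \<beta> \<in> B' \<Longrightarrow> \<bar>x - \<beta>\<bar> \<ge> \<rho>" "x \<in> U" for B' x y
  proof -
    have "\<bar>\<Sum>\<beta>\<in>B'. poly ((v \<beta>)\<^sup>2) x * eval2 (F \<beta>) x y\<bar> \<le> (\<Sum>\<beta>\<in>B'. \<bar>poly ((v \<beta>)\<^sup>2) x * eval2 (F \<beta>) x y\<bar>)"
      by (rule sum_abs)
    also have "\<dots> \<le> (\<Sum>\<beta>\<in>B'. (\<eta> * poly c x) * (K * ?D y))"
    proof (rule sum_mono)
      fix \<beta> assume "\<beta> \<in> B'"
      then have \<beta>: "\<beta> \<in> B" using that(1) by blast
      show "\<bar>poly ((v \<beta>)\<^sup>2) x * eval2 (F \<beta>) x y\<bar> \<le> (\<eta> * poly c x) * (K * ?D y)"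
        unfolding abs_mult
      proof (rule mult_mono)
        show "\<bar>poly ((v \<beta>)\<^sup>2) x\<bar> \<le> \<eta> * poly c x"
          using v(4)[OF \<beta> that(3) that(2)[OF \<open>\<beta> \<in> B'\<close>]] by (simp add: poly_power)
        show "\<bar>eval2 (F \<beta>) x y\<bar> \<le> K * ?D y" by (rule KF[OF \<beta> that(3)])
      qed (use \<eta> c0 in auto)
    qed
    also have "\<dots> = real (card B') * (\<eta> * K) * (poly c x * ?D y)" by simp
    also have "\<dots> \<le> real (card B) * (\<eta> * K) * (poly c x * ?D y)"
      using \<eta> K c0[of x] that(1) B by (intro mult_right_mono mult_nonneg_nonneg) (auto intro: card_mono)
    also have "\<dots> \<le> \<kappa> / 4 * (poly c x * ?D y)"
      using \<eta>' c0[of x] by (intro mult_right_mono) auto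
    finally show ?thesis by (simp add: mult.assoc)
  qed
  have Rx: "eval2 R x y = eval2 f x y - (\<Sum>\<beta>\<in>B. poly ((v \<beta>)\<^sup>2) x * eval2 (F \<beta>) x y)" for x y
    by (simp add: R_def G_def ev.hom_diff ev.hom_sum)
  have Rlow: "eval2 R x y \<ge> \<kappa> / 4 * poly c x * ?D y" if x: "x \<in> U" for x y
  proof (cases "\<exists>\<beta>\<in>B. \<bar>x - \<beta>\<bar> < \<rho>")
    case False
    then have "\<bar>\<Sum>\<beta>\<in>B. poly ((v \<beta>)\<^sup>2) x * eval2 (F \<beta>) x y\<bar> \<le> \<kappa> / 4 * poly c x * ?D y"
      by (intro small x) auto
    moreover have "\<kappa> / 4 * poly c x * ?D y + \<kappa> / 4 * poly c x * ?D y \<le> \<kappa> * poly c x * ?D y"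
      using \<open>\<kappa> > 0\<close> c0[of x] by (simp add: field_simps)
    ultimately show ?thesis using bound[OF x, of y] unfolding Rx by linarith
  next
    case True
    then obtain \<beta> where \<beta>: "\<beta> \<in> B" "\<bar>x - \<beta>\<bar> < \<rho>" by blast
    define h where "h = \<kappa> / 2 * poly c x * ?D y"
    have h2: "\<kappa> * poly c x * ?D y = 2 * h" by (simp add: h_def)
    have h0: "h \<ge> 0" unfolding h_def using \<open>\<kappa> > 0\<close> c0[of x] by (intro mult_nonneg_nonneg) auto
    have "\<bar>\<Sum>\<beta>\<in>B - {\<beta>}. poly ((v \<beta>)\<^sup>2) x * eval2 (F \<beta>) x y\<bar> \<le> \<kappa> / 4 * poly c x * ?D y"
    proof (intro small x)
      fix \<beta>' assume "\<beta>' \<in> B - {\<beta>}"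
      then show "\<bar>x - \<beta>'\<bar> \<ge> \<rho>" using \<delta>(2)[of \<beta> \<beta>'] \<beta> \<rho>(3) by auto
    qed auto
    moreover have "(\<Sum>\<beta>\<in>B. poly ((v \<beta>)\<^sup>2) x * eval2 (F \<beta>) x y) = poly ((v \<beta>)\<^sup>2) x * eval2 (F \<beta>) x y + (\<Sum>\<beta>\<in>B - {\<beta>}. poly ((v \<beta>)\<^sup>2) x * eval2 (F \<beta>) x y)"
      using B \<beta>(1) by (rule sum.remove)
    \<comment> \<open>Convex combination: f - w F = w (f - F) + (1 - w) f, where f - F and f are
      both at least h. Here the weight has to be at most 1.\<close>
    moreover have "eval2 f x y - poly ((v \<beta>)\<^sup>2) x * eval2 (F \<beta>) x y \<ge> h"
    proof -
      define w where "w = poly ((v \<beta>)\<^sup>2) x"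
      have w: "0 \<le> w" "w \<le> 1" using v(3)[OF \<beta>(1) x] by (auto simp: w_def poly_power)
      have e: "eval2 f x y - \<kappa> * poly c x * ?D y - eval2 (F \<beta>) x y = (x - \<beta>) ^ (2 * N) * eval2 (S \<beta>) x y"
        using arg_cong[OF S[OF \<beta>(1)], of "\<lambda>p. eval2 p x y"] by (simp add: ev.hom_diff poly_power)
      have "- ((x - \<beta>) ^ (2 * N) * eval2 (S \<beta>) x y) \<le> (x - \<beta>) ^ (2 * N) * (K * ?D y)"
        using KS[OF \<beta>(1) x, of y] mult_left_mono[of "- eval2 (S \<beta>) x y" "K * ?D y" "(x - \<beta>) ^ (2 * N)"]
        by (simp add: zero_le_even_power abs_le_iff)
      also have "\<dots> = (K * (x - \<beta>) ^ (2 * N)) * ?D y" by simp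
      also have "\<dots> \<le> h" unfolding h_def using near[OF \<beta>] by (intro mult_right_mono) auto
      finally have "eval2 (F \<beta>) x y \<le> eval2 f x y - h"
        using e h2 by linarith
      then have "w * eval2 (F \<beta>) x y \<le> w * (eval2 f x y - h)" using w by (intro mult_left_mono) auto
      moreover have "h \<le> eval2 f x y"
      proof -
        show ?thesis using bound[OF x, of y] h2 h0 by linarith
      qed
      then have "(1 - w) * h \<le> (1 - w) * eval2 f x y" using w by (intro mult_left_mono) auto
      ultimately show ?thesis unfolding w_def[symmetric] by (simp add: algebra_simps)
    qed
    moreover have "h = \<kappa> / 4 * poly c x * ?D y + \<kappa> / 4 * poly c x * ?D y" by (simp add: h_def)
    ultimately show ?thesis unfolding Rx by linarith
  qed
  \<comment> \<open>Modulo \<open>(x - \<beta>)^(2N)\<close> only the summand of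
    \<open>\<beta>\<close> survives, with weight 1, and f minus this summand is
    \<open>\<kappa> c (1 + y^2)^d\<close> by the choice of F.\<close>
  have div: "lin \<beta> ^ (2 * N) dvd coeff (R - smult (smult \<kappa> c) (Dpoly d)) i" if \<beta>: "\<beta> \<in> B" for \<beta> i
  proof -
    have "R - smult (smult \<kappa> c) (Dpoly d) = smult (lin \<beta> ^ (2 * N)) (S \<beta>) - smult ((v \<beta>)\<^sup>2 - 1) (F \<beta>) - (\<Sum>\<beta>'\<in>B - {\<beta>}. smult ((v \<beta>')\<^sup>2) (F \<beta>'))"
      unfolding S[OF \<beta>, symmetric] R_def G_def sum.remove[OF B \<beta>] by (simp add: smult_diff_left)
    then show ?thesis
      by (simp only: coeff_diff coeff_sum coeff_smult) (intro dvd_diff dvd_sum dvd_mult2 v \<beta> dvd_refl; (use \<beta> in auto))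
  qed
  have "\<exists>T. R - smult (smult \<kappa> c) (Dpoly d) = smult (c * c) T"
  proof -
    have cc: "c * c = (\<Prod>\<beta>\<in>B. lin \<beta> ^ (2 * N))"
      unfolding c_def by (simp only: prod.distrib[symmetric] power_add[symmetric] mult_2)
    have "[:c * c:] dvd R - smult (smult \<kappa> c) (Dpoly d)"
      unfolding cc const_poly_dvd_iff using div by (intro allI prod_lin_powers_dvd B) auto
    then show ?thesis by (auto elim!: dvdE)
  qed
  then obtain T where T: "R - smult (smult \<kappa> c) (Dpoly d) = smult (c * c) T" by blast
  define R' where "R' = smult [:\<kappa>:] (Dpoly d) + smult c T"
  have RR': "R = smult c R'"
  proof -
    have "smult c R' = smult (smult \<kappa> c) (Dpoly d) + smult (c * c) T" by (simp add: R'_def smult_add_right)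
    then show ?thesis unfolding T[symmetric] by simp
  qed
  have "c \<noteq> 0" unfolding c_def using B by (simp add: prod_zero_iff)
  then have degR': "degree R' \<le> 2 * d" using degR RR' by (metis degree_smult_eq)
  have "R' \<in> ycone C d"
  proof (rule strict_in_ycone[OF degR', of "\<kappa> / 4"])
    show "\<kappa> / 4 > 0" using \<open>\<kappa> > 0\<close> by simp
    fix x y assume x: "x \<in> U"
    show "eval2 R' x y \<ge> \<kappa> / 4 * ?D y"
    proof (cases "poly c x = 0")
      case True
      then show ?thesis using \<open>\<kappa> > 0\<close> by (simp add: R'_def ev.hom_add)
    next
      case False
      then have "poly c x > 0" using c0[of x] by simp
      moreover have "poly c x * (\<kappa> / 4 * ?D y) \<le> poly c x * eval2 R' x y"
        using Rlow[OF x, of y] by (simp add: RR' mult_ac)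
      ultimately show ?thesis by simp
    qed
  qed
  moreover have "c \<in> C"
  proof -
    obtain m where m: "N = m * 2" using N(1) by (metis evenE mult.commute)
    have "c = (\<Prod>\<beta>\<in>B. lin \<beta> ^ m)\<^sup>2" unfolding c_def m power_mult by (rule prod_power_distrib[symmetric])
    then show ?thesis using po.square by metis
  qed
  ultimately have "R \<in> ycone C d" unfolding RR' by (rule ycone_smult)
  then have "R + G \<in> ycone C d" using G by (rule ycone_add)
  then show ?thesis by (simp add: R_def)
qed

subsection \<open>A lower bound for square-free polynomials\<close>

text \<open>A primitive g of maximal degree with g^2 dividing f. Primitivity leaves factors in x
  alone to h and ensures that g has no zero fibre, so nonnegativity passes from f to h over every x
  in question.\<close>

lemma square_factor_maximal:
  fixes f :: "real poly poly"
  assumes "f \<noteq> 0"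
  obtains g h where "f = g\<^sup>2 * h" "Polynomial.content g = 1"
    "\<And>p. Polynomial.content p = 1 \<Longrightarrow> degree p > 0 \<Longrightarrow> \<not> p\<^sup>2 dvd h"
proof -
  define S where "S = degree ` {g. Polynomial.content g = 1 \<and> g\<^sup>2 dvd f}"
  have bound: "degree g \<le> degree f" if "g\<^sup>2 dvd f" for g
  proof -
    have "g \<noteq> 0" using that assms by auto
    then have "degree (g\<^sup>2) = 2 * degree g" by (simp add: degree_power_eq)
    then show ?thesis using dvd_imp_degree_le[OF that assms] by simp
  qed
  then have "S \<subseteq> {..degree f}" by (auto simp: S_def)
  then have fin: "finite S" using finite_subset by blast
  have "degree (1 :: real poly poly) \<in> S" unfolding S_def by (intro imageI) auto
  then have "S \<noteq> {}" by blast
  then have "Max S \<in> S" using fin by (intro Max_in)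
  then obtain g where g: "Polynomial.content g = 1" "g\<^sup>2 dvd f" "degree g = Max S" by (auto simp: S_def)
  obtain h where h: "f = g\<^sup>2 * h" using g(2) by (auto elim: dvdE)
  show ?thesis
  proof (rule that[OF h g(1)])
    fix p :: "real poly poly"
    assume p: "Polynomial.content p = 1" "degree p > 0"
    show "\<not> p\<^sup>2 dvd h"
    proof
      assume "p\<^sup>2 dvd h"
      then have "(g * p)\<^sup>2 dvd f" unfolding h power_mult_distrib by (intro mult_dvd_mono) auto
      moreover have "Polynomial.content (g * p) = 1" using g(1) p(1) by (simp add: content_mult)
      ultimately have "degree (g * p) \<in> S" by (auto simp: S_def)
      then have "degree (g * p) \<le> degree g" using Max_ge[OF fin] g(3) by simp
      moreover have "g \<noteq> 0" "p \<noteq> 0" using h assms p(2) by auto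
      ultimately show False using p(2) by (simp add: degree_mult_eq)
    qed
  qed
qed

text \<open>Over R[x] the gcd is replaced by an element u of least degree in the ideal of h and its
  derivative: by pseudo-division u divides every member of the ideal up to a factor from R[x]. If u
  had positive degree, a prime factor of its primitive part would divide h and its derivative, hence
  divide h twice.\<close>

lemma bezout_pderiv:
  fixes h :: "real poly poly"
  assumes "degree h > 0"
    and sf: "\<And>p. Polynomial.content p = 1 \<Longrightarrow> degree p > 0 \<Longrightarrow> \<not> p\<^sup>2 dvd h"
  obtains A B r where "A * h + B * pderiv h = [:r:]" "r \<noteq> 0"
proof -
  define I where "I = {A * h + B * pderiv h | A B. True}"
  have I_add: "c * u + v \<in> I" if uv: "u \<in> I" "v \<in> I" for c u v
  proof -
    obtain A B A' B' where "u = A * h + B * pderiv h" "v = A' * h + B' * pderiv h"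
      using uv by (auto simp: I_def)
    then have "c * u + v = (c * A + A') * h + (c * B + B') * pderiv h" by (simp add: algebra_simps)
    then show ?thesis unfolding I_def by blast
  qed
  have hI: "h \<in> I" unfolding I_def by (rule CollectI, rule exI[of _ 1], rule exI[of _ 0]) simp
  have h'I: "pderiv h \<in> I" unfolding I_def by (rule CollectI, rule exI[of _ 0], rule exI[of _ 1]) simp
  have I0: "0 \<in> I" unfolding I_def by (rule CollectI, rule exI[of _ 0], rule exI[of _ 0]) simp
  have h0: "h \<noteq> 0" using assms(1) by auto
  define u where "u = arg_min degree (\<lambda>u. u \<in> I \<and> u \<noteq> 0)"
  have u: "u \<in> I" "u \<noteq> 0" and umin: "\<And>w. w \<in> I \<Longrightarrow> w \<noteq> 0 \<Longrightarrow> degree u \<le> degree w"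
    using arg_min_nat_lemma[of "\<lambda>u. u \<in> I \<and> u \<noteq> 0" h degree] hI h0 by (auto simp: u_def)
  have udvd: "\<exists>a. a \<noteq> 0 \<and> u dvd smult a w" if w: "w \<in> I" for w
  proof -
    obtain a q where aq: "a \<noteq> 0" "smult a w = u * q + pseudo_mod w u"
      "pseudo_mod w u = 0 \<or> degree (pseudo_mod w u) < degree u"
      using pseudo_mod[OF u(2), of w] by blast
    have "smult a w = [:a:] * w + 0" by simp
    then have "smult a w \<in> I" using I_add[OF w I0] by metis
    then have "- q * u + smult a w \<in> I" using I_add u(1) by blast
    then have "pseudo_mod w u \<in> I" using aq(2) by (simp add: mult.commute)
    then have "pseudo_mod w u = 0" using umin aq(3) by (metis not_le)
    then have "u dvd smult a w" using aq(2) by simp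
    then show ?thesis using aq(1) by blast
  qed
  have "degree u = 0"
  proof (rule ccontr)
    assume du: "degree u \<noteq> 0"
    define u' where "u' = primitive_part u"
    have cu: "Polynomial.content u' = 1" using u(2) by (simp add: u'_def)
    have u'u: "u' dvd u" unfolding u'_def by (metis content_times_primitive_part dvd_smult dvd_refl)
    have "degree u' > 0" using du by (simp add: u'_def)
    then have "\<not> u' dvd 1" "u' \<noteq> 0" by (auto simp: is_unit_poly_iff)
    then obtain p where p: "p dvd u'" "prime p" using prime_divisor_exists by metis
    have cp: "Polynomial.content p = 1"
    proof -
      have "Polynomial.content p dvd 1" using content_dvd_contentI[OF p(1)] cu by simp
      then show ?thesis by (metis is_unit_normalize normalize_content)
    qed
    have pp: "prime_elem p" using p(2) by auto
    have dp: "degree p > 0"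
    proof (rule ccontr)
      assume "\<not> degree p > 0"
      then obtain c where c: "p = [:c:]" using degree_eq_zeroE by blast
      then have "[:c:] dvd u'" using p(1) by simp
      then have "c dvd 1" using cu const_poly_dvd_iff_dvd_content by metis
      then have "p dvd 1" using c by (simp add: is_unit_const_poly_iff)
      then show False using pp by (simp add: prime_elem_def)
    qed
    have pdvd: "p dvd w" if "w \<in> I" for w
    proof -
      obtain a where a: "a \<noteq> 0" "u dvd smult a w" using udvd[OF \<open>w \<in> I\<close>] by blast
      have "p dvd smult a w" using p(1) u'u a(2) dvd_trans by blast
      then have "p dvd [:a:] * w" by simp
      moreover have "\<not> p dvd [:a:]" using dvd_imp_degree_le[of p "[:a:]"] dp a(1) by auto
      ultimately show ?thesis using prime_elem_dvd_mult_iff[OF pp] by blast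
    qed
    obtain k where k: "h = p * k" using pdvd[OF hI] by (auto elim: dvdE)
    have "p dvd pderiv p * k"
    proof -
      have "pderiv h = p * pderiv k + pderiv p * k" by (simp add: k pderiv_mult mult.commute)
      then show ?thesis using pdvd[OF h'I] by (metis dvd_add_right_iff dvd_triv_left)
    qed
    moreover have "\<not> p dvd pderiv p"
    proof
      assume d: "p dvd pderiv p"
      have "degree (pderiv p) = degree p - 1" by (rule degree_pderiv)
      moreover have "pderiv p \<noteq> 0" using dp by (simp add: pderiv_eq_0_iff)
      ultimately show False using dvd_imp_degree_le[OF d] dp by simp
    qed
    ultimately have "p dvd k" using pp by (simp add: prime_elem_dvd_mult_iff)
    then have "p\<^sup>2 dvd h" unfolding k power2_eq_square by simp
    then show False using sf[OF cp dp] by blast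
  qed
  then obtain r where "u = [:r:]" using degree_eq_zeroE by blast
  moreover obtain A B where "u = A * h + B * pderiv h" using u(1) unfolding I_def by blast
  ultimately show ?thesis using that[of A B r] u(2) by auto
qed

lemma fib_nonzero_of_primitive:
  assumes "Polynomial.content g = (1 :: real poly)" shows "fib g x \<noteq> 0"
proof
  assume "fib g x = 0"
  then have "poly (coeff g i) x = 0" for i by (metis coeff_0 coeff_fib)
  then have "[:[:- x, 1:]:] dvd g" by (simp add: const_poly_dvd_iff poly_eq_0_iff_dvd)
  then have "[:- x, 1:] dvd 1" using assms const_poly_dvd_iff_dvd_content by metis
  then show False by (simp add: is_unit_poly_iff)
qed

section \<open>Quantitative lower bounds\<close>

lemma poly_nonneg_of_mult_square:
  fixes p q :: "real poly"
  assumes "q \<noteq> 0" "\<And>y. poly q y ^ 2 * poly p y \<ge> 0" shows "poly p y \<ge> 0"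
proof (rule ccontr)
  assume neg: "\<not> poly p y \<ge> 0"
  have "isCont (poly p) y" by simp
  then obtain \<delta> where \<delta>: "\<delta> > 0" "\<And>z. \<bar>z - y\<bar> < \<delta> \<Longrightarrow> \<bar>poly p z - poly p y\<bar> < - poly p y"
    using neg unfolding continuous_at_eps_delta dist_real_def by (metis neg_0_less_iff_less not_le)
  have "{y<..<y + \<delta>} \<subseteq> {z. poly q z = 0}"
  proof
    fix z assume "z \<in> {y<..<y + \<delta>}"
    then have "poly p z < 0" using \<delta>(2)[of z] neg by (auto simp: abs_less_iff)
    then show "z \<in> {z. poly q z = 0}" using assms(2)[of z] by (auto simp: zero_le_mult_iff not_le)
  qed
  moreover have "infinite {y<..<y + \<delta>}" using \<delta>(1) by (simp add: infinite_Ioo)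
  ultimately show False using poly_roots_finite[OF assms(1)] finite_subset by blast
qed

text \<open>A Lojasiewicz inequality in one variable: splitting off a root in U costs one power of
  the product of distances, because the distances to the other points are bounded on U.\<close>

lemma poly_lower_bound_on_compact:
  fixes P :: "real poly"
  assumes "compact U" "finite B" "P \<noteq> 0" "\<And>x. x \<in> U \<Longrightarrow> poly P x = 0 \<Longrightarrow> x \<in> B"
  shows "\<exists>m. \<exists>\<kappa>>0. \<forall>x\<in>U. \<bar>poly P x\<bar> \<ge> \<kappa> * (\<Prod>\<beta>\<in>B. \<bar>x - \<beta>\<bar>) ^ m"
  using assms(3,4)
proof (induction "degree P" arbitrary: P rule: less_induct)
  case (less P)
  show ?case
  proof (cases "\<exists>\<beta>\<in>U. poly P \<beta> = 0")
    case False
    show ?thesis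
    proof (cases "U = {}")
      case False
      have "continuous_on U (\<lambda>x. \<bar>poly P x\<bar>)" by (intro continuous_intros)
      then obtain x0 where x0: "x0 \<in> U" "\<forall>x\<in>U. \<bar>poly P x0\<bar> \<le> \<bar>poly P x\<bar>"
        using continuous_attains_inf[OF assms(1) False] by blast
      then show ?thesis using \<open>\<not> (\<exists>\<beta>\<in>U. poly P \<beta> = 0)\<close>
        by (intro exI[of _ 0] exI[of _ "\<bar>poly P x0\<bar>"]) auto
    qed (auto intro: exI[of _ 1])
  next
    case True
    then obtain \<beta> where \<beta>: "\<beta> \<in> U" "poly P \<beta> = 0" by blast
    then have \<beta>B: "\<beta> \<in> B" using less.prems by blast
    obtain P' where P': "P = [:- \<beta>, 1:] * P'" using \<beta>(2) by (auto simp: poly_eq_0_iff_dvd elim: dvdE)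
    then have "P' \<noteq> 0" using less.prems by auto
    then have "degree P = Suc (degree P')" unfolding P' by (subst degree_mult_eq) auto
    then obtain m \<kappa> where mk: "\<kappa> > 0" "\<forall>x\<in>U. \<bar>poly P' x\<bar> \<ge> \<kappa> * (\<Prod>\<beta>\<in>B. \<bar>x - \<beta>\<bar>) ^ m"
      using less.hyps[of P'] \<open>P' \<noteq> 0\<close> less.prems(2) by (auto simp: P')
    obtain K where K: "K > 0" "\<And>x. x \<in> U \<Longrightarrow> \<bar>poly (\<Prod>\<beta>'\<in>B - {\<beta>}. [:- \<beta>', 1:]) x\<bar> \<le> K"
      using poly_bounded[OF assms(1)] by metis
    have "\<bar>poly P x\<bar> \<ge> \<kappa> / K * (\<Prod>\<beta>\<in>B. \<bar>x - \<beta>\<bar>) ^ Suc m" if x: "x \<in> U" for x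
    proof -
      define q where "q = (\<Prod>\<beta>\<in>B. \<bar>x - \<beta>\<bar>)"
      have q: "q = \<bar>x - \<beta>\<bar> * (\<Prod>\<beta>'\<in>B - {\<beta>}. \<bar>x - \<beta>'\<bar>)" unfolding q_def using assms(2) \<beta>B by (rule prod.remove)
      have "(\<Prod>\<beta>'\<in>B - {\<beta>}. \<bar>x - \<beta>'\<bar>) \<le> K" using K(2)[OF x] by (simp add: poly_prod abs_prod)
      then have "q \<le> \<bar>x - \<beta>\<bar> * K" unfolding q by (intro mult_left_mono) auto
      then have "q / K \<le> \<bar>x - \<beta>\<bar>" using K(1) by (simp add: field_simps)
      moreover have q0: "q \<ge> 0" unfolding q_def by (intro prod_nonneg) auto
      moreover have "\<kappa> * q ^ m \<le> \<bar>poly P' x\<bar>" using mk(2) x unfolding q_def by blast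
      ultimately have "(q / K) * (\<kappa> * q ^ m) \<le> \<bar>x - \<beta>\<bar> * \<bar>poly P' x\<bar>"
        using mk(1) by (intro mult_mono) auto
      also have "\<bar>x - \<beta>\<bar> * \<bar>poly P' x\<bar> = \<bar>poly P x\<bar>" by (simp add: P' flip: abs_mult) (simp add: algebra_simps)
      finally show ?thesis unfolding q_def[symmetric] by (simp add: mult_ac)
    qed
    then show ?thesis using mk(1) K(1) by (intro exI[of _ "Suc m"] exI[of _ "\<kappa> / K"]) auto
  qed
qed


text \<open>The constant is explicit in l and r because both will vary with x. Beyond Y the leading
  term dominates. On [-Y, Y] the minimum lies at an end, where the same estimate applies, or at a
  critical point, where the Bezout relation bounds p from below by r.\<close>

lemma lower_bound_at:
  fixes p :: "real poly" and l M W :: real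
  assumes p0: "\<And>y. poly p y \<ge> 0" and deg: "degree p = 2 * d" "d > 0" and l: "coeff p (2 * d) = l" "l > 0"
    and M: "M \<ge> 1" "\<And>i. \<bar>coeff p i\<bar> \<le> M"
    and W: "W = M\<^sup>2 + ((4 * real d + 1) * M)\<^sup>2"
    and r: "\<bar>r\<bar> \<le> M" "\<And>y. poly (pderiv p) y = 0 \<Longrightarrow> \<bar>r\<bar> \<le> M * (1 + y\<^sup>2) ^ e * poly p y"
  shows "poly p y \<ge> 1 / (M ^ (2 * d + 2 * e + 2) * 2 ^ (d + 1) * W ^ (d + e)) * \<bar>r\<bar> * l ^ (2 * d + 2 * e + 1) * (1 + y\<^sup>2) ^ d"
proof -
  have lM: "l \<le> M" using M(2)[of "2 * d"] l by simp
  have M2: "1 \<le> M\<^sup>2" using M(1) by simp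
  have W1: "W \<ge> 1" unfolding W using M2 zero_le_power2[of "(4 * real d + 1) * M"] by linarith
  \<comment> \<open>Beyond this radius the lower terms, at most 2 d M |y|^(2d-1) in total, are at
    most half the leading term.\<close>
  define Y where "Y = 1 + 4 * real d * M / l"
  have Y: "Y \<ge> 1" using l(2) M(1) by (simp add: Y_def)
  \<comment> \<open>The three cases lose l, l^(2d+1) and l^(2d+2e), the last together with r.
    Dividing r and l by M makes both quotients at most 1, so a single large exponent covers all of
    them. W satisfies \<open>(1 + z^2) l^2 <= W\<close> for |z| <= Y, since Y l <= (4d + 1)
    M.\<close>
  define X where "X = (\<bar>r\<bar> / M) * (l / M) ^ (2 * d + 2 * e + 1)"
  define \<kappa> where "\<kappa> = 1 / (2 ^ (d + 1) * W ^ (d + e))"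
  have t: "0 \<le> \<bar>r\<bar> / M" "\<bar>r\<bar> / M \<le> 1" "0 \<le> l / M" "l / M \<le> 1" "l / M \<le> l"
    using r(1) M(1) lM l(2) by (auto simp: divide_le_eq_1 divide_le_eq mult_le_cancel_left1)
  have X0: "X \<ge> 0" unfolding X_def using t by simp
  have goal: "1 / (M ^ (2 * d + 2 * e + 2) * 2 ^ (d + 1) * W ^ (d + e)) * \<bar>r\<bar> * l ^ (2 * d + 2 * e + 1) = \<kappa> * X"
    by (simp add: \<kappa>_def X_def power_divide power_add power2_eq_square)
  have \<kappa>0: "\<kappa> > 0" using W1 by (simp add: \<kappa>_def)
  have Xpow: "X \<le> (\<bar>r\<bar> / M) * l ^ i" if "i \<le> 2 * d + 2 * e + 1" for i
  proof -
    have "(l / M) ^ (2 * d + 2 * e + 1) \<le> (l / M) ^ i" using that t by (intro power_decreasing)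
    also have "\<dots> \<le> l ^ i" using t by (intro power_mono)
    finally show ?thesis unfolding X_def using t by (intro mult_left_mono)
  qed
  have Xpow1: "X \<le> l ^ i" if "i \<le> 2 * d + 2 * e + 1" for i
  proof -
    have "(\<bar>r\<bar> / M) * l ^ i \<le> 1 * l ^ i" using t l(2) by (intro mult_right_mono) auto
    then show ?thesis using Xpow[OF that] by simp
  qed
  have \<kappa>1: "\<kappa> \<le> 1 / 2 ^ (d + 1)" "\<kappa> \<le> 1 / (2 * W ^ d)" "\<kappa> \<le> 1 / W ^ (d + e)"
  proof -
    have w: "1 \<le> W ^ (d + e)" "W ^ d \<le> W ^ (d + e)" "(1::real) \<le> 2 ^ d" using W1 by (auto intro: one_le_power power_increasing)
    have w4: "(2::real) \<le> 2 ^ (d + 1)" "(1::real) \<le> 2 ^ (d + 1)" using w(3) by (simp, intro one_le_power, simp)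
    have "2 ^ (d + 1) * 1 \<le> 2 ^ (d + 1) * W ^ (d + e)" using w by (intro mult_left_mono) auto
    then show "\<kappa> \<le> 1 / 2 ^ (d + 1)" unfolding \<kappa>_def by (intro divide_left_mono) (use W1 in auto)
    have "2 * W ^ d \<le> 2 ^ (d + 1) * W ^ (d + e)" by (intro mult_mono w w4) (use W1 in auto)
    then show "\<kappa> \<le> 1 / (2 * W ^ d)" unfolding \<kappa>_def by (intro divide_left_mono) (use W1 in auto)
    have "1 * W ^ (d + e) \<le> 2 ^ (d + 1) * W ^ (d + e)" by (intro mult_right_mono w4) (use W1 in auto)
    then show "\<kappa> \<le> 1 / W ^ (d + e)" unfolding \<kappa>_def by (intro divide_left_mono) (use W1 in auto)
  qed
  have far: "poly p y \<ge> l / 2 * (y\<^sup>2) ^ d" if y: "\<bar>y\<bar> \<ge> Y" for y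
  proof -
    have y1: "\<bar>y\<bar> \<ge> 1" using y Y by simp
    have "poly p y = (\<Sum>i\<le>2 * d. coeff p i * y ^ i)" by (simp add: poly_altdef deg)
    also have "\<dots> = (\<Sum>i<2 * d. coeff p i * y ^ i) + l * y ^ (2 * d)"
      by (simp add: l lessThan_Suc_atMost[symmetric])
    finally have pe: "poly p y = (\<Sum>i<2 * d. coeff p i * y ^ i) + l * y ^ (2 * d)" .
    have "\<bar>\<Sum>i<2 * d. coeff p i * y ^ i\<bar> \<le> (\<Sum>i<2 * d. \<bar>coeff p i * y ^ i\<bar>)" by (rule sum_abs)
    also have "\<dots> \<le> (\<Sum>i<2 * d. M * \<bar>y\<bar> ^ (2 * d - 1))"
    proof (rule sum_mono)
      fix i assume "i \<in> {..<2 * d}"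
      then have "\<bar>y\<bar> ^ i \<le> \<bar>y\<bar> ^ (2 * d - 1)" using y1 by (intro power_increasing) auto
      then show "\<bar>coeff p i * y ^ i\<bar> \<le> M * \<bar>y\<bar> ^ (2 * d - 1)"
        using M by (auto simp: abs_mult power_abs intro!: mult_mono)
    qed
    also have "\<dots> = 2 * real d * M * \<bar>y\<bar> ^ (2 * d - 1)" by simp
    also have "\<dots> \<le> (l / 2 * \<bar>y\<bar>) * \<bar>y\<bar> ^ (2 * d - 1)"
    proof (rule mult_right_mono)
      have "4 * real d * M / l \<le> \<bar>y\<bar>" using y by (simp add: Y_def)
      then show "2 * real d * M \<le> l / 2 * \<bar>y\<bar>" using l(2) by (simp add: field_simps)
    qed simp
    also have "\<dots> = l / 2 * \<bar>y\<bar> ^ (2 * d)"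
      using deg(2) by (simp add: power_eq_if)
    finally have "- (l / 2 * y ^ (2 * d)) \<le> (\<Sum>i<2 * d. coeff p i * y ^ i)" by (simp add: power_even_abs abs_le_iff)
    moreover have "(y\<^sup>2) ^ d = y ^ (2 * d)" by (simp add: power_mult)
    ultimately show ?thesis unfolding pe by simp
  qed
  have "\<kappa> * X * (1 + y\<^sup>2) ^ d \<le> poly p y"
  proof (cases "\<bar>y\<bar> \<ge> Y")
    case True
    then have "\<bar>y\<bar> \<ge> 1" using Y by simp
    then have "1 \<le> y\<^sup>2" using power_mono[of 1 "\<bar>y\<bar>" 2] by simp
    then have "(1 + y\<^sup>2) ^ d \<le> (2 * y\<^sup>2) ^ d" by (intro power_mono) auto
    moreover have "\<kappa> * X \<le> 1 / 2 ^ (d + 1) * l" using \<kappa>1(1) \<kappa>0 Xpow1[of 1] X0 by (intro mult_mono) auto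
    ultimately have "\<kappa> * X * (1 + y\<^sup>2) ^ d \<le> 1 / 2 ^ (d + 1) * l * (2 * y\<^sup>2) ^ d"
      by - (rule mult_mono; (assumption | use l(2) in simp))
    also have "\<dots> = l / 2 * (y\<^sup>2) ^ d" by (simp add: power_mult_distrib)
    also have "\<dots> \<le> poly p y" by (rule far[OF True])
    finally show ?thesis .
  next
    case False
    have "continuous_on {-Y..Y} (poly p)" by (intro continuous_intros)
    then obtain y1 where y1: "y1 \<in> {-Y..Y}" "\<forall>z\<in>{-Y..Y}. poly p y1 \<le> poly p z"
      using continuous_attains_inf[of "{-Y..Y}" "poly p"] Y by auto
    have YW: "1 + z\<^sup>2 \<le> W / l\<^sup>2" if "\<bar>z\<bar> \<le> Y" for z
    proof -
      have "Y * l \<le> (4 * real d + 1) * M" using l(2) lM by (simp add: Y_def field_simps)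
      moreover have "\<bar>z\<bar> * l \<le> Y * l" using that l(2) by (intro mult_right_mono) auto
      ultimately have "\<bar>z\<bar> * l \<le> (4 * real d + 1) * M" by linarith
      then have "(\<bar>z\<bar> * l)\<^sup>2 \<le> ((4 * real d + 1) * M)\<^sup>2" by (rule power_mono) (use l(2) in simp)
      moreover have "l\<^sup>2 \<le> M\<^sup>2" using l(2) lM by (intro power_mono) auto
      ultimately have "(1 + z\<^sup>2) * l\<^sup>2 \<le> W" unfolding W by (simp add: power_mult_distrib algebra_simps)
      then show ?thesis using l(2) by (simp add: field_simps)
    qed
    have "y \<in> {-Y..Y}" using False by (auto simp: not_le abs_less_iff)
    then have py: "poly p y1 \<le> poly p y" using y1(2) by blast
    have "(1 + y\<^sup>2) ^ d \<le> (W / l\<^sup>2) ^ d" using YW[of y] False by (intro power_mono) auto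
    then have "\<kappa> * X * (1 + y\<^sup>2) ^ d \<le> \<kappa> * X * (W / l\<^sup>2) ^ d" using \<kappa>0 X0 by (intro mult_left_mono) auto
    also have "\<dots> \<le> poly p y1"
    proof (cases "\<bar>y1\<bar> = Y")
      case True
      have "1 \<le> \<bar>y1\<bar>" using True Y by simp
      then have "1 \<le> y1\<^sup>2" using power_mono[of 1 "\<bar>y1\<bar>" 2] by simp
      then have "1 \<le> (y1\<^sup>2) ^ d" by (rule one_le_power)
      then have "l / 2 * 1 \<le> l / 2 * (y1\<^sup>2) ^ d" using l(2) by (intro mult_left_mono) auto
      then have "l / 2 \<le> poly p y1" using far[of y1] True by simp
      moreover have "\<kappa> * X * (W / l\<^sup>2) ^ d \<le> 1 / (2 * W ^ d) * l ^ (2 * d + 1) * (W / l\<^sup>2) ^ d"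
        using \<kappa>1(2) \<kappa>0 Xpow1[of "2 * d + 1"] X0 W1 l(2) by (intro mult_right_mono mult_mono) auto
      moreover have "1 / (2 * W ^ d) * l ^ (2 * d + 1) * (W / l\<^sup>2) ^ d = l / 2"
        using W1 l(2) by (simp add: power_divide power_mult[symmetric])
      ultimately show ?thesis by linarith
    next
      case False
      then have int: "- Y < y1" "y1 < Y" using y1(1) by auto
      have "poly (pderiv p) y1 = 0"
      proof (rule DERIV_local_min[of "poly p" _ y1 "min (y1 + Y) (Y - y1)"])
        show "DERIV (poly p) y1 :> poly (pderiv p) y1" by (rule poly_DERIV)
        show "\<forall>z. \<bar>y1 - z\<bar> < min (y1 + Y) (Y - y1) \<longrightarrow> poly p y1 \<le> poly p z" using y1(2) by (auto simp: abs_less_iff)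
      qed (use int in auto)
      then have "\<bar>r\<bar> \<le> M * (1 + y1\<^sup>2) ^ e * poly p y1" by (rule r(2))
      also have "\<dots> \<le> M * (W / l\<^sup>2) ^ e * poly p y1"
        using YW[of y1] y1(1) M(1) p0 by (intro mult_right_mono mult_left_mono power_mono) auto
      finally have rp: "\<bar>r\<bar> / M \<le> (W / l\<^sup>2) ^ e * poly p y1" using M(1) by (simp add: field_simps)
      have "\<kappa> * X * (W / l\<^sup>2) ^ d \<le> 1 / W ^ (d + e) * ((\<bar>r\<bar> / M) * l ^ (2 * d + 2 * e)) * (W / l\<^sup>2) ^ d"
        using \<kappa>1(3) \<kappa>0 Xpow[of "2 * d + 2 * e"] X0 W1 l(2) by (intro mult_right_mono mult_mono) auto
      also have "\<dots> = 1 / W ^ e * (\<bar>r\<bar> / M) * l ^ (2 * e)"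
        using W1 l(2) by (simp add: power_divide power_mult[symmetric] power_add)
      also have "\<dots> \<le> 1 / W ^ e * ((W / l\<^sup>2) ^ e * poly p y1) * l ^ (2 * e)"
        using rp W1 l(2) by (intro mult_right_mono mult_left_mono) auto
      also have "\<dots> = poly p y1" using W1 l(2) by (simp add: power_divide power_mult[symmetric])
      finally show ?thesis .
    qed
    finally show ?thesis using py by simp
  qed
  then show ?thesis unfolding goal .
qed

lemma lower_bound:
  fixes h :: "real poly poly"
  assumes U: "compact U" and h0: "h \<noteq> 0" and pos: "\<And>x y. x \<in> U \<Longrightarrow> eval2 h x y \<ge> 0"
    and sf: "\<And>p. Polynomial.content p = 1 \<Longrightarrow> degree p > 0 \<Longrightarrow> \<not> p\<^sup>2 dvd h"
  obtains \<kappa> r E where "\<kappa> > 0" "r \<noteq> 0" "E > 0"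
    "\<And>x y. x \<in> U \<Longrightarrow> eval2 h x y \<ge> \<kappa> * \<bar>poly r x\<bar> * \<bar>poly (lead_coeff h) x\<bar> ^ E * (1 + y\<^sup>2) ^ ((degree h + 1) div 2)"
proof (cases "degree h = 0")
  case True
  then obtain l where l: "h = [:l:]" using degree_eq_zeroE by blast
  show ?thesis
  proof (rule that[of 1 1 1])
    fix x y assume "x \<in> U"
    then show "eval2 h x y \<ge> 1 * \<bar>poly 1 x\<bar> * \<bar>poly (lead_coeff h) x\<bar> ^ 1 * (1 + y\<^sup>2) ^ ((degree h + 1) div 2)"
      using pos[of x y] by (simp add: l)
  qed auto
next
  case False
  \<comment> \<open>Rounded up because the degree can be odd when the leading coefficient vanishes
    on all of a finite U. At points where it does not vanish the degree is even; at its zeros the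
    positive exponent makes the claimed bound 0.\<close>
  define d where "d = (degree h + 1) div 2"
  have d0: "d > 0" using False by (simp add: d_def)
  obtain A B r where AB: "A * h + B * pderiv h = [:r:]" "r \<noteq> 0"
    using bezout_pderiv[OF _ sf] False by blast
  define e where "e = degree A"
  obtain KA where KA: "KA > 0" "\<And>x y. x \<in> U \<Longrightarrow> \<bar>eval2 A x y\<bar> \<le> KA * (1 + y\<^sup>2) ^ e"
    using eval2_bounded[OF U, of A e] by (auto simp: e_def)
  obtain Kr where Kr: "Kr > 0" "\<And>x. x \<in> U \<Longrightarrow> \<bar>poly r x\<bar> \<le> Kr" using poly_bounded[OF U] by metis
  have "\<exists>K>0. \<forall>x\<in>U. \<bar>poly (coeff h i) x\<bar> \<le> K" for i using poly_bounded[OF U] by metis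
  then obtain Kh where Kh: "\<And>i. Kh i > 0" "\<And>i x. x \<in> U \<Longrightarrow> \<bar>poly (coeff h i) x\<bar> \<le> Kh i" by metis
  define M where "M = 1 + KA + Kr + (\<Sum>i\<le>degree h. Kh i)"
  have Ms: "(\<Sum>i\<le>degree h. Kh i) \<ge> 0" using Kh(1) by (intro sum_nonneg) (auto intro: less_imp_le)
  have M: "M \<ge> 1" "KA \<le> M" "Kr \<le> M" using KA(1) Kr(1) Ms by (auto simp: M_def)
  have Mh: "\<bar>poly (coeff h i) x\<bar> \<le> M" if "x \<in> U" for i x
  proof (cases "i \<le> degree h")
    case True
    have "Kh i \<le> (\<Sum>i\<le>degree h. Kh i)" using True Kh(1) by (intro member_le_sum) (auto intro: less_imp_le)
    then show ?thesis using Kh(2)[OF that, of i] KA(1) Kr(1) by (simp add: M_def)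
  next
    case F: False
    then have "coeff h i = 0" by (simp add: coeff_eq_0)
    then show ?thesis using M(1) by simp
  qed
  define W where "W = M\<^sup>2 + ((4 * real d + 1) * M)\<^sup>2"
  define \<kappa> where "\<kappa> = 1 / (M ^ (2 * d + 2 * e + 2) * 2 ^ (d + 1) * W ^ (d + e))"
  have "W > 0" unfolding W_def using M(1) by (simp add: add_pos_nonneg)
  then have \<kappa>: "\<kappa> > 0" using M(1) by (simp add: \<kappa>_def)
  show ?thesis
  proof (rule that[OF \<kappa> AB(2), of "2 * d + 2 * e + 1"])
    fix x y assume x: "x \<in> U"
    define l where "l = poly (lead_coeff h) x"
    show "eval2 h x y \<ge> \<kappa> * \<bar>poly r x\<bar> * \<bar>poly (lead_coeff h) x\<bar> ^ (2 * d + 2 * e + 1) * (1 + y\<^sup>2) ^ ((degree h + 1) div 2)"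
    proof (cases "l = 0")
      case True
      then show ?thesis using pos[OF x] by (simp add: l_def)
    next
      case l0: False
      have deg: "degree (fib h x) = degree h"
        using l0 by (intro antisym degree_fib_le le_degree) (simp add: l_def)
      have psd: "poly (fib h x) y \<ge> 0" for y using pos[OF x] by (simp add: poly_fib)
      have "even (degree h)"
      proof -
        obtain u v where uv: "fib h x = u\<^sup>2 + v\<^sup>2" "2 * degree u \<le> degree (fib h x)" "2 * degree v \<le> degree (fib h x)"
          using psd_poly_two_squares psd by blast
        have "degree (fib h x) \<le> max (degree (u\<^sup>2)) (degree (v\<^sup>2))" unfolding uv(1) by (rule degree_add_le_max)
        also have "\<dots> \<le> max (2 * degree u) (2 * degree v)"
          using degree_power_le[of u 2] degree_power_le[of v 2] by (intro max.mono) (simp_all add: mult.commute)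
        finally have "degree h = 2 * degree u \<or> degree h = 2 * degree v" using uv(2,3) deg by linarith
        then show ?thesis by auto
      qed
      then have dh: "degree h = 2 * d" by (auto simp: d_def elim: evenE)
      have c: "coeff (fib h x) (2 * d) = l" by (simp add: l_def dh)
      then have lpos: "l > 0" using psd_coeff_nonneg[OF psd, of "2 * d"] deg dh l0 by simp
      have "poly (fib h x) y \<ge> 1 / (M ^ (2 * d + 2 * e + 2) * 2 ^ (d + 1) * W ^ (d + e)) * \<bar>poly r x\<bar> * l ^ (2 * d + 2 * e + 1) * (1 + y\<^sup>2) ^ d"
      proof (rule lower_bound_at[OF psd _ d0 c lpos M(1) _ W_def])
        show "degree (fib h x) = 2 * d" using deg dh by simp
        show "\<bar>coeff (fib h x) i\<bar> \<le> M" for i using Mh[OF x] by simp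
        show "\<bar>poly r x\<bar> \<le> M" using Kr(2)[OF x] M(3) by simp
        fix y assume z: "poly (pderiv (fib h x)) y = 0"
        have "pderiv (fib h x) = fib (pderiv h) x"
          by (intro poly_eqI) (simp add: coeff_pderiv poly_mult of_nat_poly)
        then have "eval2 (pderiv h) x y = 0" using z by (simp add: poly_fib)
        moreover have "eval2 A x y * eval2 h x y + eval2 B x y * eval2 (pderiv h) x y = poly r x"
          using arg_cong[OF AB(1), of "\<lambda>p. eval2 p x y"] by (simp add: ev.hom_add ev.hom_mult)
        ultimately have "\<bar>poly r x\<bar> = \<bar>eval2 A x y\<bar> * eval2 h x y"
          using pos[OF x, of y] by (simp flip: abs_mult) (metis abs_mult abs_of_nonneg)
        also have "\<dots> \<le> M * (1 + y\<^sup>2) ^ e * eval2 h x y"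
        proof (rule mult_right_mono[OF _ pos[OF x]])
          have "KA * (1 + y\<^sup>2) ^ e \<le> M * (1 + y\<^sup>2) ^ e" using M(2) by (intro mult_right_mono) auto
          then show "\<bar>eval2 A x y\<bar> \<le> M * (1 + y\<^sup>2) ^ e" using KA(2)[OF x, of y] by linarith
        qed
        finally show "\<bar>poly r x\<bar> \<le> M * (1 + y\<^sup>2) ^ e * poly (fib h x) y" by (simp add: poly_fib)
      qed
      then show ?thesis using lpos by (simp add: poly_fib \<kappa>_def l_def d_def)
    qed
  qed simp
qed

subsection \<open>Local representations at points of U\<close>

definition trunc :: "nat \<Rightarrow> real fps \<Rightarrow> real poly" where
  "trunc M f = (\<Sum>i<M. monom (fps_nth f i) i)"

lemma coeff_trunc: "coeff (trunc M f) n = (if n < M then fps_nth f n else 0)"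
  by (auto simp: trunc_def coeff_sum)

lemma trunc_0 [simp]: "trunc M 0 = 0"
  by (simp add: trunc_def)

lemma trunc_dvd: "fps_X ^ M dvd f - fps_of_poly (trunc M f)"
proof -
  let ?g = "f - fps_of_poly (trunc M f)"
  have "fps_cutoff M ?g = 0" by (auto simp: fps_eq_iff coeff_trunc)
  then have "?g = fps_shift M ?g * fps_X ^ M" using fps_shift_cutoff[of M ?g] by simp
  then show ?thesis by (metis dvd_triv_right)
qed

lemma map_trunc_dvd: "[:fps_X ^ M:] dvd A - map_poly fps_of_poly (map_poly (trunc M) A)"
  by (simp add: const_poly_dvd_iff coeff_map_poly trunc_dvd)

lemma lin_0: "lin 0 ^ M = monom 1 M"
  by (simp add: monom_altdef)

lemma fps_X_dvd_iff: "[:fps_X ^ M:] dvd map_poly fps_of_poly \<psi> \<Longrightarrow> [:lin 0 ^ M:] dvd \<psi>"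
proof (unfold const_poly_dvd_iff, intro allI)
  fix n assume a: "\<forall>n. fps_X ^ M dvd coeff (map_poly fps_of_poly \<psi>) n"
  have "fps_X ^ M dvd fps_of_poly (coeff \<psi> n)" using a[rule_format, of n] by (simp add: coeff_map_poly)
  then obtain q where q: "fps_of_poly (coeff \<psi> n) = fps_X ^ M * q" by (auto elim: dvdE)
  have "coeff (coeff \<psi> n) j = 0" if "j < M" for j
  proof -
    have "coeff (coeff \<psi> n) j = fps_nth (fps_of_poly (coeff \<psi> n)) j" by simp
    also have "\<dots> = 0" unfolding q using that by (simp add: fps_X_power_mult_nth)
    finally show ?thesis .
  qed
  then show "lin 0 ^ M dvd coeff \<psi> n" unfolding lin_0 by (simp add: monom_1_dvd_iff')
qed

lemma square_trunc_dvd: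
  "[:fps_X ^ M:] dvd A\<^sup>2 - (map_poly fps_of_poly (map_poly (trunc M) A))\<^sup>2"
proof -
  let ?T = "map_poly fps_of_poly (map_poly (trunc M) A)"
  have "A\<^sup>2 - ?T\<^sup>2 = (A - ?T) * (A + ?T)" by (simp add: power2_eq_square algebra_simps)
  then show ?thesis using map_trunc_dvd by (metis dvd_mult2)
qed

text \<open>The two power series squares are truncated at order M; in A^2 - T^2 = (A - T)(A + T) the
  first factor is divisible by t^M.\<close>

lemma local_interior:
  fixes \<phi> :: "real poly poly"
  assumes "degree \<phi> \<le> 2 * d" "\<epsilon> > 0" "\<kappa> > 0" "even N"
    and "\<And>t y. \<bar>t\<bar> < \<epsilon> \<Longrightarrow> eval2 \<phi> t y \<ge> \<kappa> * t ^ N * (1 + y\<^sup>2) ^ d"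
  obtains A B where "degree A \<le> d" "degree B \<le> d" "[:lin 0 ^ M:] dvd \<phi> - (A\<^sup>2 + B\<^sup>2)"
proof -
  obtain A B where AB: "map_poly fps_of_poly \<phi> = A\<^sup>2 + B\<^sup>2" "degree A \<le> d" "degree B \<le> d"
    using local_sos[OF assms] by blast
  let ?A = "map_poly (trunc M) A" and ?B = "map_poly (trunc M) B"
  have "map_poly fps_of_poly (\<phi> - (?A\<^sup>2 + ?B\<^sup>2))
      = (A\<^sup>2 - (map_poly fps_of_poly ?A)\<^sup>2) + (B\<^sup>2 - (map_poly fps_of_poly ?B)\<^sup>2)"
    by (simp add: mfpp.hom_diff mfpp.hom_add mfpp.hom_power AB(1))
  then have "[:fps_X ^ M:] dvd map_poly fps_of_poly (\<phi> - (?A\<^sup>2 + ?B\<^sup>2))"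
    using square_trunc_dvd dvd_add by metis
  then have "[:lin 0 ^ M:] dvd \<phi> - (?A\<^sup>2 + ?B\<^sup>2)" by (rule fps_X_dvd_iff)
  moreover have "degree ?A \<le> d" "degree ?B \<le> d"
    using map_poly_degree_leq[of "trunc M" A] map_poly_degree_leq[of "trunc M" B] AB(2,3) by linarith+
  ultimately show ?thesis using that by blast
qed

definition evf :: "real fps \<Rightarrow> real fps" where "evf f = Abs_fps (\<lambda>n. fps_nth f (2 * n))"
definition odf :: "real fps \<Rightarrow> real fps" where "odf f = Abs_fps (\<lambda>n. fps_nth f (2 * n + 1))"

lemma evf_odf: "f = ssub 1 2 (evf f) + fps_X * ssub 1 2 (odf f)"
proof (rule fps_ext)
  fix n
  show "fps_nth f n = fps_nth (ssub 1 2 (evf f) + fps_X * ssub 1 2 (odf f)) n"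
    by (cases "even n") (auto simp: ssub_nth evf_def odf_def elim!: evenE oddE)
qed

lemma evf_odf_0 [simp]: "evf 0 = 0" "odf 0 = 0"
  by (simp_all add: evf_def odf_def)

lemma ssub_2_even_part:
  assumes "ssub 1 2 p = ssub 1 2 q + fps_X * ssub 1 2 (r :: real fps)"
  shows "p = q"
proof (rule fps_ext)
  fix n
  have "fps_nth (ssub 1 2 p) (2 * n) = fps_nth (ssub 1 2 q + fps_X * ssub 1 2 r) (2 * n)" using assms by simp
  moreover have "odd (2 * n - 1)" if "n > 0" using that by simp
  ultimately show "fps_nth p n = fps_nth q n" by (cases "n = 0") (auto simp: ssub_nth)
qed

section \<open>Substitutions in x and one-sided local representations\<close>

definition shiftx :: "real poly \<Rightarrow> real poly poly \<Rightarrow> real poly poly" where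
  "shiftx s \<phi> = map_poly (\<lambda>c. pcompose c s) \<phi>"

lemma rhom_pcompose: "rhom (\<lambda>c. pcompose c s)"
  by standard (auto simp: pcompose_add pcompose_mult one_pCons)

interpretation shiftx: rhom "shiftx s" for s
  unfolding shiftx_def by (rule rhom.rhom_map_poly[OF rhom_pcompose])

lemma coeff_shiftx: "coeff (shiftx s \<phi>) i = pcompose (coeff \<phi> i) s"
  by (simp add: shiftx_def coeff_map_poly)

lemma degree_shiftx_le: "degree (shiftx s \<phi>) \<le> degree \<phi>"
  by (simp add: shiftx_def map_poly_degree_leq)

lemma eval2_shiftx: "eval2 (shiftx s \<phi>) t y = eval2 \<phi> (poly s t) y"
proof -
  have "fib (shiftx s \<phi>) t = fib \<phi> (poly s t)"
    by (intro poly_eqI) (simp add: coeff_shiftx poly_pcompose)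
  then show ?thesis by (metis poly_fib)
qed

lemma shiftx_smult: "shiftx s (smult c \<phi>) = smult (pcompose c s) (shiftx s \<phi>)"
  by (intro poly_eqI) (simp add: coeff_shiftx pcompose_mult)

text \<open>With s = t^2 the one-sided bound becomes two-sided, so \<open>\<phi>(t^2, y)\<close> is
  a sum of two squares over R[[t]]. Writing each as A0(t^2) + t A1(t^2) and comparing even parts in
  t gives \<open>\<phi>\<close>, with the multiplier s on the squares of the odd parts.\<close>

lemma local_halfline:
  fixes \<phi> :: "real poly poly"
  assumes deg: "degree \<phi> \<le> 2 * d" and "\<epsilon> > 0" "\<kappa> > 0"
    and pos: "\<And>s y. 0 \<le> s \<Longrightarrow> s < \<epsilon> \<Longrightarrow> eval2 \<phi> s y \<ge> \<kappa> * s ^ N * (1 + y\<^sup>2) ^ d"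
  obtains A0 B0 A1 B1 where "degree A0 \<le> d" "degree B0 \<le> d" "degree A1 \<le> d" "degree B1 \<le> d"
    "[:lin 0 ^ M:] dvd \<phi> - (A0\<^sup>2 + B0\<^sup>2 + smult [:0, 1:] (A1\<^sup>2 + B1\<^sup>2))"
proof -
  define \<psi> where "\<psi> = shiftx [:0, 0, 1:] \<phi>"
  have \<psi>pos: "eval2 \<psi> t y \<ge> \<kappa> * t ^ (2 * N) * (1 + y\<^sup>2) ^ d" if "\<bar>t\<bar> < min 1 \<epsilon>" for t y
  proof -
    have "\<bar>t\<bar> * \<bar>t\<bar> \<le> \<bar>t\<bar> * 1" using that by (intro mult_left_mono) auto
    then have "t * t < \<epsilon>" using that by (simp flip: abs_mult)
    then have "eval2 \<phi> (t * t) y \<ge> \<kappa> * (t * t) ^ N * (1 + y\<^sup>2) ^ d" by (intro pos) auto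
    then show ?thesis by (simp add: \<psi>_def eval2_shiftx power_mult power2_eq_square)
  qed
  have "degree \<psi> \<le> 2 * d" using degree_shiftx_le deg order_trans unfolding \<psi>_def by blast
  then have "\<exists>A B. map_poly fps_of_poly \<psi> = A\<^sup>2 + B\<^sup>2 \<and> degree A \<le> d \<and> degree B \<le> d"
    by (rule local_sos[where \<epsilon> = "min 1 \<epsilon>" and \<kappa> = \<kappa> and M = "2 * N"]) (use \<open>\<epsilon> > 0\<close> \<open>\<kappa> > 0\<close> \<psi>pos in auto)
  then obtain A B where AB: "map_poly fps_of_poly \<psi> = A\<^sup>2 + B\<^sup>2" "degree A \<le> d" "degree B \<le> d" by blast
  interpret S: rhom "map_poly (ssub (1::real) 2)" by (rule rhom.rhom_map_poly[OF rhom_ssub]) simp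
  interpret s: rhom "ssub (1::real) 2" by (rule rhom_ssub) simp
  have split: "X = map_poly (ssub 1 2) (map_poly evf X) + smult fps_X (map_poly (ssub 1 2) (map_poly odf X))" for X
    by (intro poly_eqI) (simp add: coeff_map_poly evf_odf[symmetric])
  define A0 A1 B0 B1 where "A0 = map_poly evf A" and "A1 = map_poly odf A"
    and "B0 = map_poly evf B" and "B1 = map_poly odf B"
  have XX: "ssub 1 2 (fps_X :: real fps) = fps_X * fps_X"
    using ssub_X_power[of 2 1 1] by (simp add: power2_eq_square)
  have sq: "(map_poly (ssub 1 2) V + smult fps_X (map_poly (ssub 1 2) W))\<^sup>2
      = map_poly (ssub 1 2) (V\<^sup>2 + smult fps_X (W\<^sup>2)) + smult fps_X (map_poly (ssub 1 2) (2 * V * W))" for V W :: "real fps poly"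
  proof -
    have two: "map_poly (ssub 1 2) (2 :: real fps poly) = 2" by (metis S.hom_add S.hom_one one_add_one)
    have "map_poly (ssub 1 2) (smult fps_X (W\<^sup>2)) = smult (fps_X * fps_X) (map_poly (ssub 1 2) W * map_poly (ssub 1 2) W)"
      by (simp add: map_poly_smult s.hom_mult XX power2_eq_square S.hom_mult)
    then show ?thesis
      by (simp add: S.hom_add S.hom_mult two power2_eq_square algebra_simps smult_add_right)
  qed
  have fps\<psi>: "map_poly fps_of_poly \<psi> = map_poly (ssub 1 2) (map_poly fps_of_poly \<phi>)"
  proof (rule poly_eqI)
    fix i
    have "[:0, 0, 1:] = monom (1::real) 2" by (simp add: numeral_2_eq_2 monom_Suc monom_0)
    then have "fps_of_poly (pcompose c [:0, 0, 1:]) = ssub 1 2 (fps_of_poly c)" for c :: "real poly"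
      by (simp add: fps_of_poly_pcompose ssub_def fps_of_poly_monom)
    then show "coeff (map_poly fps_of_poly \<psi>) i = coeff (map_poly (ssub 1 2) (map_poly fps_of_poly \<phi>)) i"
      by (simp add: \<psi>_def coeff_map_poly coeff_shiftx)
  qed
  define P where "P = A0\<^sup>2 + B0\<^sup>2 + smult fps_X (A1\<^sup>2 + B1\<^sup>2)"
  have "A\<^sup>2 + B\<^sup>2 = map_poly (ssub 1 2) P + smult fps_X (map_poly (ssub 1 2) (2 * A0 * A1 + 2 * B0 * B1))"
  proof -
    have "A\<^sup>2 = map_poly (ssub 1 2) (A0\<^sup>2 + smult fps_X (A1\<^sup>2)) + smult fps_X (map_poly (ssub 1 2) (2 * A0 * A1))"
      by (subst split[of A]) (simp only: A0_def[symmetric] A1_def[symmetric] sq)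
    moreover have "B\<^sup>2 = map_poly (ssub 1 2) (B0\<^sup>2 + smult fps_X (B1\<^sup>2)) + smult fps_X (map_poly (ssub 1 2) (2 * B0 * B1))"
      by (subst split[of B]) (simp only: B0_def[symmetric] B1_def[symmetric] sq)
    ultimately show ?thesis by (simp only: P_def S.hom_add smult_add_right ac_simps)
  qed
  then have eq: "map_poly (ssub 1 2) (map_poly fps_of_poly \<phi>) = map_poly (ssub 1 2) P + smult fps_X (map_poly (ssub 1 2) (2 * A0 * A1 + 2 * B0 * B1))"
    using AB(1) fps\<psi> by simp
  have \<phi>P: "map_poly fps_of_poly \<phi> = P"
  proof (rule poly_eqI)
    fix i
    show "coeff (map_poly fps_of_poly \<phi>) i = coeff P i"
    proof (rule ssub_2_even_part)
      have "coeff (map_poly (ssub 1 2) (map_poly fps_of_poly \<phi>)) i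
          = coeff (map_poly (ssub 1 2) P + smult fps_X (map_poly (ssub 1 2) (2 * A0 * A1 + 2 * B0 * B1))) i"
        by (simp only: eq)
      then show "ssub 1 2 (coeff (map_poly fps_of_poly \<phi>) i)
          = ssub 1 2 (coeff P i) + fps_X * ssub 1 2 (coeff (2 * A0 * A1 + 2 * B0 * B1) i)"
        by (simp only: coeff_map_poly[of "ssub 1 2", OF ssub_0] coeff_add coeff_smult)
    qed
  qed
  let ?T = "map_poly (trunc M)"
  let ?F = "map_poly (fps_of_poly :: real poly \<Rightarrow> real fps)"
  have "?F (\<phi> - ((?T A0)\<^sup>2 + (?T B0)\<^sup>2 + smult [:0, 1:] ((?T A1)\<^sup>2 + (?T B1)\<^sup>2)))
      = (A0\<^sup>2 - (?F (?T A0))\<^sup>2) + (B0\<^sup>2 - (?F (?T B0))\<^sup>2)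
        + [:fps_X:] * ((A1\<^sup>2 - (?F (?T A1))\<^sup>2) + (B1\<^sup>2 - (?F (?T B1))\<^sup>2))"
    by (simp add: mfpp.hom_diff mfpp.hom_add mfpp.hom_power \<phi>P P_def map_poly_smult fpp.hom_mult
        fps_of_poly_pCons smult_add_right smult_diff_right)
  also have "[:fps_X ^ M:] dvd \<dots>" by (intro dvd_add dvd_mult square_trunc_dvd)
  finally have "[:lin 0 ^ M:] dvd \<phi> - ((?T A0)\<^sup>2 + (?T B0)\<^sup>2 + smult [:0, 1:] ((?T A1)\<^sup>2 + (?T B1)\<^sup>2))"
    by (rule fps_X_dvd_iff)
  moreover have "degree (?T (map_poly g X)) \<le> d" if "degree X \<le> d" for g X
    using map_poly_degree_leq that order_trans by meson
  ultimately show ?thesis using that AB(2,3) unfolding A0_def A1_def B0_def B1_def by blast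
qed

text \<open>The substitution \<open>x = \<beta> + \<sigma> s\<close> is inverted by
  \<open>s = \<sigma> (x - \<beta>)\<close>, and an even M absorbs the sign in s^M.\<close>

lemma shift_back:
  assumes "\<sigma> \<in> {1, -1}" "even M" "[:lin 0 ^ M:] dvd shiftx [:\<beta>, \<sigma>:] \<phi> - H"
  shows "[:lin \<beta> ^ M:] dvd \<phi> - shiftx [:- (\<sigma> * \<beta>), \<sigma>:] H"
proof -
  let ?s = "[:- (\<sigma> * \<beta>), \<sigma>:]"
  have ss: "\<sigma> * \<sigma> = 1" using assms(1) by auto
  have inv: "pcompose [:\<beta>, \<sigma>:] ?s = [:0, 1:]"
    using ss by (simp add: pcompose_pCons mult.assoc[symmetric])
  obtain G where G: "shiftx [:\<beta>, \<sigma>:] \<phi> - H = [:lin 0 ^ M:] * G" using assms(3) by (auto elim: dvdE)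
  have "shiftx ?s (shiftx [:\<beta>, \<sigma>:] \<phi>) = \<phi>"
    by (rule poly_eqI) (simp only: coeff_shiftx pcompose_assoc[symmetric] inv pcompose_idR)
  moreover have "shiftx ?s [:lin 0 ^ M:] = [:lin \<beta> ^ M:]"
  proof -
    have "pcompose (lin 0 ^ M) ?s = ?s ^ M"
      by (simp add: rhom.hom_power[OF rhom_pcompose] pcompose_pCons)
    also have "\<dots> = lin \<beta> ^ M"
    proof (cases "\<sigma> = 1")
      case False
      then have "?s = - lin \<beta>" using assms(1) by auto
      then show ?thesis using assms(2) by (metis power_minus_even)
    qed simp
    finally show ?thesis by (simp add: shiftx_def map_poly_pCons)
  qed
  ultimately have "\<phi> - shiftx ?s H = [:lin \<beta> ^ M:] * shiftx ?s G"
    using arg_cong[OF G, of "shiftx ?s"] by (simp only: shiftx.hom_diff shiftx.hom_mult)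
  then show ?thesis by (rule dvdI)
qed

context intervals
begin

lemma ycone_square: "degree p \<le> d \<Longrightarrow> p\<^sup>2 \<in> ycone C d"
  using ycone_single[of 1 C p d] po_const[of 1 gens] by (simp flip: one_pCons)

text \<open>For isolated points, where l and -l are both congruent to members of C. Every H is a sum
  of terms r p^2 with r in R[x]; writing r = u^2 - v^2 with u = (r + 1)/2 and v = (r - 1)/2, the
  term l r p^2 is matched by (cp u^2 + cm v^2) p^2.\<close>

lemma signed_multiple_congruent:
  assumes cp: "cp \<in> C" "e dvd cp - l" and cm: "cm \<in> C" "e dvd cm + l" and H: "degree H \<le> 2 * d"
  shows "\<exists>F\<in>ycone C d. [:e:] dvd smult l H - F"
proof -
  define Z where "Z = {H. \<exists>F\<in>ycone C d. [:e:] dvd smult l H - F}"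
  have Z_add: "H1 + H2 \<in> Z" if z: "H1 \<in> Z" "H2 \<in> Z" for H1 H2
  proof -
    obtain F1 F2 where F: "F1 \<in> ycone C d" "[:e:] dvd smult l H1 - F1" "F2 \<in> ycone C d" "[:e:] dvd smult l H2 - F2"
      using z by (auto simp: Z_def)
    have "smult l (H1 + H2) - (F1 + F2) = (smult l H1 - F1) + (smult l H2 - F2)" by (simp add: smult_add_right)
    then have "[:e:] dvd smult l (H1 + H2) - (F1 + F2)" using F dvd_add by metis
    then show ?thesis unfolding Z_def using ycone_add F by blast
  qed
  have Z_0: "0 \<in> Z" unfolding Z_def using ycone.zero by (intro CollectI bexI[of _ 0]) auto
  have Z_sum: "sum f I \<in> Z" if "\<And>i. i \<in> I \<Longrightarrow> f i \<in> Z" for f and I :: "nat set"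
    using that by (induction I rule: infinite_finite_induct) (auto intro: Z_add Z_0)
  have Z_sq: "smult r (p\<^sup>2) \<in> Z" if p: "degree p \<le> d" for r p
  proof -
    define u v where "u = smult (1/2) (r + 1)" and "v = smult (1/2) (r + 1) - 1"
    have uv: "u\<^sup>2 - v\<^sup>2 = r"
    proof -
      have "u\<^sup>2 - v\<^sup>2 = (u - v) * (u + v)" by (simp add: power2_eq_square algebra_simps)
      also have "u - v = 1" by (simp add: u_def v_def)
      also have "u + v = (smult (1/2) (r + 1) + smult (1/2) (r + 1)) - 1" by (simp only: u_def v_def add_diff_eq)
      also have "\<dots> = r" by (simp flip: smult_add_left)
      finally show ?thesis by simp
    qed
    define F where "F = smult (cp * u\<^sup>2) (p\<^sup>2) + smult (cm * v\<^sup>2) (p\<^sup>2)"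
    have "F \<in> ycone C d"
      unfolding F_def by (intro ycone_add ycone_single po.mult po.square cp cm p)
    moreover have "smult l (smult r (p\<^sup>2)) - F = [:(cp - l) * (- (u\<^sup>2)) + (cm + l) * (- (v\<^sup>2)):] * p\<^sup>2"
    proof -
      have "smult l (smult r q) - (smult x q + smult y q) = [:l * r - (x + y):] * q" for x y and q :: "real poly poly"
        by (simp add: smult_add_left smult_diff_left)
      moreover have "l * r - (cp * u\<^sup>2 + cm * v\<^sup>2) = (cp - l) * (- (u\<^sup>2)) + (cm + l) * (- (v\<^sup>2))"
        unfolding uv[symmetric] by (simp add: algebra_simps)
      ultimately show ?thesis by (simp only: F_def)
    qed
    moreover have "[:e:] dvd [:(cp - l) * (- (u\<^sup>2)) + (cm + l) * (- (v\<^sup>2)):]"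
      unfolding const_poly_dvd_const_poly_iff by (intro dvd_add dvd_mult2[OF cp(2)] dvd_mult2[OF cm(2)])
    ultimately have "F \<in> ycone C d" "[:e:] dvd smult l (smult r (p\<^sup>2)) - F"
      by (simp_all only: dvd_mult2)
    then show ?thesis unfolding Z_def by blast
  qed
  have "(\<Sum>i\<le>2 * d. monom (coeff H i) i) \<in> Z"
  proof (rule Z_sum)
    fix i assume i: "i \<in> {..2 * d}"
    show "monom (coeff H i) i \<in> Z"
    proof (cases "even i")
      case True
      then obtain m where m: "i = 2 * m" by auto
      have "smult (coeff H i) ((monom 1 m)\<^sup>2) \<in> Z" using i m by (intro Z_sq) (simp add: degree_monom_eq)
      then show ?thesis by (simp add: m power2_eq_square mult_monom smult_monom mult_2)
    next
      case False
      then obtain m where m: "i = 2 * m + 1" by (auto elim: oddE)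
      let ?p = "monom (1 :: real poly) m" and ?q = "monom (1 :: real poly) (m + 1)"
      have md: "m + 1 \<le> d" using i m by auto
      \<comment> \<open>Polarisation: 4 y^(2m+1) is the difference of the squares of y^m + y^(m+1)
        and y^m - y^(m+1).\<close>
      define h where "h = smult (1/4) (coeff H i)"
      have "smult h ((?p + ?q)\<^sup>2) + smult (- h) ((?p - ?q)\<^sup>2) \<in> Z"
        using md by (intro Z_add Z_sq degree_add_le degree_diff_le) (auto simp: degree_monom_eq)
      moreover have "smult h ((?p + ?q)\<^sup>2) + smult (- h) ((?p - ?q)\<^sup>2) = smult h ((?p + ?q)\<^sup>2 - (?p - ?q)\<^sup>2)"
        by (simp add: smult_diff_right)
      moreover have "(?p + ?q)\<^sup>2 - (?p - ?q)\<^sup>2 = ?p * ?q + ?p * ?q + ?p * ?q + ?p * ?q"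
        by (simp add: power2_eq_square algebra_simps)
      moreover have "?p * ?q = monom 1 i" by (simp add: mult_monom m mult_2)
      moreover have "smult h (monom 1 i + monom 1 i + monom 1 i + monom 1 i) = monom (h + h + h + h) i"
        by (simp only: smult_add_right smult_monom add_monom distrib_left mult_1_right)
      moreover have "h + h + h + h = coeff H i" by (simp add: h_def flip: smult_add_left)
      ultimately show ?thesis by metis
    qed
  qed
  then have "H \<in> Z" using poly_as_sum_of_monoms'[OF H] by simp
  then show ?thesis by (simp add: Z_def)
qed

text \<open>Here g stands for the factors of c at the other points; being positive at
  \<open>\<beta>\<close>, it is bounded below nearby, and the bound takes the pure form in
  \<open>(x - \<beta>)^N\<close> that the power series argument needs. Interior points, the two
  kinds of endpoints and isolated points are treated separately.\<close>

lemma local_representation: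
  fixes \<phi> :: "real poly poly" and M N d :: nat
  assumes deg: "degree \<phi> \<le> 2 * d" and \<beta>: "\<beta> \<in> U" and "\<kappa> > 0" and N: "even N" and M: "even M"
    and g: "poly g \<beta> > 0"
    and bound: "\<And>x y. x \<in> U \<Longrightarrow> eval2 \<phi> x y \<ge> \<kappa> * ((x - \<beta>) ^ N * poly g x) * (1 + y\<^sup>2) ^ d"
  shows "\<exists>F\<in>ycone C d. [:lin \<beta> ^ M:] dvd \<phi> - F"
proof -
  obtain i where i: "i < k" "a i \<le> \<beta>" "\<beta> \<le> b i" using \<beta> by (auto simp: U_def)
  have IU: "x \<in> U" if "a i \<le> x" "x \<le> b i" for x using that i(1) by (auto simp: U_def)
  have "isCont (poly g) \<beta>" by simp
  then obtain \<delta> where \<delta>: "\<delta> > 0" "\<And>x. \<bar>x - \<beta>\<bar> < \<delta> \<Longrightarrow> \<bar>poly g x - poly g \<beta>\<bar> < poly g \<beta> / 2"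
    using g unfolding continuous_at_eps_delta dist_real_def by (metis half_gt_zero)
  define \<gamma> where "\<gamma> = \<kappa> * (poly g \<beta> / 2)"
  have \<gamma>: "\<gamma> > 0" using g \<open>\<kappa> > 0\<close> by (simp add: \<gamma>_def)
  have near: "eval2 \<phi> x y \<ge> \<gamma> * (x - \<beta>) ^ N * (1 + y\<^sup>2) ^ d" if x: "x \<in> U" "\<bar>x - \<beta>\<bar> < \<delta>" for x y
  proof -
    have "poly g \<beta> / 2 \<le> poly g x" using \<delta>(2)[OF x(2)] by (simp add: abs_if split: if_splits)
    then have "\<kappa> * ((x - \<beta>) ^ N * (poly g \<beta> / 2)) * (1 + y\<^sup>2) ^ d \<le> \<kappa> * ((x - \<beta>) ^ N * poly g x) * (1 + y\<^sup>2) ^ d"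
      using \<open>\<kappa> > 0\<close> N by (intro mult_right_mono mult_left_mono) (auto simp: zero_le_even_power)
    then show ?thesis using bound[OF x(1), of y] by (simp add: \<gamma>_def mult_ac)
  qed
  have degs: "degree (shiftx s \<phi>) \<le> 2 * d" for s using degree_shiftx_le deg order_trans by blast
  have endpoint: "\<exists>F\<in>ycone C d. [:lin \<beta> ^ M:] dvd \<phi> - F"
    if \<sigma>: "\<sigma> \<in> {1, -1}" and \<epsilon>: "\<epsilon> > 0" "\<And>s. 0 \<le> s \<Longrightarrow> s < \<epsilon> \<Longrightarrow> \<beta> + \<sigma> * s \<in> U"
      and c: "c \<in> C" "lin \<beta> ^ M dvd c - [:- (\<sigma> * \<beta>), \<sigma>:]" for \<sigma> \<epsilon> c
  proof -
    have pos: "eval2 (shiftx [:\<beta>, \<sigma>:] \<phi>) s y \<ge> \<gamma> * s ^ N * (1 + y\<^sup>2) ^ d" if s: "0 \<le> s" "s < min \<epsilon> \<delta>" for s y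
    proof -
      have "(\<sigma> * s) ^ N = s ^ N" using \<sigma> N by auto
      moreover have "\<bar>\<sigma> * s\<bar> < \<delta>" using \<sigma> s by auto
      ultimately show ?thesis using near[OF \<epsilon>(2)[of s], of y] s by (simp add: eval2_shiftx mult.commute)
    qed
    have "min \<epsilon> \<delta> > 0" using \<epsilon>(1) \<delta>(1) by simp
    from local_halfline[OF degs this \<gamma> pos, of M] obtain A0 B0 A1 B1 where AB: "degree A0 \<le> d" "degree B0 \<le> d" "degree A1 \<le> d" "degree B1 \<le> d"
      "[:lin 0 ^ M:] dvd shiftx [:\<beta>, \<sigma>:] \<phi> - (A0\<^sup>2 + B0\<^sup>2 + smult [:0, 1:] (A1\<^sup>2 + B1\<^sup>2))" by metis
    let ?s = "[:- (\<sigma> * \<beta>), \<sigma>:]"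
    let ?P = "(shiftx ?s A1)\<^sup>2 + (shiftx ?s B1)\<^sup>2"
    have d1: "[:lin \<beta> ^ M:] dvd \<phi> - ((shiftx ?s A0)\<^sup>2 + (shiftx ?s B0)\<^sup>2 + smult ?s ?P)"
      using shift_back[OF \<sigma> M AB(5)]
      by (simp add: shiftx.hom_add shiftx.hom_power shiftx_smult pcompose_pCons)
    have d2: "[:lin \<beta> ^ M:] dvd [:?s - c:] * ?P"
    proof -
      have "lin \<beta> ^ M dvd ?s - c" using c(2) by (metis dvd_minus_iff minus_diff_eq)
      then show ?thesis by (intro dvd_mult2) (simp only: const_poly_dvd_const_poly_iff)
    qed
    define F where "F = (shiftx ?s A0)\<^sup>2 + (shiftx ?s B0)\<^sup>2 + (smult c ((shiftx ?s A1)\<^sup>2) + smult c ((shiftx ?s B1)\<^sup>2))"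
    have dle: "degree (shiftx ?s X) \<le> d" if "degree X \<le> d" for X using degree_shiftx_le that order_trans by blast
    have "F \<in> ycone C d"
      unfolding F_def by (intro ycone_add ycone_square ycone_single dle AB c)
    moreover have eq: "\<phi> - F = (\<phi> - ((shiftx ?s A0)\<^sup>2 + (shiftx ?s B0)\<^sup>2 + smult ?s ?P)) + [:?s - c:] * ?P"
      by (simp only: F_def) (simp add: algebra_simps smult_diff_left smult_add_right del: pCons_eq_iff diff_pCons minus_pCons)
    have "[:lin \<beta> ^ M:] dvd \<phi> - F" unfolding eq using d1 d2 by (rule dvd_add)
    ultimately show ?thesis by blast
  qed
  consider "a i < \<beta>" "\<beta> < b i" | "a i = \<beta>" "\<beta> < b i" | "a i < \<beta>" "\<beta> = b i" | "a i = \<beta>" "\<beta> = b i"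
    using i by linarith
  then show ?thesis
  proof cases
    case 1
    define \<epsilon> where "\<epsilon> = min \<delta> (min (\<beta> - a i) (b i - \<beta>))"
    have "\<epsilon> > 0" using 1 \<delta>(1) by (simp add: \<epsilon>_def)
    have pos: "eval2 (shiftx [:\<beta>, 1:] \<phi>) t y \<ge> \<gamma> * t ^ N * (1 + y\<^sup>2) ^ d" if t: "\<bar>t\<bar> < \<epsilon>" for t y
    proof -
      have "\<beta> + t \<in> U" using t by (intro IU) (auto simp: \<epsilon>_def)
      then show ?thesis using near[of "\<beta> + t" y] t by (simp add: eval2_shiftx \<epsilon>_def)
    qed
    obtain A B where AB: "degree A \<le> d" "degree B \<le> d" "[:lin 0 ^ M:] dvd shiftx [:\<beta>, 1:] \<phi> - (A\<^sup>2 + B\<^sup>2)"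
      using local_interior[OF degs \<open>\<epsilon> > 0\<close> \<gamma> N pos] by metis
    have "[:lin \<beta> ^ M:] dvd \<phi> - ((shiftx (lin \<beta>) A)\<^sup>2 + (shiftx (lin \<beta>) B)\<^sup>2)"
      using shift_back[OF _ M AB(3)] by (simp add: shiftx.hom_add shiftx.hom_power)
    moreover have "(shiftx (lin \<beta>) A)\<^sup>2 + (shiftx (lin \<beta>) B)\<^sup>2 \<in> ycone C d"
      using AB degree_shiftx_le order_trans by (intro ycone_add ycone_square) blast+
    ultimately show ?thesis by blast
  next
    case 2
    obtain c where c: "c \<in> C" "lin (a i) ^ M dvd c - lin (a i)" using local_left_multiplier[OF i(1) M] .
    show ?thesis
      by (rule endpoint[of 1 "b i - \<beta>" c]) (use 2 c in \<open>auto intro!: IU\<close>)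
  next
    case 3
    obtain c where c: "c \<in> C" "lin (b i) ^ M dvd c - [:b i, -1:]" using local_right_multiplier[OF i(1) M] .
    show ?thesis
      by (rule endpoint[of "-1" "\<beta> - a i" c]) (use 3 c in \<open>auto intro!: IU\<close>)
  next
    \<comment> \<open>At an isolated point the only usable information is that the fibre over
      \<open>\<beta>\<close> is nonnegative. This fibre, constant in x, is one summand; the
      difference is a multiple of \<open>x - \<beta>\<close> and can be represented whatever its
      sign.\<close>
    case 4
    obtain cp where cp: "cp \<in> C" "lin \<beta> ^ M dvd cp - lin \<beta>"
      using local_left_multiplier[OF i(1) M] 4(1) by metis
    obtain cm where cm: "cm \<in> C" "lin \<beta> ^ M dvd cm - [:\<beta>, -1:]"
      using local_right_multiplier[OF i(1) M] 4(2) by metis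
    have "[:\<beta>, -1:] = - lin \<beta>" by simp
    then have cm': "lin \<beta> ^ M dvd cm + lin \<beta>" using cm(2) by (simp only: diff_minus_eq_add)
    define \<phi>0 where "\<phi>0 = liftc (fib \<phi> \<beta>)"
    have "poly (fib \<phi> \<beta>) y \<ge> 0" for y
    proof -
      have "0 \<le> \<kappa> * ((\<beta> - \<beta>) ^ N * poly g \<beta>) * (1 + y\<^sup>2) ^ d"
        using \<open>\<kappa> > 0\<close> g N by (intro mult_nonneg_nonneg) (auto simp: zero_le_even_power)
      then show ?thesis using bound[OF \<beta>, of y] by (simp add: poly_fib)
    qed
    then have \<phi>0: "\<phi>0 \<in> ycone C d"
      unfolding \<phi>0_def using degree_fib_le deg order_trans by (intro psd_liftc_in_ycone) blast+
    have "[:lin \<beta>:] dvd \<phi> - \<phi>0"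
      by (simp add: const_poly_dvd_iff \<phi>0_def coeff_map_poly poly_eq_0_iff_dvd[symmetric])
    then obtain H where H: "\<phi> - \<phi>0 = smult (lin \<beta>) H" by (auto elim!: dvdE)
    have "degree (\<phi> - \<phi>0) \<le> 2 * d" using deg degree_ycone[OF \<phi>0] by (rule degree_diff_le)
    then have "degree H \<le> 2 * d" unfolding H by simp
    then obtain F where F: "F \<in> ycone C d" "[:lin \<beta> ^ M:] dvd smult (lin \<beta>) H - F"
      using signed_multiple_congruent[OF cp cm(1) cm'] by blast
    have "\<phi> - (\<phi>0 + F) = smult (lin \<beta>) H - F" unfolding H[symmetric] by simp
    then have "[:lin \<beta> ^ M:] dvd \<phi> - (\<phi>0 + F)" using F(2) by (simp only:)
    then show ?thesis using ycone_add[OF \<phi>0 F(1)] by blast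
  qed
qed

end

subsection \<open>Saturation\<close>

lemma ycone_mult_square: "F \<in> ycone C d \<Longrightarrow> p\<^sup>2 * F \<in> ycone C (degree p + d)"
proof (induction F rule: ycone.induct)
  case (step F c q)
  have "degree (p * q) \<le> degree p + d" using degree_mult_le[of p q] step.hyps(3) by linarith
  then have "p\<^sup>2 * F + smult c ((p * q)\<^sup>2) \<in> ycone C (degree p + d)"
    using step by (intro ycone.step)
  then show ?case by (simp add: power_mult_distrib distrib_left)
qed (simp add: ycone.zero)

theorem (in intervals) psd_on_strip:
  assumes pos: "\<And>x y. x \<in> U \<Longrightarrow> eval2 f x y \<ge> 0"
  shows "\<exists>d. f \<in> ycone C d"
proof (cases "f = 0")
  case True
  then show ?thesis using ycone.zero by blast
next
  case False
  obtain g h where gh: "f = g\<^sup>2 * h" "Polynomial.content g = 1"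
    and sf: "\<And>p. Polynomial.content p = 1 \<Longrightarrow> degree p > 0 \<Longrightarrow> \<not> p\<^sup>2 dvd h"
    using square_factor_maximal[OF False] by metis
  have h0: "h \<noteq> 0" using False gh(1) by auto
  have hpos: "eval2 h x y \<ge> 0" if x: "x \<in> U" for x y
  proof -
    have "poly (fib h x) y \<ge> 0"
    proof (rule poly_nonneg_of_mult_square[OF fib_nonzero_of_primitive[OF gh(2), of x]])
      fix y show "0 \<le> poly (fib g x) y ^ 2 * poly (fib h x) y"
        using pos[OF x, of y] by (simp add: gh(1) poly_fib ev.hom_mult ev.hom_power)
    qed
    then show ?thesis by (simp add: poly_fib)
  qed
  obtain \<kappa> r E where r: "\<kappa> > 0" "r \<noteq> 0" "E > 0"
    and hb: "\<And>x y. x \<in> U \<Longrightarrow> eval2 h x y \<ge> \<kappa> * \<bar>poly r x\<bar> * \<bar>poly (lead_coeff h) x\<bar> ^ E * (1 + y\<^sup>2) ^ ((degree h + 1) div 2)"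
    using lower_bound[OF compact_U h0 hpos sf] by metis
  define d where "d = (degree h + 1) div 2"
  define l where "l = lead_coeff h"
  have dh: "degree h \<le> 2 * d" by (simp add: d_def)
  have l0: "l \<noteq> 0" using h0 by (simp add: l_def)
  define B where "B = {x \<in> U. poly (r * l) x = 0}"
  have B: "finite B" "B \<subseteq> U"
    unfolding B_def using poly_roots_finite[of "r * l"] r(2) l0 by (auto intro: finite_subset)
  define q where "q x = (\<Prod>\<beta>\<in>B. \<bar>x - \<beta>\<bar>)" for x
  have q0: "q x \<ge> 0" for x unfolding q_def by (intro prod_nonneg) auto
  obtain m1 \<kappa>1 where m1: "\<kappa>1 > 0" "\<And>x. x \<in> U \<Longrightarrow> \<bar>poly r x\<bar> \<ge> \<kappa>1 * q x ^ m1"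
    using poly_lower_bound_on_compact[OF compact_U B(1) r(2)] unfolding q_def B_def by fastforce
  obtain m2 \<kappa>2 where m2: "\<kappa>2 > 0" "\<And>x. x \<in> U \<Longrightarrow> \<bar>poly l x\<bar> \<ge> \<kappa>2 * q x ^ m2"
    using poly_lower_bound_on_compact[OF compact_U B(1) l0] unfolding q_def B_def by fastforce
  define m where "m = m1 + m2 * E"
  \<comment> \<open>Even and positive as \<open>glue\<close> requires, and N = m + (m + 2), so that
    q^N <= K^(m+2) q^m on U.\<close>
  define N where "N = 2 * (m + 1)"
  obtain K where K: "K > 0" "\<And>x. x \<in> U \<Longrightarrow> \<bar>poly (\<Prod>\<beta>\<in>B. lin \<beta>) x\<bar> \<le> K"
    using poly_bounded[OF compact_U] by metis
  have qK: "q x \<le> K" if "x \<in> U" for x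
    using K(2)[OF that] by (simp add: poly_prod q_def abs_prod)
  define c where "c = (\<Prod>\<beta>\<in>B. lin \<beta> ^ N)"
  have Nev: "even N" "N > 0" by (auto simp: N_def)
  have cq: "poly c x = q x ^ N" for x
  proof -
    have "poly c x = (\<Prod>\<beta>\<in>B. x - \<beta>) ^ N"
      by (simp add: c_def poly_prod poly_power prod_power_distrib)
    moreover have "q x = \<bar>\<Prod>\<beta>\<in>B. x - \<beta>\<bar>" by (simp only: q_def abs_prod)
    ultimately show ?thesis using Nev(1) by (simp only: power_even_abs)
  qed
  define \<kappa>' where "\<kappa>' = \<kappa> * \<kappa>1 * \<kappa>2 ^ E / K ^ (m + 2)"
  have \<kappa>': "\<kappa>' > 0" using r(1) m1(1) m2(1) K(1) by (simp add: \<kappa>'_def)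
  have bound: "eval2 h x y \<ge> \<kappa>' * poly c x * (1 + y\<^sup>2) ^ d" if x: "x \<in> U" for x y
  proof -
    have "N = m + (m + 2)" by (simp add: N_def)
    then have "poly c x = q x ^ m * q x ^ (m + 2)" unfolding cq by (simp add: power_add)
    also have "\<dots> \<le> q x ^ m * K ^ (m + 2)" using qK[OF x] q0 by (intro mult_left_mono power_mono) auto
    finally have "poly c x / K ^ (m + 2) \<le> q x ^ m" using K(1) by (simp add: divide_le_eq)
    then have "\<kappa>' * poly c x \<le> \<kappa> * \<kappa>1 * \<kappa>2 ^ E * q x ^ m"
      using r(1) m1(1) m2(1) mult_left_mono[of "poly c x / K ^ (m + 2)" "q x ^ m" "\<kappa> * \<kappa>1 * \<kappa>2 ^ E"]
      by (simp add: \<kappa>'_def)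
    also have "\<dots> = \<kappa> * (\<kappa>1 * q x ^ m1) * (\<kappa>2 * q x ^ m2) ^ E"
      by (simp add: m_def power_add power_mult power_mult_distrib)
    also have "\<dots> \<le> \<kappa> * \<bar>poly r x\<bar> * \<bar>poly l x\<bar> ^ E"
      using r(1) m1 m2 q0 x by (intro mult_mono power_mono) auto
    finally have "\<kappa>' * poly c x * (1 + y\<^sup>2) ^ d \<le> \<kappa> * \<bar>poly r x\<bar> * \<bar>poly l x\<bar> ^ E * (1 + y\<^sup>2) ^ d"
      by (intro mult_right_mono) auto
    then show ?thesis using hb[OF x, of y] by (simp add: l_def d_def)
  qed
  have c0: "poly c x \<ge> 0" for x unfolding cq using q0 by simp
  \<comment> \<open>Only half of the available bound is passed to \<open>glue\<close>: after
    \<open>\<kappa>'/2 c (1 + y^2)^d\<close> is subtracted, the other half remains as the lower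
    bound for the local representations.\<close>
  have half: "\<kappa>' / 2 * poly c x * (1 + y\<^sup>2) ^ d + \<kappa>' / 2 * poly c x * (1 + y\<^sup>2) ^ d = \<kappa>' * poly c x * (1 + y\<^sup>2) ^ d" for x y :: real
    by simp
  have half0: "\<kappa>' / 2 * poly c x * (1 + y\<^sup>2) ^ d \<ge> 0" for x y :: real
    using \<kappa>' c0 by (intro mult_nonneg_nonneg) auto
  have "h \<in> ycone C d"
  proof (rule glue[OF B(1) Nev _ dh, of "\<kappa>' / 2", folded c_def])
    show "\<kappa>' / 2 > 0" using \<kappa>' by simp
    show "eval2 h x y \<ge> \<kappa>' / 2 * poly c x * (1 + y\<^sup>2) ^ d" if "x \<in> U" for x y
      using bound[OF that, of y] half[of x y] half0[of x y] by linarith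
    fix \<beta> assume \<beta>: "\<beta> \<in> B"
    define \<phi> where "\<phi> = h - smult (smult (\<kappa>' / 2) c) (Dpoly d)"
    define g' where "g' = (\<Prod>\<beta>'\<in>B - {\<beta>}. lin \<beta>' ^ N)"
    have cg: "poly c x = (x - \<beta>) ^ N * poly g' x" for x
      using B(1) \<beta> by (simp add: c_def g'_def prod.remove poly_prod poly_power)
    show "\<exists>F\<in>ycone C d. [:lin \<beta> ^ (2 * N):] dvd h - smult (smult (\<kappa>' / 2) c) (Dpoly d) - F"
      unfolding \<phi>_def[symmetric]
    proof (rule local_representation[of \<phi> d \<beta> "\<kappa>' / 2" N "2 * N" g'])
      show "degree \<phi> \<le> 2 * d"
        unfolding \<phi>_def using dh degree_smult_le degree_Dpoly order_trans by (intro degree_diff_le) blast+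
      show "\<beta> \<in> U" using \<beta> B by blast
      show "poly g' \<beta> > 0"
        unfolding g'_def poly_prod using Nev by (intro prod_pos) (auto simp: poly_power zero_less_power_eq)
      fix x y assume x: "x \<in> U"
      have "eval2 \<phi> x y = eval2 h x y - \<kappa>' / 2 * poly c x * (1 + y\<^sup>2) ^ d"
        by (simp add: \<phi>_def ev.hom_diff)
      then show "eval2 \<phi> x y \<ge> \<kappa>' / 2 * ((x - \<beta>) ^ N * poly g' x) * (1 + y\<^sup>2) ^ d"
        using bound[OF x, of y] half[of x y] unfolding cg[symmetric] by linarith
    qed (use \<kappa>' Nev in auto)
  qed
  then have "g\<^sup>2 * h \<in> ycone C (degree g + d)" by (rule ycone_mult_square)
  then show ?thesis unfolding gh(1) by blast
qed

text \<open>Even part, with the square of the variable as the new variable: P(z) = (evp P)(z^2) + z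
  (odp P)(z^2).\<close>

definition evp :: "real poly poly \<Rightarrow> real poly poly" where
  "evp P = (\<Sum>i\<le>degree P. monom (coeff P (2 * i)) i)"

definition odp :: "real poly poly \<Rightarrow> real poly poly" where
  "odp P = (\<Sum>i\<le>degree P. monom (coeff P (2 * i + 1)) i)"

lemma coeff_evp [simp]: "coeff (evp P) i = coeff P (2 * i)"
  and coeff_odp [simp]: "coeff (odp P) i = coeff P (2 * i + 1)"
  by (auto simp: evp_def odp_def coeff_sum coeff_eq_0)

abbreviation ysq :: "real poly poly" where "ysq \<equiv> [:0, 0, 1:]"

lemma coeff_pcompose_ysq: "coeff (pcompose A ysq) n = (if even n then coeff A (n div 2) else 0)"
proof (induction A arbitrary: n)
  case (pCons a A)
  have "coeff (ysq * pcompose A ysq) n = (if n < 2 then 0 else coeff (pcompose A ysq) (n - 2))"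
    by (auto simp: coeff_pCons split: nat.split)
  then show ?case using pCons.IH[of "n - 2"]
    by (auto simp: pcompose_pCons coeff_pCons split: nat.split elim!: evenE)
qed simp

lemma evp_odp: "P = pcompose (evp P) ysq + [:0, 1:] * pcompose (odp P) ysq"
proof (rule poly_eqI)
  fix n
  show "coeff P n = coeff (pcompose (evp P) ysq + [:0, 1:] * pcompose (odp P) ysq) n"
    by (cases n) (auto simp: coeff_pcompose_ysq simp del: coeff_pcompose_0 elim!: evenE oddE)
qed

lemma evp_unique: "evp (pcompose A ysq + [:0, 1:] * pcompose B ysq) = A"
proof (rule poly_eqI)
  fix n
  show "coeff (evp (pcompose A ysq + [:0, 1:] * pcompose B ysq)) n = coeff A n"
    by (cases n) (auto simp: coeff_pcompose_ysq simp del: coeff_pcompose_0)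
qed

lemma evp_add: "evp (P + Q) = evp P + evp Q"
  by (rule poly_eqI) simp

text \<open>The cross term of the square is odd in z and drops out; the square of the odd part
  carries z^2, which becomes the new variable.\<close>

lemma evp_smult_square: "evp (smult c (p\<^sup>2)) = smult c ((evp p)\<^sup>2 + [:0, 1:] * (odp p)\<^sup>2)"
proof -
  let ?A = "evp p" and ?B = "odp p" and ?y = "[:0, 1:] :: real poly poly"
  have "?y * ?y = pcompose ?y ysq" by (simp add: pcompose_pCons)
  moreover have "p\<^sup>2 = (pcompose ?A ysq)\<^sup>2 + (?y * ?y) * (pcompose ?B ysq)\<^sup>2
      + ?y * (pcompose ?A ysq * pcompose ?B ysq + pcompose ?A ysq * pcompose ?B ysq)"
    by (subst evp_odp[of p]) algebra
  ultimately have "smult c (p\<^sup>2) = pcompose (smult c (?A\<^sup>2 + ?y * ?B\<^sup>2)) ysq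
      + ?y * pcompose (smult c (?A * ?B + ?A * ?B)) ysq"
    by (simp only: pcompose_add pcompose_mult pcompose_smult power2_eq_square smult_add_right mult_smult_right distrib_left)
  then show ?thesis by (simp only: evp_unique)
qed

section \<open>Closure properties of preorderings in two variables\<close>

lemma is_sos_square: "is_sos (p\<^sup>2)"
  unfolding is_sos_def by (rule exI[of _ "[p]"]) simp

lemma is_sos_0: "is_sos 0"
  unfolding is_sos_def by (rule exI[of _ "[]"]) simp

lemma is_sos_add: "is_sos p \<Longrightarrow> is_sos q \<Longrightarrow> is_sos (p + q)"
  unfolding is_sos_def by (metis map_append sum_list_append)

lemma is_sos_square_mult: "is_sos q \<Longrightarrow> is_sos (p\<^sup>2 * q)"
proof -
  assume "is_sos q"
  then obtain L where L: "q = sum_list (map (\<lambda>q. q\<^sup>2) L)" by (auto simp: is_sos_def)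
  have "p\<^sup>2 * sum_list (map (\<lambda>q. q\<^sup>2) L) = sum_list (map (\<lambda>q. q\<^sup>2) (map ((*) p) L))"
    by (induction L) (auto simp: power_mult_distrib distrib_left)
  then show ?thesis using L unfolding is_sos_def by metis
qed

lemma preordering_add:
  assumes "f \<in> preordering s" "g \<in> preordering s" shows "f + g \<in> preordering s"
proof -
  obtain \<sigma> \<tau> where "\<forall>I. is_sos (\<sigma> I)" "f = (\<Sum>I\<in>Pow {..<length s}. \<sigma> I * (\<Prod>i\<in>I. s ! i))"
    "\<forall>I. is_sos (\<tau> I)" "g = (\<Sum>I\<in>Pow {..<length s}. \<tau> I * (\<Prod>i\<in>I. s ! i))"
    using assms unfolding preordering_def by blast
  then show ?thesis unfolding preordering_def
    by (intro CollectI exI[of _ "\<lambda>I. \<sigma> I + \<tau> I"]) (simp add: is_sos_add sum.distrib distrib_right)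
qed

lemma preordering_square_mult:
  assumes "f \<in> preordering s" shows "p\<^sup>2 * f \<in> preordering s"
proof -
  obtain \<sigma> where "\<forall>I. is_sos (\<sigma> I)" "f = (\<Sum>I\<in>Pow {..<length s}. \<sigma> I * (\<Prod>i\<in>I. s ! i))"
    using assms unfolding preordering_def by blast
  then show ?thesis unfolding preordering_def
    by (intro CollectI exI[of _ "\<lambda>I. p\<^sup>2 * \<sigma> I"]) (simp add: is_sos_square_mult sum_distrib_left mult.assoc)
qed

lemma preordering_gen_mult:
  assumes "f \<in> preordering s" "j < length s" shows "s ! j * f \<in> preordering s"
proof -
  let ?n = "length s"
  obtain \<sigma> where \<sigma>: "\<forall>I. is_sos (\<sigma> I)" "f = (\<Sum>I\<in>Pow {..<?n}. \<sigma> I * (\<Prod>i\<in>I. s ! i))"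
    using assms unfolding preordering_def by blast
  \<comment> \<open>Multiplying by s_j toggles j in the index set. If j was present, the factor
    s_j^2 arises and joins the sum of squares; \<open>\<tau>\<close> is indexed by the set after
    toggling.\<close>
  define t where "t I = (if j \<in> I then I - {j} else insert j I)" for I :: "nat set"
  define \<tau> where "\<tau> K = (if j \<in> K then \<sigma> (t K) else (s ! j)\<^sup>2 * \<sigma> (t K))" for K
  have tt: "t (t I) = I" for I by (auto simp: t_def)
  have tP: "t I \<in> Pow {..<?n}" if "I \<in> Pow {..<?n}" for I using that assms(2) by (auto simp: t_def)
  have "s ! j * f = (\<Sum>I\<in>Pow {..<?n}. s ! j * (\<sigma> I * (\<Prod>i\<in>I. s ! i)))"
    by (simp add: \<sigma>(2) sum_distrib_left)
  also have "\<dots> = (\<Sum>K\<in>Pow {..<?n}. \<tau> K * (\<Prod>i\<in>K. s ! i))"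
  proof (rule sum.reindex_bij_witness[of _ t t])
    fix I assume I: "I \<in> Pow {..<?n}"
    then have fin: "finite I" using finite_subset by blast
    show "\<tau> (t I) * (\<Prod>i\<in>t I. s ! i) = s ! j * (\<sigma> I * (\<Prod>i\<in>I. s ! i))"
    proof (cases "j \<in> I")
      case True
      then have "(\<Prod>i\<in>I. s ! i) = s ! j * (\<Prod>i\<in>I - {j}. s ! i)" using fin by (simp add: prod.remove)
      then show ?thesis using True unfolding \<tau>_def tt by (simp add: t_def power2_eq_square mult_ac)
    next
      case False
      then show ?thesis using fin unfolding \<tau>_def tt by (simp add: t_def mult_ac)
    qed
  qed (use tt tP in auto)
  finally have "s ! j * f = (\<Sum>K\<in>Pow {..<?n}. \<tau> K * (\<Prod>i\<in>K. s ! i))" .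
  moreover have "\<forall>K. is_sos (\<tau> K)" using \<sigma>(1) by (simp add: \<tau>_def is_sos_square_mult)
  ultimately show ?thesis unfolding preordering_def by blast
qed

lemma preordering_1: "1 \<in> preordering s"
  unfolding preordering_def
proof (intro CollectI exI[of _ "\<lambda>I. if I = {} then 1 else 0"] conjI allI)
  fix I :: "nat set"
  show "is_sos (if I = {} then 1 else 0)" using is_sos_0 is_sos_square[of 1] by simp
  have "(\<Sum>I\<in>Pow {..<length s}. (if I = {} then 1 else 0) * (\<Prod>i\<in>I. s ! i)) = (\<Sum>I\<in>Pow {..<length s}. if I = {} then 1 else 0)"
    by (intro sum.cong) auto
  then show "1 = (\<Sum>I\<in>Pow {..<length s}. (if I = {} then 1 else 0) * (\<Prod>i\<in>I. s ! i))" by simp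
qed

lemma preordering_square: "p\<^sup>2 \<in> preordering s"
  using preordering_square_mult[OF preordering_1] by simp

lemma preordering_po_mult:
  assumes "c \<in> po G" "\<And>g. g \<in> G \<Longrightarrow> liftx g \<in> set s" "f \<in> preordering s"
  shows "liftx c * f \<in> preordering s"
  using assms(1,3)
proof (induction c arbitrary: f rule: po.induct)
  case (gen g)
  then obtain j where "j < length s" "s ! j = liftx g" using assms(2) by (metis in_set_conv_nth)
  then show ?case using preordering_gen_mult gen by metis
next
  case (square p)
  have "liftx (p\<^sup>2) = (liftx p)\<^sup>2" by (simp add: liftx_def power2_eq_square)
  then show ?case using preordering_square_mult square by metis
next
  case (add p q)
  have "liftx (p + q) * f = liftx p * f + liftx q * f" by (simp add: liftx_def smult_add_left)
  then show ?case using preordering_add add by metis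
next
  case (mult p q)
  have "liftx (p * q) * f = liftx p * (liftx q * f)" by (simp add: liftx_def mult.commute)
  then show ?case using mult by metis
qed

lemma eval2_pcompose: "eval2 (pcompose f s) x y = eval2 f x (eval2 s x y)"
  by (induction f) (simp_all add: pcompose_pCons ev.hom_add ev.hom_mult)

section \<open>Return from the strip to the region above the graph\<close>

context intervals
begin

lemma set_natural_gens: "set (natural_gens k a b) = liftx ` gens"
proof -
  have "{[:- a (Suc i), 1:] * [:- b i, 1:] | i. Suc i < k} = (\<lambda>i. [:- a (Suc i), 1:] * [:- b i, 1:]) ` {0..<k - 1}"
    by (auto simp: less_diff_conv simp del: mult_pCons_left mult_pCons_right)
  then show ?thesis
    by (simp only: natural_gens_def gens_def set_append set_map set_upt list.set image_Un image_image image_insert image_empty)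
      auto
qed

text \<open>Taking the even part turns z^2 into the second variable, and replacing that by y - q
  undoes the shift. A summand c p^2 becomes c (A^2 + (y - q) B^2), with c generated by the natural
  generators and y - q the last one.\<close>

lemma half_strip_member:
  fixes q :: "real poly" and s :: "real poly poly list"
  assumes s: "s = natural_gens k a b @ [varY - liftx q]" and F: "F \<in> ycone C d"
  shows "pcompose (evp F) [:- q, 1:] \<in> preordering s"
  using F
proof (induction F rule: ycone.induct)
  case zero
  have "evp 0 = 0" by (rule poly_eqI) simp
  then show ?case using preordering_square[of 0 s] by simp
next
  case (step F c p)
  let ?r = "\<lambda>P. pcompose P [:- q, 1:]"
  have "varY - liftx q = [:- q, 1:]" by (simp add: varY_def liftx_def)
  then have last: "s ! length (natural_gens k a b) = [:- q, 1:]" by (simp add: s)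
  have "[:- q, 1:] * (?r (odp p))\<^sup>2 \<in> preordering s"
    using preordering_gen_mult[OF preordering_square, of "length (natural_gens k a b)" s "?r (odp p)"]
    by (simp only: last) (simp add: s)
  then have "(?r (evp p))\<^sup>2 + [:- q, 1:] * (?r (odp p))\<^sup>2 \<in> preordering s"
    using preordering_square by (intro preordering_add)
  then have "liftx c * ((?r (evp p))\<^sup>2 + [:- q, 1:] * (?r (odp p))\<^sup>2) \<in> preordering s"
    using step.hyps(2) by (intro preordering_po_mult[of c gens s]) (auto simp: s set_natural_gens)
  moreover have "?r (evp (smult c (p\<^sup>2))) = liftx c * ((?r (evp p))\<^sup>2 + [:- q, 1:] * (?r (odp p))\<^sup>2)"
    by (subst evp_smult_square, simp only: liftx_def pcompose_smult pcompose_add pcompose_mult power2_eq_square)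
       (simp add: pcompose_pCons)
  ultimately show ?case using step.IH by (simp only: evp_add pcompose_add preordering_add)
qed

theorem half_strip_saturated: "saturated (natural_gens k a b @ [varY - liftx q])"
  unfolding saturated_def
proof (intro allI impI)
  let ?s = "natural_gens k a b @ [varY - liftx q]"
  fix f assume f: "\<forall>(x, y)\<in>basic_set ?s. 0 \<le> eval2 f x y"
  have "eval2 (pcompose f [:q, 0, 1:]) x z \<ge> 0" if x: "x \<in> U" for x z
  proof -
    have "eval2 g x (poly q x + z\<^sup>2) \<ge> 0" if "g \<in> set ?s" for g
      using that gens_nonneg[OF _ x] by (auto simp: set_natural_gens liftx_def varY_def ev.hom_diff)
    then have "(x, poly q x + z\<^sup>2) \<in> basic_set ?s"
      unfolding basic_set_def using nth_mem by blast
    then show ?thesis using f by (auto simp: eval2_pcompose power2_eq_square)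
  qed
  then obtain d where d: "pcompose f [:q, 0, 1:] \<in> ycone C d" using psd_on_strip by blast
  have "pcompose [:q, 1:] ysq = [:q, 0, 1:]" by (simp add: pcompose_pCons)
  \<comment> \<open>The substituted polynomial has no odd part in z, so passing to the even part
    recovers f(x, q + y) exactly.\<close>
  then have "pcompose f [:q, 0, 1:] = pcompose (pcompose f [:q, 1:]) ysq + [:0, 1:] * pcompose 0 ysq"
    by (simp add: pcompose_assoc[symmetric])
  then have "evp (pcompose f [:q, 0, 1:]) = pcompose f [:q, 1:]" by (simp only: evp_unique)
  moreover have "pcompose (pcompose f [:q, 1:]) [:- q, 1:] = f"
  proof -
    have "pcompose [:q, 1:] [:- q, 1:] = [:0, 1:]" by (simp add: pcompose_pCons)
    then show ?thesis by (simp only: pcompose_assoc[symmetric] pcompose_idR)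
  qed
  ultimately show "f \<in> preordering ?s" using half_strip_member[OF refl d, of q] by simp
qed

end

theorem theorem4:
  fixes k :: nat and a b :: "nat \<Rightarrow> real" and q :: "real poly"
  assumes "k \<ge> 1"
    and "\<forall>i<k. a i \<le> b i"
    and "\<forall>i. Suc i < k \<longrightarrow> b i < a (Suc i)"
    and "\<forall>x\<in>(\<Union>i<k. {a i..b i}). poly q x \<ge> 0"
  shows "saturated (natural_gens k a b @ [varY - liftx q])"
proof -
  interpret intervals k a b using assms(1-3) by unfold_locales auto
  show ?thesis by (rule half_strip_saturated)
qed

end
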